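(* Let $\mathcal{A}$ and $\mathcal{B}$ be abelian categories and let $F:\mathcal{A}\to\mathcal{B}$ be a faithful additive functor with a left adjoint $L$ and a right adjoint $R$. Then the class of short exact sequences in $\mathcal{A}$ that become split short exact upon applying $F$ is an exact structure on $\mathcal{A}$ with enough projectives and enough injectives. If, moreover, the class $\mathcal{P}$ of projectives and the class of injectives with respect to this exact structure coincide, then there is a triangulated quotient $\underline{\mathcal{A}}_F=\mathcal{A}/\mathcal{P}$, and its triangles correspond to the $F$-split short exact sequences.
   Context: Exact structure is in the sense of Quillen (see Keller). An object $P$ is projective with respect to an exact structure if $\mathrm{Hom}(P,-)$ sends exact pairs to short exact sequences, and injective objects are defined dually; there are enough projectives if every $X$ fits into an exact pair $X'\to P\to X$ with $P$ projective, and enough injectives is the dual condition. A short exact sequence is $F$-split if it becomes split upon applying $F$. The quotient category $\mathcal{A}/\mathcal{P}$ has the objects of $\mathcal{A}$, and morphism sets $\mathrm{Hom}_{\mathcal{A}}(X,Y)$ modulo $f\sim g$ iff $f-g$ factors through an object of $\mathcal{P}$. The triangulated structure meant is the one given by Happel's theorem: for each $X$ choose an $F$-split short exact sequence $X\to I\to X[1]$ with $I$ injective for the exact structure; this defines the shift functor on the quotient. Each $F$-split short exact sequence $X\to Y\to Z$ gives a triangle $X\to Y\to Z\to X[1]$, where $Z\to X[1]$ is induced by an extension $Y\to I$ of $X\to I$ along $X\to Y$, and the distinguished triangles are those isomorphic in $\mathcal{A}/\mathcal{P}$ to triangles of this form. *)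

theory Defs
  imports "HOL-Algebra.Exact_Sequence"
begin

section \<open>Categories and functors\<close>

record ('o, 'm) category_data =
  Obj :: "'o set"
  Arr :: "'m set"
  Dom :: "'m \<Rightarrow> 'o"
  Cod :: "'m \<Rightarrow> 'o"
  Ident :: "'o \<Rightarrow> 'm"
  Comp :: "'m \<Rightarrow> 'm \<Rightarrow> 'm"  (infixr \<open>\<cdot>\<index>\<close> 70)

definition Hom :: "('o, 'm, 'z) category_data_scheme \<Rightarrow> 'o \<Rightarrow> 'o \<Rightarrow> 'm set" where
  "Hom C X Y = {f \<in> Arr C. Dom C f = X \<and> Cod C f = Y}"

text \<open>Composition is in the usual order, and is only meaningful on composable arrows.\<close>

locale category =
  fixes C :: "('o, 'm, 'z) category_data_scheme" (structure)
  assumes Dom_Obj: "f \<in> Arr C \<Longrightarrow> Dom C f \<in> Obj C"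
    and Cod_Obj: "f \<in> Arr C \<Longrightarrow> Cod C f \<in> Obj C"
    and Ident_Hom: "X \<in> Obj C \<Longrightarrow> Ident C X \<in> Hom C X X"
    and Comp_Hom: "\<lbrakk>f \<in> Hom C X Y; g \<in> Hom C Y Z\<rbrakk> \<Longrightarrow> g \<cdot> f \<in> Hom C X Z"
    and Comp_Ident: "f \<in> Hom C X Y \<Longrightarrow> f \<cdot> Ident C X = f"
    and Ident_Comp: "f \<in> Hom C X Y \<Longrightarrow> Ident C Y \<cdot> f = f"
    and Comp_assoc:
      "\<lbrakk>f \<in> Hom C W X; g \<in> Hom C X Y; h \<in> Hom C Y Z\<rbrakk> \<Longrightarrow> (h \<cdot> g) \<cdot> f = h \<cdot> (g \<cdot> f)"

definition is_iso :: "('o, 'm, 'z) category_data_scheme \<Rightarrow> 'm \<Rightarrow> bool" where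
  "is_iso C f \<longleftrightarrow> f \<in> Arr C \<and>
     (\<exists>g \<in> Hom C (Cod C f) (Dom C f).
        g \<cdot>\<^bsub>C\<^esub> f = Ident C (Dom C f) \<and> f \<cdot>\<^bsub>C\<^esub> g = Ident C (Cod C f))"

definition is_mono :: "('o, 'm, 'z) category_data_scheme \<Rightarrow> 'm \<Rightarrow> bool" where
  "is_mono C f \<longleftrightarrow> f \<in> Arr C \<and>
     (\<forall>W. \<forall>a \<in> Hom C W (Dom C f). \<forall>b \<in> Hom C W (Dom C f).
        f \<cdot>\<^bsub>C\<^esub> a = f \<cdot>\<^bsub>C\<^esub> b \<longrightarrow> a = b)"

definition is_epi :: "('o, 'm, 'z) category_data_scheme \<Rightarrow> 'm \<Rightarrow> bool" where
  "is_epi C f \<longleftrightarrow> f \<in> Arr C \<and>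
     (\<forall>W. \<forall>a \<in> Hom C (Cod C f) W. \<forall>b \<in> Hom C (Cod C f) W.
        a \<cdot>\<^bsub>C\<^esub> f = b \<cdot>\<^bsub>C\<^esub> f \<longrightarrow> a = b)"

definition zero_object :: "('o, 'm, 'z) category_data_scheme \<Rightarrow> 'o \<Rightarrow> bool" where
  "zero_object C Z \<longleftrightarrow> Z \<in> Obj C \<and>
     (\<forall>X \<in> Obj C. (\<exists>!f. f \<in> Hom C X Z) \<and> (\<exists>!f. f \<in> Hom C Z X))"

text \<open>\<open>is_pullback C a b f g\<close>: the square \<open>f \<cdot> a = g \<cdot> b\<close> is cartesian;
  \<open>is_pushout C f g a b\<close>: the square \<open>a \<cdot> f = b \<cdot> g\<close> is cocartesian.\<close>

definition is_pullback :: "('o, 'm, 'z) category_data_scheme \<Rightarrow> 'm \<Rightarrow> 'm \<Rightarrow> 'm \<Rightarrow> 'm \<Rightarrow> bool" where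
  "is_pullback C a b f g \<longleftrightarrow>
     a \<in> Arr C \<and> b \<in> Arr C \<and> f \<in> Arr C \<and> g \<in> Arr C \<and>
     Dom C a = Dom C b \<and> Cod C a = Dom C f \<and> Cod C b = Dom C g \<and> Cod C f = Cod C g \<and>
     f \<cdot>\<^bsub>C\<^esub> a = g \<cdot>\<^bsub>C\<^esub> b \<and>
     (\<forall>W. \<forall>s \<in> Hom C W (Dom C f). \<forall>t \<in> Hom C W (Dom C g). f \<cdot>\<^bsub>C\<^esub> s = g \<cdot>\<^bsub>C\<^esub> t \<longrightarrow>
        (\<exists>!k. k \<in> Hom C W (Dom C a) \<and> a \<cdot>\<^bsub>C\<^esub> k = s \<and> b \<cdot>\<^bsub>C\<^esub> k = t))"

definition is_pushout :: "('o, 'm, 'z) category_data_scheme \<Rightarrow> 'm \<Rightarrow> 'm \<Rightarrow> 'm \<Rightarrow> 'm \<Rightarrow> bool" where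
  "is_pushout C f g a b \<longleftrightarrow>
     a \<in> Arr C \<and> b \<in> Arr C \<and> f \<in> Arr C \<and> g \<in> Arr C \<and>
     Dom C f = Dom C g \<and> Cod C f = Dom C a \<and> Cod C g = Dom C b \<and> Cod C a = Cod C b \<and>
     a \<cdot>\<^bsub>C\<^esub> f = b \<cdot>\<^bsub>C\<^esub> g \<and>
     (\<forall>W. \<forall>s \<in> Hom C (Cod C f) W. \<forall>t \<in> Hom C (Cod C g) W. s \<cdot>\<^bsub>C\<^esub> f = t \<cdot>\<^bsub>C\<^esub> g \<longrightarrow>
        (\<exists>!k. k \<in> Hom C (Cod C a) W \<and> k \<cdot>\<^bsub>C\<^esub> a = s \<and> k \<cdot>\<^bsub>C\<^esub> b = t))"

record ('o, 'm, 'p, 'n) functor_data =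
  fobj :: "'o \<Rightarrow> 'p"
  farr :: "'m \<Rightarrow> 'n"

definition is_functor ::
  "('o, 'm, 'y) category_data_scheme \<Rightarrow> ('p, 'n, 'z) category_data_scheme
    \<Rightarrow> ('o, 'm, 'p, 'n) functor_data \<Rightarrow> bool" where
  "is_functor C D F \<longleftrightarrow> category C \<and> category D \<and>
     (\<forall>X \<in> Obj C. fobj F X \<in> Obj D) \<and>
     (\<forall>X Y. \<forall>f \<in> Hom C X Y. farr F f \<in> Hom D (fobj F X) (fobj F Y)) \<and>
     (\<forall>X \<in> Obj C. farr F (Ident C X) = Ident D (fobj F X)) \<and>
     (\<forall>X Y Z. \<forall>f \<in> Hom C X Y. \<forall>g \<in> Hom C Y Z.
        farr F (g \<cdot>\<^bsub>C\<^esub> f) = farr F g \<cdot>\<^bsub>D\<^esub> farr F f)"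

definition faithful ::
  "('o, 'm, 'y) category_data_scheme \<Rightarrow> ('o, 'm, 'p, 'n) functor_data \<Rightarrow> bool" where
  "faithful C F \<longleftrightarrow> (\<forall>X \<in> Obj C. \<forall>Y \<in> Obj C. inj_on (farr F) (Hom C X Y))"

definition id_functor :: "('o, 'm, 'o, 'm) functor_data" where
  "id_functor = \<lparr>fobj = (\<lambda>X. X), farr = (\<lambda>f. f)\<rparr>"

definition comp_functor ::
  "('p, 'n, 'q, 'k) functor_data \<Rightarrow> ('o, 'm, 'p, 'n) functor_data
    \<Rightarrow> ('o, 'm, 'q, 'k) functor_data" where
  "comp_functor G F = \<lparr>fobj = (\<lambda>X. fobj G (fobj F X)), farr = (\<lambda>f. farr G (farr F f))\<rparr>"

definition naturally_isomorphic ::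
  "('o, 'm, 'y) category_data_scheme \<Rightarrow> ('p, 'n, 'z) category_data_scheme
    \<Rightarrow> ('o, 'm, 'p, 'n) functor_data \<Rightarrow> ('o, 'm, 'p, 'n) functor_data \<Rightarrow> bool" where
  "naturally_isomorphic C D F G \<longleftrightarrow>
     (\<exists>\<eta>. (\<forall>X \<in> Obj C. \<eta> X \<in> Hom D (fobj F X) (fobj G X) \<and> is_iso D (\<eta> X)) \<and>
          (\<forall>X Y. \<forall>f \<in> Hom C X Y. \<eta> Y \<cdot>\<^bsub>D\<^esub> farr F f = farr G f \<cdot>\<^bsub>D\<^esub> \<eta> X))"

definition is_equivalence ::
  "('o, 'm, 'y) category_data_scheme \<Rightarrow> ('p, 'n, 'z) category_data_scheme
    \<Rightarrow> ('o, 'm, 'p, 'n) functor_data \<Rightarrow> bool" where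
  "is_equivalence C D F \<longleftrightarrow> is_functor C D F \<and>
     (\<exists>G. is_functor D C G \<and>
          naturally_isomorphic C C (comp_functor G F) id_functor \<and>
          naturally_isomorphic D D (comp_functor F G) id_functor)"

definition adjunction ::
  "('p, 'n, 'z) category_data_scheme \<Rightarrow> ('o, 'm, 'y) category_data_scheme
    \<Rightarrow> ('p, 'n, 'o, 'm) functor_data \<Rightarrow> ('o, 'm, 'p, 'n) functor_data
    \<Rightarrow> ('p \<Rightarrow> 'o \<Rightarrow> 'm \<Rightarrow> 'n) \<Rightarrow> bool" where
  "adjunction D C L G \<phi> \<longleftrightarrow> is_functor D C L \<and> is_functor C D G \<and>
     (\<forall>Y \<in> Obj D. \<forall>X \<in> Obj C.
        bij_betw (\<phi> Y X) (Hom C (fobj L Y) X) (Hom D Y (fobj G X))) \<and>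
     (\<forall>Y \<in> Obj D. \<forall>X \<in> Obj C. \<forall>Y' \<in> Obj D. \<forall>X' \<in> Obj C.
        \<forall>h \<in> Hom C (fobj L Y) X. \<forall>y \<in> Hom D Y' Y. \<forall>x \<in> Hom C X X'.
        \<phi> Y' X' (x \<cdot>\<^bsub>C\<^esub> h \<cdot>\<^bsub>C\<^esub> farr L y) = farr G x \<cdot>\<^bsub>D\<^esub> \<phi> Y X h \<cdot>\<^bsub>D\<^esub> y)"

text \<open>\<open>L : D \<rightarrow> C\<close> is left adjoint to \<open>G : C \<rightarrow> D\<close>.\<close>

definition adjoint ::
  "('p, 'n, 'z) category_data_scheme \<Rightarrow> ('o, 'm, 'y) category_data_scheme
    \<Rightarrow> ('p, 'n, 'o, 'm) functor_data \<Rightarrow> ('o, 'm, 'p, 'n) functor_data \<Rightarrow> bool" where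
  "adjoint D C L G \<longleftrightarrow> (\<exists>\<phi>. adjunction D C L G \<phi>)"


section \<open>Additive and abelian categories\<close>

record ('o, 'm) preadditive_data = "('o, 'm) category_data" +
  Add :: "'m \<Rightarrow> 'm \<Rightarrow> 'm"  (infixl \<open>\<boxplus>\<index>\<close> 65)
  Null :: "'o \<Rightarrow> 'o \<Rightarrow> 'm"

definition hom_group :: "('o, 'm, 'z) preadditive_data_scheme \<Rightarrow> 'o \<Rightarrow> 'o \<Rightarrow> 'm monoid" where
  "hom_group C X Y = \<lparr>carrier = Hom C X Y, mult = Add C, one = Null C X Y\<rparr>"

definition Neg :: "('o, 'm, 'z) preadditive_data_scheme \<Rightarrow> 'm \<Rightarrow> 'm" where
  "Neg C f = inv\<^bsub>hom_group C (Dom C f) (Cod C f)\<^esub> f"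

locale preadditive_category = category C
  for C :: "('o, 'm, 'z) preadditive_data_scheme" (structure) +
  assumes hom_comm_group: "\<lbrakk>X \<in> Obj C; Y \<in> Obj C\<rbrakk> \<Longrightarrow> comm_group (hom_group C X Y)"
    and Comp_Add_right: "\<lbrakk>f \<in> Hom C X Y; f' \<in> Hom C X Y; g \<in> Hom C Y Z\<rbrakk>
          \<Longrightarrow> g \<cdot> (f \<boxplus> f') = (g \<cdot> f) \<boxplus> (g \<cdot> f')"
    and Comp_Add_left: "\<lbrakk>f \<in> Hom C X Y; g \<in> Hom C Y Z; g' \<in> Hom C Y Z\<rbrakk>
          \<Longrightarrow> (g \<boxplus> g') \<cdot> f = (g \<cdot> f) \<boxplus> (g' \<cdot> f)"

locale additive_category = preadditive_category C
  for C :: "('o, 'm, 'z) preadditive_data_scheme" (structure) +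
  assumes ex_zero_object: "\<exists>Z. zero_object C Z"
    and ex_biproduct: "\<lbrakk>X \<in> Obj C; Y \<in> Obj C\<rbrakk> \<Longrightarrow>
      \<exists>S \<in> Obj C. \<exists>i \<in> Hom C X S. \<exists>j \<in> Hom C Y S. \<exists>p \<in> Hom C S X. \<exists>q \<in> Hom C S Y.
        p \<cdot> i = Ident C X \<and> q \<cdot> j = Ident C Y \<and> p \<cdot> j = Null C Y X \<and> q \<cdot> i = Null C X Y \<and>
        (i \<cdot> p) \<boxplus> (j \<cdot> q) = Ident C S"

definition is_kernel :: "('o, 'm, 'z) preadditive_data_scheme \<Rightarrow> 'm \<Rightarrow> 'm \<Rightarrow> bool" where
  "is_kernel C f g \<longleftrightarrow> f \<in> Arr C \<and> g \<in> Arr C \<and> Cod C f = Dom C g \<and>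
     g \<cdot>\<^bsub>C\<^esub> f = Null C (Dom C f) (Cod C g) \<and>
     (\<forall>W. \<forall>h \<in> Hom C W (Dom C g). g \<cdot>\<^bsub>C\<^esub> h = Null C W (Cod C g) \<longrightarrow>
        (\<exists>!k. k \<in> Hom C W (Dom C f) \<and> f \<cdot>\<^bsub>C\<^esub> k = h))"

definition is_cokernel :: "('o, 'm, 'z) preadditive_data_scheme \<Rightarrow> 'm \<Rightarrow> 'm \<Rightarrow> bool" where
  "is_cokernel C g f \<longleftrightarrow> f \<in> Arr C \<and> g \<in> Arr C \<and> Cod C f = Dom C g \<and>
     g \<cdot>\<^bsub>C\<^esub> f = Null C (Dom C f) (Cod C g) \<and>
     (\<forall>W. \<forall>h \<in> Hom C (Cod C f) W. h \<cdot>\<^bsub>C\<^esub> f = Null C (Dom C f) W \<longrightarrow>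
        (\<exists>!k. k \<in> Hom C (Cod C g) W \<and> k \<cdot>\<^bsub>C\<^esub> g = h))"

locale abelian_category = additive_category C
  for C :: "('o, 'm, 'z) preadditive_data_scheme" (structure) +
  assumes ex_kernel: "g \<in> Arr C \<Longrightarrow> \<exists>f. is_kernel C f g"
    and ex_cokernel: "f \<in> Arr C \<Longrightarrow> \<exists>g. is_cokernel C g f"
    and mono_normal: "is_mono C f \<Longrightarrow> \<exists>g. is_kernel C f g"
    and epi_normal: "is_epi C g \<Longrightarrow> \<exists>f. is_cokernel C g f"

definition additive_functor ::
  "('o, 'm, 'y) preadditive_data_scheme \<Rightarrow> ('p, 'n, 'z) preadditive_data_scheme
    \<Rightarrow> ('o, 'm, 'p, 'n) functor_data \<Rightarrow> bool" where
  "additive_functor C D F \<longleftrightarrow> is_functor C D F \<and>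
     (\<forall>X Y. \<forall>f \<in> Hom C X Y. \<forall>g \<in> Hom C X Y.
        farr F (f \<boxplus>\<^bsub>C\<^esub> g) = farr F f \<boxplus>\<^bsub>D\<^esub> farr F g)"

text \<open>Short exact sequences \<open>X \<rightarrow> Y \<rightarrow> Z\<close> are kernel-cokernel pairs, and are represented by the
  pair of their arrows.\<close>

definition short_exact :: "('o, 'm, 'z) preadditive_data_scheme \<Rightarrow> 'm \<Rightarrow> 'm \<Rightarrow> bool" where
  "short_exact C f g \<longleftrightarrow> is_kernel C f g \<and> is_cokernel C g f"

definition split_short_exact :: "('o, 'm, 'z) preadditive_data_scheme \<Rightarrow> 'm \<Rightarrow> 'm \<Rightarrow> bool" where
  "split_short_exact C f g \<longleftrightarrow> short_exact C f g \<and>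
     (\<exists>s \<in> Hom C (Cod C g) (Dom C g). g \<cdot>\<^bsub>C\<^esub> s = Ident C (Cod C g))"

definition F_split ::
  "('o, 'm, 'y) preadditive_data_scheme \<Rightarrow> ('p, 'n, 'z) preadditive_data_scheme
    \<Rightarrow> ('o, 'm, 'p, 'n) functor_data \<Rightarrow> ('m \<times> 'm) set" where
  "F_split A B F = {(f, g). short_exact A f g \<and> split_short_exact B (farr F f) (farr F g)}"


section \<open>Exact structures\<close>

definition inflations :: "('m \<times> 'm) set \<Rightarrow> 'm set" where
  "inflations E = {f. \<exists>g. (f, g) \<in> E}"

definition deflations :: "('m \<times> 'm) set \<Rightarrow> 'm set" where
  "deflations E = {g. \<exists>f. (f, g) \<in> E}"

text \<open>Keller's version of Quillen's axioms, stated self-dually.\<close>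

locale exact_structure = additive_category C
  for C :: "('o, 'm, 'z) preadditive_data_scheme" (structure)
    and E :: "('m \<times> 'm) set" +
  assumes exact_pair: "(f, g) \<in> E \<Longrightarrow> is_kernel C f g \<and> is_cokernel C g f"
    and iso_closed: "\<lbrakk>(f, g) \<in> E; is_iso C a; is_iso C b; is_iso C c;
        f' \<in> Hom C (Cod C a) (Cod C b); g' \<in> Hom C (Cod C b) (Cod C c);
        Dom C a = Dom C f; Dom C b = Cod C f; Dom C c = Cod C g;
        f' \<cdot> a = b \<cdot> f; g' \<cdot> b = c \<cdot> g\<rbrakk> \<Longrightarrow> (f', g') \<in> E"
    and zero_deflation: "zero_object C Z \<Longrightarrow> Ident C Z \<in> deflations E"
    and zero_inflation: "zero_object C Z \<Longrightarrow> Ident C Z \<in> inflations E"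
    and deflation_Comp: "\<lbrakk>d \<in> deflations E; d' \<in> deflations E; Cod C d = Dom C d'\<rbrakk>
        \<Longrightarrow> d' \<cdot> d \<in> deflations E"
    and inflation_Comp: "\<lbrakk>i \<in> inflations E; i' \<in> inflations E; Cod C i = Dom C i'\<rbrakk>
        \<Longrightarrow> i' \<cdot> i \<in> inflations E"
    and deflation_pullback: "\<lbrakk>d \<in> deflations E; f \<in> Arr C; Cod C f = Cod C d\<rbrakk>
        \<Longrightarrow> \<exists>d' f'. is_pullback C d' f' f d \<and> d' \<in> deflations E"
    and inflation_pushout: "\<lbrakk>i \<in> inflations E; f \<in> Arr C; Dom C f = Dom C i\<rbrakk>
        \<Longrightarrow> \<exists>i' f'. is_pushout C f i i' f' \<and> i' \<in> inflations E"

text \<open>\<^const>\<open>exact_seq\<close> lists the groups and maps from right to left and expresses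
  exactness at the inner terms only, so injectivity and surjectivity are added.\<close>

definition short_exact_groups ::
  "'g monoid \<Rightarrow> 'g monoid \<Rightarrow> 'g monoid \<Rightarrow> ('g \<Rightarrow> 'g) \<Rightarrow> ('g \<Rightarrow> 'g) \<Rightarrow> bool" where
  "short_exact_groups G H K \<alpha> \<beta> \<longleftrightarrow> exact_seq ([K, H, G], [\<beta>, \<alpha>]) \<and>
     inj_on \<alpha> (carrier G) \<and> \<beta> ` carrier H = carrier K"

definition projectives ::
  "('o, 'm, 'z) preadditive_data_scheme \<Rightarrow> ('m \<times> 'm) set \<Rightarrow> 'o set" where
  "projectives C E = {P \<in> Obj C. \<forall>(f, g) \<in> E.
     short_exact_groups (hom_group C P (Dom C f)) (hom_group C P (Cod C f))
       (hom_group C P (Cod C g)) (\<lambda>h. f \<cdot>\<^bsub>C\<^esub> h) (\<lambda>h. g \<cdot>\<^bsub>C\<^esub> h)}"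

definition injectives ::
  "('o, 'm, 'z) preadditive_data_scheme \<Rightarrow> ('m \<times> 'm) set \<Rightarrow> 'o set" where
  "injectives C E = {I \<in> Obj C. \<forall>(f, g) \<in> E.
     short_exact_groups (hom_group C (Cod C g) I) (hom_group C (Cod C f) I)
       (hom_group C (Dom C f) I) (\<lambda>h. h \<cdot>\<^bsub>C\<^esub> g) (\<lambda>h. h \<cdot>\<^bsub>C\<^esub> f)}"

definition enough_projectives ::
  "('o, 'm, 'z) preadditive_data_scheme \<Rightarrow> ('m \<times> 'm) set \<Rightarrow> bool" where
  "enough_projectives C E \<longleftrightarrow>
     (\<forall>X \<in> Obj C. \<exists>(f, g) \<in> E. Dom C g \<in> projectives C E \<and> Cod C g = X)"

definition enough_injectives ::
  "('o, 'm, 'z) preadditive_data_scheme \<Rightarrow> ('m \<times> 'm) set \<Rightarrow> bool" where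
  "enough_injectives C E \<longleftrightarrow>
     (\<forall>X \<in> Obj C. \<exists>(f, g) \<in> E. Dom C f = X \<and> Cod C f \<in> injectives C E)"


section \<open>The quotient category\<close>

definition factors_through ::
  "('o, 'm, 'z) category_data_scheme \<Rightarrow> 'o set \<Rightarrow> 'm \<Rightarrow> bool" where
  "factors_through C \<P> h \<longleftrightarrow>
     (\<exists>P \<in> \<P>. \<exists>a \<in> Hom C (Dom C h) P. \<exists>b \<in> Hom C P (Cod C h). h = b \<cdot>\<^bsub>C\<^esub> a)"

definition quot_rel ::
  "('o, 'm, 'z) preadditive_data_scheme \<Rightarrow> 'o set \<Rightarrow> 'm rel" where
  "quot_rel C \<P> = {(f, g). f \<in> Arr C \<and> g \<in> Hom C (Dom C f) (Cod C f) \<and>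
     factors_through C \<P> (f \<boxplus>\<^bsub>C\<^esub> Neg C g)}"

definition quot_class ::
  "('o, 'm, 'z) preadditive_data_scheme \<Rightarrow> 'o set \<Rightarrow> 'm \<Rightarrow> 'm set" where
  "quot_class C \<P> f = quot_rel C \<P> `` {f}"

text \<open>An arrow of the quotient is a whole equivalence class. The operations take the union of
  the classes obtained from all representatives, which is a single class when they are
  independent of representatives.\<close>

definition quot_category ::
  "('o, 'm, 'z) preadditive_data_scheme \<Rightarrow> 'o set \<Rightarrow> ('o, 'm set) preadditive_data" where
  "quot_category C \<P> =
     \<lparr>Obj = Obj C,
      Arr = Arr C // quot_rel C \<P>,
      Dom = (\<lambda>\<phi>. Dom C (SOME f. f \<in> \<phi>)),
      Cod = (\<lambda>\<phi>. Cod C (SOME f. f \<in> \<phi>)),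
      Ident = (\<lambda>X. quot_class C \<P> (Ident C X)),
      Comp = (\<lambda>\<psi> \<phi>. \<Union>g \<in> \<psi>. \<Union>f \<in> \<phi>. quot_class C \<P> (g \<cdot>\<^bsub>C\<^esub> f)),
      Add = (\<lambda>\<phi> \<psi>. \<Union>f \<in> \<phi>. \<Union>g \<in> \<psi>. quot_class C \<P> (f \<boxplus>\<^bsub>C\<^esub> g)),
      Null = (\<lambda>X Y. quot_class C \<P> (Null C X Y))\<rparr>"

definition quot_functor ::
  "('o, 'm, 'z) preadditive_data_scheme \<Rightarrow> 'o set \<Rightarrow> ('o, 'm, 'o, 'm set) functor_data" where
  "quot_functor C \<P> = \<lparr>fobj = (\<lambda>X. X), farr = quot_class C \<P>\<rparr>"


section \<open>Triangulated categories\<close>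

text \<open>A candidate triangle \<open>X \<rightarrow> Y \<rightarrow> Z \<rightarrow> S X\<close> is represented by its three arrows.\<close>

type_synonym 'm triangle = "'m \<times> 'm \<times> 'm"

definition is_triangle ::
  "('o, 'm, 'z) category_data_scheme \<Rightarrow> ('o, 'm, 'o, 'm) functor_data \<Rightarrow> 'm triangle \<Rightarrow> bool" where
  "is_triangle T S = (\<lambda>(u, v, w). u \<in> Arr T \<and> v \<in> Arr T \<and> w \<in> Arr T \<and>
     Cod T u = Dom T v \<and> Cod T v = Dom T w \<and> Cod T w = fobj S (Dom T u))"

definition triangle_map ::
  "('o, 'm, 'z) category_data_scheme \<Rightarrow> ('o, 'm, 'o, 'm) functor_data
    \<Rightarrow> 'm triangle \<Rightarrow> 'm triangle \<Rightarrow> 'm \<Rightarrow> 'm \<Rightarrow> 'm \<Rightarrow> bool" where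
  "triangle_map T S = (\<lambda>(u, v, w) (u', v', w') a b c.
     a \<in> Hom T (Dom T u) (Dom T u') \<and> b \<in> Hom T (Dom T v) (Dom T v') \<and>
     c \<in> Hom T (Dom T w) (Dom T w') \<and>
     b \<cdot>\<^bsub>T\<^esub> u = u' \<cdot>\<^bsub>T\<^esub> a \<and> c \<cdot>\<^bsub>T\<^esub> v = v' \<cdot>\<^bsub>T\<^esub> b \<and> farr S a \<cdot>\<^bsub>T\<^esub> w = w' \<cdot>\<^bsub>T\<^esub> c)"

definition triangle_iso ::
  "('o, 'm, 'z) category_data_scheme \<Rightarrow> ('o, 'm, 'o, 'm) functor_data
    \<Rightarrow> 'm triangle \<Rightarrow> 'm triangle \<Rightarrow> bool" where
  "triangle_iso T S t t' \<longleftrightarrow> is_triangle T S t \<and> is_triangle T S t' \<and>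
     (\<exists>a b c. triangle_map T S t t' a b c \<and> is_iso T a \<and> is_iso T b \<and> is_iso T c)"

text \<open>The shift is required to be an autoequivalence, not an automorphism, of the category.\<close>

locale triangulated_category = additive_category T
  for T :: "('o, 'm, 'z) preadditive_data_scheme" (structure)
    and S :: "('o, 'm, 'o, 'm) functor_data"
    and \<Delta> :: "'m triangle set" +
  assumes shift_additive: "additive_functor T T S"
    and shift_equivalence: "is_equivalence T T S"
    and dist_is_triangle: "t \<in> \<Delta> \<Longrightarrow> is_triangle T S t"
    and dist_iso_closed: "\<lbrakk>t \<in> \<Delta>; triangle_iso T S t t'\<rbrakk> \<Longrightarrow> t' \<in> \<Delta>"
    and dist_Ident: "\<lbrakk>X \<in> Obj T; zero_object T Z\<rbrakk>
        \<Longrightarrow> (Ident T X, Null T X Z, Null T Z (fobj S X)) \<in> \<Delta>"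
    and dist_cone: "u \<in> Arr T \<Longrightarrow> \<exists>v w. (u, v, w) \<in> \<Delta>"
    and dist_rotate: "is_triangle T S (u, v, w) \<Longrightarrow>
        (u, v, w) \<in> \<Delta> \<longleftrightarrow> (v, w, Neg T (farr S u)) \<in> \<Delta>"
    and dist_fill: "\<lbrakk>(u, v, w) \<in> \<Delta>; (u', v', w') \<in> \<Delta>;
        a \<in> Hom T (Dom T u) (Dom T u'); b \<in> Hom T (Dom T v) (Dom T v'); b \<cdot> u = u' \<cdot> a\<rbrakk>
        \<Longrightarrow> \<exists>c. triangle_map T S (u, v, w) (u', v', w') a b c"
    and octahedral: "\<lbrakk>Cod T u = Dom T v; (u, j, k) \<in> \<Delta>; (v, l, i) \<in> \<Delta>; (v \<cdot> u, m, n) \<in> \<Delta>\<rbrakk>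
        \<Longrightarrow> \<exists>f \<in> Hom T (Cod T j) (Cod T m). \<exists>g \<in> Hom T (Cod T m) (Cod T l).
              (f, g, farr S j \<cdot> i) \<in> \<Delta> \<and>
              f \<cdot> j = m \<cdot> v \<and> n \<cdot> f = k \<and> g \<cdot> m = l \<and> i \<cdot> g = farr S u \<cdot> n"


section \<open>Happel's structure on the quotient\<close>

text \<open>A choice \<open>c\<close> assigns to each \<open>X\<close> an exact pair \<open>c X = (\<iota>, \<pi>)\<close>,
  \<open>X \<rightarrow> I \<rightarrow> X[1]\<close>, with \<open>I\<close> injective.\<close>

definition injective_choice ::
  "('o, 'm, 'z) preadditive_data_scheme \<Rightarrow> ('m \<times> 'm) set \<Rightarrow> ('o \<Rightarrow> 'm \<times> 'm) \<Rightarrow> bool" where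
  "injective_choice C E c \<longleftrightarrow>
     (\<forall>X \<in> Obj C. c X \<in> E \<and> Dom C (fst (c X)) = X \<and> Cod C (fst (c X)) \<in> injectives C E)"

text \<open>\<open>induces C a (f, g) (f', g') h\<close>: there is a commutative diagram with rows
  \<open>(f, g)\<close> and \<open>(f', g')\<close> and outer vertical arrows \<open>a\<close> and \<open>h\<close>.
  With bottom row \<open>c Y\<close> this gives both the shift of an arrow \<open>a : X \<rightarrow> Y\<close>
  (top row \<open>c X\<close>) and, with \<open>a\<close> an identity, the third arrow of a triangle.\<close>

definition induces ::
  "('o, 'm, 'z) preadditive_data_scheme \<Rightarrow> 'm \<Rightarrow> 'm \<times> 'm \<Rightarrow> 'm \<times> 'm \<Rightarrow> 'm \<Rightarrow> bool" where
  "induces C a = (\<lambda>(f, g) (f', g') h. a \<in> Hom C (Dom C f) (Dom C f') \<and>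
     h \<in> Hom C (Cod C g) (Cod C g') \<and>
     (\<exists>e \<in> Hom C (Cod C f) (Cod C f'). e \<cdot>\<^bsub>C\<^esub> f = f' \<cdot>\<^bsub>C\<^esub> a \<and> h \<cdot>\<^bsub>C\<^esub> g = g' \<cdot>\<^bsub>C\<^esub> e))"

definition shift_functor ::
  "('o, 'm, 'z) preadditive_data_scheme \<Rightarrow> 'o set \<Rightarrow> ('o \<Rightarrow> 'm \<times> 'm)
    \<Rightarrow> ('o, 'm set, 'o, 'm set) functor_data" where
  "shift_functor C \<P> c =
     \<lparr>fobj = (\<lambda>X. Cod C (snd (c X))),
      farr = (\<lambda>\<phi>. \<Union>a \<in> \<phi>. \<Union>h \<in> {h. induces C a (c (Dom C a)) (c (Cod C a)) h}.
                quot_class C \<P> h)\<rparr>"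

definition standard_triangles ::
  "('o, 'm, 'z) preadditive_data_scheme \<Rightarrow> ('m \<times> 'm) set \<Rightarrow> 'o set \<Rightarrow> ('o \<Rightarrow> 'm \<times> 'm)
    \<Rightarrow> 'm set triangle set" where
  "standard_triangles C E \<P> c =
     {(quot_class C \<P> f, quot_class C \<P> g, quot_class C \<P> h) | f g h.
        (f, g) \<in> E \<and> induces C (Ident C (Dom C f)) (f, g) (c (Dom C f)) h}"

definition distinguished_triangles ::
  "('o, 'm, 'z) preadditive_data_scheme \<Rightarrow> ('m \<times> 'm) set \<Rightarrow> 'o set \<Rightarrow> ('o \<Rightarrow> 'm \<times> 'm)
    \<Rightarrow> 'm set triangle set" where
  "distinguished_triangles C E \<P> c =
     {t. \<exists>s \<in> standard_triangles C E \<P> c.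
           triangle_iso (quot_category C \<P>) (shift_functor C \<P> c) s t}"

end

theory Submission
  imports Defs
begin

text \<open>
  Since \<open>F\<close> is faithful and a right adjoint, it reflects epimorphisms and preserves kernels, so the
  deflations of the \<open>F\<close>-split structure are exactly the arrows \<open>g\<close> such that \<open>F g\<close> is a split
  epimorphism; this class is visibly closed under composition and pullback. The objects \<open>L Y\<close> are
  projective and the counits \<open>L (F X) \<rightarrow> X\<close> are deflations. The statements about inflations and injectives
  follow by passing to the opposite categories, where \<open>R\<close> is a left adjoint of \<open>F\<close>.

  For the triangulation, the basic fact is that in a map of exact pairs whose target has an injective
  middle term, the right-hand arrow is determined in the quotient by the left-hand one, and dually.
  Every compatibility in Happel's axioms is obtained by exhibiting two maps of exact pairs with the
  same left-hand arrow.
\<close>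

section \<open>Calculus in preadditive categories\<close>

text \<open>What drives the triangulation is cancellation: if \<open>i' \<cdot> i\<close> is an
  inflation, so is \<open>i\<close>. Hence any arrow X \<rightarrow> Y turns into an inflation X
  \<rightarrow> Y \<oplus> I once a component X \<rightarrow> I of a chosen row is added, and since
  I vanishes in the quotient, questions about arbitrary arrows become questions about genuine exact
  pairs.

  Two obstacles shape the rest. No long exact Hom sequences are set up, so the five lemma for
  triangles rests on a weak cokernel property and a square-zero argument instead. And the shift is
  an equivalence, not an automorphism, so triangles cannot simply be rotated backwards: the converse
  of rotation is recovered from repeated forward rotation and full faithfulness of the shift. The
  coincidence of projectives and injectives is what makes the shift invertible, because the middle
  terms of the chosen rows then allow lifting as well as extending. The octahedral axiom is the
  third isomorphism theorem for two composable inflations, transported along comparison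
  isomorphisms.\<close>

lemma in_Hom: "f \<in> Hom C X Y \<longleftrightarrow> f \<in> Arr C \<and> Dom C f = X \<and> Cod C f = Y"
  by (simp add: Hom_def)

context category
begin

lemmas Dom_Obj [simp] = Dom_Obj and Cod_Obj [simp] = Cod_Obj

lemma Ident_Arr [simp]:
  assumes "X \<in> Obj C"
  shows "Ident C X \<in> Arr C" "Dom C (Ident C X) = X" "Cod C (Ident C X) = X"
  using Ident_Hom[OF assms] by (simp_all add: in_Hom)

text \<open>The locale axioms speak of \<open>Hom\<close> sets; restated with equations for domain
  and codomain they let the simplifier discharge the typing conditions of composites.\<close>

lemma Comp_Arr [simp]:
  assumes "f \<in> Arr C" "g \<in> Arr C" "Cod C f = Dom C g"
  shows "g \<cdot> f \<in> Arr C" "Dom C (g \<cdot> f) = Dom C f" "Cod C (g \<cdot> f) = Cod C g"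
  using Comp_Hom[of f "Dom C f" "Dom C g" g "Cod C g"] assms by (simp_all add: in_Hom)

lemma Comp_Ident' [simp]: "\<lbrakk>f \<in> Arr C; Dom C f = X\<rbrakk> \<Longrightarrow> f \<cdot> Ident C X = f"
  using Comp_Ident[of f X "Cod C f"] by (simp add: in_Hom)

lemma Ident_Comp' [simp]: "\<lbrakk>f \<in> Arr C; Cod C f = X\<rbrakk> \<Longrightarrow> Ident C X \<cdot> f = f"
  using Ident_Comp[of f "Dom C f" X] by (simp add: in_Hom)

lemma Comp_assoc' [simp]:
  "\<lbrakk>f \<in> Arr C; g \<in> Arr C; h \<in> Arr C; Cod C f = Dom C g; Cod C g = Dom C h\<rbrakk>
    \<Longrightarrow> (h \<cdot> g) \<cdot> f = h \<cdot> (g \<cdot> f)"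
  using Comp_assoc[of f "Dom C f" "Dom C g" g "Dom C h" h "Cod C h"] by (simp add: in_Hom)

text \<open>Simplification brackets composites to the right, where an equation for
  \<open>g \<cdot> f\<close> no longer matches. This form applies such an equation inside a longer
  composite.\<close>

lemma Comp_reassoc:
  "\<lbrakk>g \<cdot> f = k; f \<in> Arr C; g \<in> Arr C; x \<in> Arr C; Cod C f = Dom C g; Cod C x = Dom C f\<rbrakk>
    \<Longrightarrow> g \<cdot> (f \<cdot> x) = k \<cdot> x"
  by (metis Comp_assoc')

lemma is_isoI:
  "\<lbrakk>f \<in> Hom C X Y; g \<in> Hom C Y X; g \<cdot> f = Ident C X; f \<cdot> g = Ident C Y\<rbrakk> \<Longrightarrow> is_iso C f"
  by (auto simp: is_iso_def Ball_def Bex_def in_Hom)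

lemma is_isoE:
  assumes "is_iso C f"
  obtains g where "f \<in> Arr C" "g \<in> Arr C" "Dom C g = Cod C f" "Cod C g = Dom C f"
    "g \<cdot> f = Ident C (Dom C f)" "f \<cdot> g = Ident C (Cod C f)" "is_iso C g"
  using assms is_isoI[of _ "Cod C f" "Dom C f" f] unfolding is_iso_def[of C f] by (auto simp: in_Hom)

lemma is_iso_Ident [simp]: "X \<in> Obj C \<Longrightarrow> is_iso C (Ident C X)"
  by (rule is_isoI[of _ X X "Ident C X"]) (simp_all add: in_Hom)

lemma is_iso_Comp [simp]:
  assumes "is_iso C f" "is_iso C g" "Cod C f = Dom C g"
  shows "is_iso C (g \<cdot> f)"
proof -
  obtain f' where f: "f \<in> Arr C" "f' \<in> Arr C" "Dom C f' = Cod C f" "Cod C f' = Dom C f"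
    "f' \<cdot> f = Ident C (Dom C f)" "f \<cdot> f' = Ident C (Cod C f)"
    using is_isoE[OF assms(1)] by metis
  obtain g' where g: "g \<in> Arr C" "g' \<in> Arr C" "Dom C g' = Cod C g" "Cod C g' = Dom C g"
    "g' \<cdot> g = Ident C (Dom C g)" "g \<cdot> g' = Ident C (Cod C g)"
    using is_isoE[OF assms(2)] by metis
  show ?thesis
    by (rule is_isoI[of _ "Dom C f" "Cod C g" "f' \<cdot> g'"])
      (use f g assms(3) in \<open>simp_all add: in_Hom Comp_reassoc[OF f(5)] Comp_reassoc[OF g(5)]
          Comp_reassoc[OF f(6)] Comp_reassoc[OF g(6)]\<close>)
qed

end

context preadditive_category
begin

lemma Null_Arr [simp]:
  assumes "X \<in> Obj C" "Y \<in> Obj C"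
  shows "Null C X Y \<in> Arr C" "Dom C (Null C X Y) = X" "Cod C (Null C X Y) = Y"
proof -
  interpret G: comm_group "hom_group C X Y" using assms by (rule hom_comm_group)
  show "Null C X Y \<in> Arr C" "Dom C (Null C X Y) = X" "Cod C (Null C X Y) = Y"
    using G.one_closed by (simp_all add: hom_group_def Ball_def Bex_def in_Hom)
qed

lemma Add_Arr [simp]:
  assumes "f \<in> Arr C" "g \<in> Arr C" "Dom C f = Dom C g" "Cod C f = Cod C g"
  shows "f \<boxplus> g \<in> Arr C" "Dom C (f \<boxplus> g) = Dom C g" "Cod C (f \<boxplus> g) = Cod C g"
proof -
  interpret G: comm_group "hom_group C (Dom C g) (Cod C g)" using assms by (simp add: hom_comm_group)
  show "f \<boxplus> g \<in> Arr C" "Dom C (f \<boxplus> g) = Dom C g" "Cod C (f \<boxplus> g) = Cod C g"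
    using G.m_closed[of f g] assms by (simp_all add: hom_group_def Ball_def Bex_def in_Hom)
qed

lemma Neg_Arr [simp]:
  assumes "f \<in> Arr C"
  shows "Neg C f \<in> Arr C" "Dom C (Neg C f) = Dom C f" "Cod C (Neg C f) = Cod C f"
proof -
  interpret G: comm_group "hom_group C (Dom C f) (Cod C f)" using assms by (simp add: hom_comm_group)
  show "Neg C f \<in> Arr C" "Dom C (Neg C f) = Dom C f" "Cod C (Neg C f) = Cod C f"
    using G.inv_closed[of f] assms by (simp_all add: hom_group_def Ball_def Bex_def in_Hom Neg_def)
qed

lemma Add_assoc:
  assumes "f \<in> Arr C" "g \<in> Arr C" "h \<in> Arr C" "Dom C f = Dom C g" "Cod C f = Cod C g"
    "Dom C g = Dom C h" "Cod C g = Cod C h"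
  shows "(f \<boxplus> g) \<boxplus> h = f \<boxplus> (g \<boxplus> h)"
proof -
  interpret G: comm_group "hom_group C (Dom C h) (Cod C h)" using assms by (simp add: hom_comm_group)
  show ?thesis
    using G.m_assoc[of f g h] assms by (simp_all add: hom_group_def Ball_def Bex_def in_Hom)
qed

lemma Add_commute:
  assumes "f \<in> Arr C" "g \<in> Arr C" "Dom C f = Dom C g" "Cod C f = Cod C g"
  shows "f \<boxplus> g = g \<boxplus> f"
proof -
  interpret G: comm_group "hom_group C (Dom C g) (Cod C g)" using assms by (simp add: hom_comm_group)
  show ?thesis
    using G.m_comm[of f g] assms by (simp_all add: hom_group_def Ball_def Bex_def in_Hom)
qed

lemma Add_left_commute:
  assumes "f \<in> Arr C" "g \<in> Arr C" "h \<in> Arr C" "Dom C f = Dom C g" "Cod C f = Cod C g"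
    "Dom C g = Dom C h" "Cod C g = Cod C h"
  shows "f \<boxplus> (g \<boxplus> h) = g \<boxplus> (f \<boxplus> h)"
  using Add_assoc[of f g h] Add_assoc[of g f h] Add_commute[of f g] assms by simp

lemmas Add_ac = Add_assoc Add_commute Add_left_commute

lemma Null_Add [simp]: "\<lbrakk>f \<in> Arr C; Dom C f = X; Cod C f = Y\<rbrakk> \<Longrightarrow> Null C X Y \<boxplus> f = f"
proof -
  assume a: "f \<in> Arr C" "Dom C f = X" "Cod C f = Y"
  interpret G: comm_group "hom_group C X Y" using a by (auto intro!: hom_comm_group)
  show ?thesis
    using G.l_one[of f] a by (simp_all add: hom_group_def Ball_def Bex_def in_Hom)
qed

lemma Add_Null [simp]: "\<lbrakk>f \<in> Arr C; Dom C f = X; Cod C f = Y\<rbrakk> \<Longrightarrow> f \<boxplus> Null C X Y = f"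
  using Null_Add[of f X Y] Add_commute[of f "Null C X Y"] Dom_Obj[of f] Cod_Obj[of f] by simp

lemma Neg_Add [simp]: "f \<in> Arr C \<Longrightarrow> Neg C f \<boxplus> f = Null C (Dom C f) (Cod C f)"
proof -
  assume a: "f \<in> Arr C"
  interpret G: comm_group "hom_group C (Dom C f) (Cod C f)" using a by (auto intro!: hom_comm_group)
  show ?thesis
    using G.l_inv[of f] a by (simp_all add: hom_group_def Ball_def Bex_def in_Hom Neg_def)
qed

lemma Add_Neg [simp]: "f \<in> Arr C \<Longrightarrow> f \<boxplus> Neg C f = Null C (Dom C f) (Cod C f)"
  using Neg_Add[of f] Add_commute[of f "Neg C f"] by simp

lemma Add_cancel:
  assumes "f \<in> Arr C" "g \<in> Arr C" "Dom C f = Dom C g" "Cod C f = Cod C g"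
  shows "f \<boxplus> (Neg C f \<boxplus> g) = g" "Neg C f \<boxplus> (f \<boxplus> g) = g"
  using assms by (simp_all add: Add_assoc[symmetric])

lemma Add_Neg_eq_Null_iff:
  assumes "f \<in> Arr C" "g \<in> Arr C" "Dom C f = Dom C g" "Cod C f = Cod C g"
  shows "f \<boxplus> Neg C g = Null C (Dom C g) (Cod C g) \<longleftrightarrow> f = g"
proof
  assume "f \<boxplus> Neg C g = Null C (Dom C g) (Cod C g)"
  hence "(f \<boxplus> Neg C g) \<boxplus> g = g" using assms by simp
  thus "f = g" using assms by (simp add: Add_assoc)
qed (use assms in simp)

lemma Add_left_cancel:
  assumes "f \<in> Arr C" "g \<in> Arr C" "h \<in> Arr C" "Dom C f = Dom C g" "Cod C f = Cod C g"
    "Dom C g = Dom C h" "Cod C g = Cod C h" "f \<boxplus> g = f \<boxplus> h"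
  shows "g = h"
  by (metis assms Add_cancel(2))

lemma Neg_unique:
  assumes "f \<in> Arr C" "g \<in> Arr C" "Dom C f = Dom C g" "Cod C f = Cod C g"
    "f \<boxplus> g = Null C (Dom C g) (Cod C g)"
  shows "Neg C f = g"
  by (rule Add_left_cancel[of f]) (use assms in simp_all)

lemma Neg_Neg [simp]: "f \<in> Arr C \<Longrightarrow> Neg C (Neg C f) = f"
  by (rule Neg_unique) simp_all

lemma Neg_Null [simp]: "\<lbrakk>X \<in> Obj C; Y \<in> Obj C\<rbrakk> \<Longrightarrow> Neg C (Null C X Y) = Null C X Y"
  by (rule Neg_unique) simp_all

lemma Neg_Add_distrib:
  assumes "f \<in> Arr C" "g \<in> Arr C" "Dom C f = Dom C g" "Cod C f = Cod C g"
  shows "Neg C (f \<boxplus> g) = Neg C f \<boxplus> Neg C g"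
  by (rule Neg_unique) (use assms in \<open>simp_all add: Add_ac Add_cancel\<close>)

lemma Comp_Add:
  "\<lbrakk>f \<in> Arr C; f' \<in> Arr C; g \<in> Arr C; Dom C f = Dom C f'; Cod C f = Cod C f'; Cod C f' = Dom C g\<rbrakk>
    \<Longrightarrow> g \<cdot> (f \<boxplus> f') = (g \<cdot> f) \<boxplus> (g \<cdot> f')"
  using Comp_Add_right[of f "Dom C f" "Dom C g" f' g "Cod C g"] by (simp add: in_Hom)

lemma Add_Comp:
  "\<lbrakk>f \<in> Arr C; g \<in> Arr C; g' \<in> Arr C; Dom C g = Dom C g'; Cod C g = Cod C g'; Cod C f = Dom C g'\<rbrakk>
    \<Longrightarrow> (g \<boxplus> g') \<cdot> f = (g \<cdot> f) \<boxplus> (g' \<cdot> f)"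
  using Comp_Add_left[of f "Dom C f" "Dom C g" g "Cod C g" g'] by (simp add: in_Hom)

lemma Comp_Null [simp]:
  assumes "g \<in> Arr C" "Dom C g = Y" "X \<in> Obj C"
  shows "g \<cdot> Null C X Y = Null C X (Cod C g)"
proof -
  have Y: "Y \<in> Obj C" using assms by auto
  have *: "g \<cdot> (Null C X Y \<boxplus> Null C X Y) = g \<cdot> Null C X Y \<boxplus> g \<cdot> Null C X Y"
    using assms Y by (subst Comp_Add) simp_all
  show ?thesis
    by (rule Add_left_cancel[of "g \<cdot> Null C X Y"]) (use * assms Y in simp_all)
qed

lemma Null_Comp [simp]:
  assumes "g \<in> Arr C" "Cod C g = X" "Y \<in> Obj C"
  shows "Null C X Y \<cdot> g = Null C (Dom C g) Y"
proof -
  have X: "X \<in> Obj C" using assms by auto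
  have *: "(Null C X Y \<boxplus> Null C X Y) \<cdot> g = Null C X Y \<cdot> g \<boxplus> Null C X Y \<cdot> g"
    using assms X by (subst Add_Comp) simp_all
  show ?thesis
    by (rule Add_left_cancel[of "Null C X Y \<cdot> g"]) (use * assms X in simp_all)
qed

lemma Comp_Neg [simp]:
  assumes "f \<in> Arr C" "g \<in> Arr C" "Cod C f = Dom C g"
  shows "g \<cdot> Neg C f = Neg C (g \<cdot> f)"
  by (rule Neg_unique[symmetric]) (use assms in \<open>simp_all add: Comp_Add[symmetric]\<close>)

lemma Neg_Comp [simp]:
  assumes "f \<in> Arr C" "g \<in> Arr C" "Cod C f = Dom C g"
  shows "Neg C g \<cdot> f = Neg C (g \<cdot> f)"
  by (rule Neg_unique[symmetric]) (use assms in \<open>simp_all add: Add_Comp[symmetric]\<close>)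

lemmas hom_algebra = Comp_Add Add_Comp Neg_Add_distrib Add_ac Add_cancel

lemma is_monoI:
  assumes "f \<in> Arr C"
    and "\<And>a. \<lbrakk>a \<in> Arr C; Cod C a = Dom C f; f \<cdot> a = Null C (Dom C a) (Cod C f)\<rbrakk>
      \<Longrightarrow> a = Null C (Dom C a) (Dom C f)"
  shows "is_mono C f"
  unfolding is_mono_def
proof (intro conjI allI ballI impI)
  fix W a b assume ab: "a \<in> Hom C W (Dom C f)" "b \<in> Hom C W (Dom C f)" "f \<cdot> a = f \<cdot> b"
  hence "a \<boxplus> Neg C b = Null C (Dom C (a \<boxplus> Neg C b)) (Dom C f)"
    by (intro assms(2)) (use ab assms in \<open>auto simp: in_Hom hom_algebra\<close>)
  thus "a = b" using ab Add_Neg_eq_Null_iff[of a b] by (simp add: in_Hom)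
qed fact

lemma kernel_Arr:
  assumes "is_kernel C f g"
  shows "f \<in> Arr C" "g \<in> Arr C" "Cod C f = Dom C g" "g \<cdot> f = Null C (Dom C f) (Cod C g)"
  using assms by (auto simp: is_kernel_def)

lemma cokernel_Arr:
  assumes "is_cokernel C g f"
  shows "f \<in> Arr C" "g \<in> Arr C" "Cod C f = Dom C g" "g \<cdot> f = Null C (Dom C f) (Cod C g)"
  using assms by (auto simp: is_cokernel_def)

lemma kernel_factor:
  assumes "is_kernel C f g" "h \<in> Arr C" "Cod C h = Dom C g" "g \<cdot> h = Null C (Dom C h) (Cod C g)"
  obtains k where "k \<in> Arr C" "Dom C k = Dom C h" "Cod C k = Dom C f" "f \<cdot> k = h"
  using assms unfolding is_kernel_def Ball_def Bex_def in_Hom by metis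

lemma cokernel_factor:
  assumes "is_cokernel C g f" "h \<in> Arr C" "Dom C h = Cod C f" "h \<cdot> f = Null C (Dom C f) (Cod C h)"
  obtains k where "k \<in> Arr C" "Dom C k = Cod C g" "Cod C k = Cod C h" "k \<cdot> g = h"
  using assms unfolding is_cokernel_def Ball_def Bex_def in_Hom by metis

lemma kernel_cancel:
  assumes "is_kernel C f g" "a \<in> Arr C" "b \<in> Arr C" "Dom C a = Dom C b" "Cod C a = Dom C f"
    "Cod C b = Dom C f" "f \<cdot> a = f \<cdot> b"
  shows "a = b"
proof -
  have "f \<cdot> a \<in> Hom C (Dom C a) (Dom C g)" "g \<cdot> (f \<cdot> a) = Null C (Dom C a) (Cod C g)"
    using assms kernel_Arr[OF assms(1)] Comp_reassoc[of g f "Null C (Dom C f) (Cod C g)" a] by (auto simp: in_Hom)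
  thus ?thesis using assms unfolding is_kernel_def Ball_def Bex_def in_Hom by metis
qed

lemma cokernel_cancel:
  assumes "is_cokernel C g f" "a \<in> Arr C" "b \<in> Arr C" "Cod C a = Cod C b" "Dom C a = Cod C g"
    "Dom C b = Cod C g" "a \<cdot> g = b \<cdot> g"
  shows "a = b"
proof -
  have "a \<cdot> g \<in> Hom C (Cod C f) (Cod C a)" "(a \<cdot> g) \<cdot> f = Null C (Dom C f) (Cod C a)"
    using assms cokernel_Arr[OF assms(1)] by (auto simp: in_Hom)
  thus ?thesis using assms unfolding is_cokernel_def Ball_def Bex_def in_Hom by metis
qed

lemma is_kernelI:
  assumes "f \<in> Arr C" "g \<in> Arr C" "Cod C f = Dom C g" "g \<cdot> f = Null C (Dom C f) (Cod C g)"
    and "\<And>h. \<lbrakk>h \<in> Arr C; Cod C h = Dom C g; g \<cdot> h = Null C (Dom C h) (Cod C g)\<rbrakk>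
      \<Longrightarrow> \<exists>k \<in> Arr C. Dom C k = Dom C h \<and> Cod C k = Dom C f \<and> f \<cdot> k = h"
    and "is_mono C f"
  shows "is_kernel C f g"
  unfolding is_kernel_def
proof (intro conjI allI ballI impI)
  fix W h assume "h \<in> Hom C W (Dom C g)" "g \<cdot> h = Null C W (Cod C g)"
  thus "\<exists>!k. k \<in> Hom C W (Dom C f) \<and> f \<cdot> k = h"
    using assms(5)[of h] assms(6) unfolding is_mono_def Ball_def Bex_def in_Hom by metis
qed fact+

end

context additive_category
begin

definition biproduct where
  "biproduct X Y S i j p q \<longleftrightarrow> S \<in> Obj C \<and> i \<in> Hom C X S \<and> j \<in> Hom C Y S \<and> p \<in> Hom C S X \<and> q \<in> Hom C S Y \<and>
     p \<cdot> i = Ident C X \<and> q \<cdot> j = Ident C Y \<and> p \<cdot> j = Null C Y X \<and> q \<cdot> i = Null C X Y \<and>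
     (i \<cdot> p) \<boxplus> (j \<cdot> q) = Ident C S"

lemma biproductE:
  assumes "X \<in> Obj C" "Y \<in> Obj C"
  obtains S i j p q where "biproduct X Y S i j p q"
  using ex_biproduct[OF assms] unfolding biproduct_def by blast

lemma biproductD:
  assumes "biproduct X Y S i j p q"
  shows "S \<in> Obj C" "i \<in> Arr C" "Dom C i = X" "Cod C i = S" "j \<in> Arr C" "Dom C j = Y"
    "Cod C j = S" "p \<in> Arr C" "Dom C p = S" "Cod C p = X" "q \<in> Arr C" "Dom C q = S" "Cod C q = Y"
    "p \<cdot> i = Ident C X" "q \<cdot> j = Ident C Y" "p \<cdot> j = Null C Y X" "q \<cdot> i = Null C X Y"
    "(i \<cdot> p) \<boxplus> (j \<cdot> q) = Ident C S"
  using assms by (simp_all add: biproduct_def in_Hom)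

end

section \<open>The opposite category\<close>

text \<open>Arrows, identities and addition stay literally the same, so Hom groups are equal rather
  than isomorphic and dualizing twice gives back the same record. \<open>Null\<close> has to be
  changed because it is indexed by source and target.\<close>

definition op_category ::
  "('o, 'm, 'z) preadditive_data_scheme \<Rightarrow> ('o, 'm, 'z) preadditive_data_scheme" where
  "op_category C = C\<lparr>Dom := Cod C, Cod := Dom C, Comp := (\<lambda>g f. f \<cdot>\<^bsub>C\<^esub> g), Null := (\<lambda>X Y. Null C Y X)\<rparr>"

lemma op_sel [simp]:
  "Obj (op_category C) = Obj C" "Arr (op_category C) = Arr C" "Dom (op_category C) = Cod C"
  "Cod (op_category C) = Dom C" "Ident (op_category C) = Ident C"
  "Comp (op_category C) = (\<lambda>g f. f \<cdot>\<^bsub>C\<^esub> g)" "Add (op_category C) = Add C"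
  "Null (op_category C) X Y = Null C Y X" "Hom (op_category C) X Y = Hom C Y X"
  "hom_group (op_category C) X Y = hom_group C Y X"
  "Neg (op_category C) f = Neg C f"
  by (auto simp: op_category_def Hom_def hom_group_def Neg_def conj_commute)

lemma op_op [simp]: "op_category (op_category C) = C"
  by (simp add: op_category_def)

lemma op_kernel [simp]: "is_kernel (op_category C) f g \<longleftrightarrow> is_cokernel C f g"
  unfolding is_kernel_def is_cokernel_def by auto

lemma op_cokernel [simp]: "is_cokernel (op_category C) f g \<longleftrightarrow> is_kernel C f g"
  using op_kernel[of "op_category C"] by simp

lemma op_short_exact [simp]: "short_exact (op_category C) f g \<longleftrightarrow> short_exact C g f"
  by (auto simp: short_exact_def)

lemma op_mono [simp]: "is_mono (op_category C) f \<longleftrightarrow> is_epi C f"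
  by (simp add: is_mono_def is_epi_def)

lemma op_epi [simp]: "is_epi (op_category C) f \<longleftrightarrow> is_mono C f"
  by (simp add: is_mono_def is_epi_def)

lemma op_pullback [simp]: "is_pullback (op_category C) a b f g \<longleftrightarrow> is_pushout C f g a b"
  unfolding is_pullback_def is_pushout_def by auto

lemma op_zero_object [simp]: "zero_object (op_category C) Z \<longleftrightarrow> zero_object C Z"
  by (auto simp: zero_object_def)

lemma op_category_category: "category C \<Longrightarrow> category (op_category C)"
  unfolding category_def by (simp add: in_Hom)

lemma op_preadditive:
  assumes "preadditive_category C"
  shows "preadditive_category (op_category C)"
proof -
  interpret preadditive_category C by fact
  interpret O: category "op_category C" by (rule op_category_category) unfold_locales
  show ?thesis
    by (intro preadditive_category.intro preadditive_category_axioms.intro O.category_axioms)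
      (auto simp: hom_comm_group in_Hom Comp_Add Add_Comp)
qed

lemma op_additive:
  assumes "additive_category C"
  shows "additive_category (op_category C)"
proof -
  interpret additive_category C by fact
  interpret O: preadditive_category "op_category C" by (rule op_preadditive) unfold_locales
  show ?thesis
  proof unfold_locales
    show "\<exists>Z. zero_object (op_category C) Z" using ex_zero_object by simp
  next
    fix X Y assume "X \<in> Obj (op_category C)" "Y \<in> Obj (op_category C)"
    then obtain S i j p q where S: "S \<in> Obj C" "i \<in> Hom C X S" "j \<in> Hom C Y S" "p \<in> Hom C S X"
      "q \<in> Hom C S Y" "p \<cdot>\<^bsub>C\<^esub> i = Ident C X" "q \<cdot>\<^bsub>C\<^esub> j = Ident C Y" "p \<cdot>\<^bsub>C\<^esub> j = Null C Y X" "q \<cdot>\<^bsub>C\<^esub> i = Null C X Y"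
      "(i \<cdot>\<^bsub>C\<^esub> p) \<boxplus>\<^bsub>C\<^esub> (j \<cdot>\<^bsub>C\<^esub> q) = Ident C S"
      using ex_biproduct[of X Y] by auto
    show "\<exists>S\<in>Obj (op_category C). \<exists>i\<in>Hom (op_category C) X S. \<exists>j\<in>Hom (op_category C) Y S.
       \<exists>p\<in>Hom (op_category C) S X. \<exists>q\<in>Hom (op_category C) S Y.
         p \<cdot>\<^bsub>op_category C\<^esub> i = Ident (op_category C) X \<and> q \<cdot>\<^bsub>op_category C\<^esub> j = Ident (op_category C) Y \<and>
         p \<cdot>\<^bsub>op_category C\<^esub> j = Null (op_category C) Y X \<and> q \<cdot>\<^bsub>op_category C\<^esub> i = Null (op_category C) X Y \<and>
         (i \<cdot>\<^bsub>op_category C\<^esub> p) \<boxplus>\<^bsub>op_category C\<^esub> (j \<cdot>\<^bsub>op_category C\<^esub> q) = Ident (op_category C) S"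
      \<comment> \<open>Inclusions and projections of the biproduct exchange their roles.\<close>
      by (rule bexI[of _ S], rule bexI[of _ p], rule bexI[of _ q], rule bexI[of _ i], rule bexI[of _ j])
        (use S in auto)
  qed
qed

lemma op_abelian:
  assumes "abelian_category C"
  shows "abelian_category (op_category C)"
proof -
  interpret abelian_category C by fact
  interpret O: additive_category "op_category C" by (rule op_additive) unfold_locales
  show ?thesis
    by unfold_locales (use ex_kernel ex_cokernel mono_normal epi_normal in auto)
qed

context preadditive_category
begin

lemma is_cokernelI:
  assumes "f \<in> Arr C" "g \<in> Arr C" "Cod C f = Dom C g" "g \<cdot> f = Null C (Dom C f) (Cod C g)"
    and "\<And>h. \<lbrakk>h \<in> Arr C; Dom C h = Cod C f; h \<cdot> f = Null C (Dom C f) (Cod C h)\<rbrakk>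
      \<Longrightarrow> \<exists>k \<in> Arr C. Dom C k = Cod C g \<and> Cod C k = Cod C h \<and> k \<cdot> g = h"
    and "is_epi C g"
  shows "is_cokernel C g f"
proof -
  interpret O: preadditive_category "op_category C" by (rule op_preadditive) unfold_locales
  show ?thesis
    using O.is_kernelI[of g f] assms by auto
qed

lemma cokernel_is_epi: "is_cokernel C g f \<Longrightarrow> is_epi C g"
  using cokernel_cancel[of g f] cokernel_Arr[of g f] by (auto simp: is_epi_def in_Hom)

lemma is_epiI:
  assumes "f \<in> Arr C"
    and "\<And>a. \<lbrakk>a \<in> Arr C; Dom C a = Cod C f; a \<cdot> f = Null C (Dom C f) (Cod C a)\<rbrakk>
      \<Longrightarrow> a = Null C (Cod C f) (Cod C a)"
  shows "is_epi C f"
proof -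
  interpret O: preadditive_category "op_category C" by (rule op_preadditive) unfold_locales
  show ?thesis
    using O.is_monoI[of f] assms by auto
qed

end

context abelian_category
begin

text \<open>By normality \<open>g\<close> is the cokernel of some \<open>f0\<close>. As
  \<open>f0\<close> factors through the kernel \<open>f\<close>, whatever kills \<open>f\<close>
  kills \<open>f0\<close> and therefore factors through \<open>g\<close>.\<close>

lemma kernel_epi_short_exact:
  assumes "is_kernel C f g" "is_epi C g"
  shows "short_exact C f g"
proof -
  obtain f0 where f0: "is_cokernel C g f0" using epi_normal assms(2) by auto
  note a = kernel_Arr[OF assms(1)] cokernel_Arr[OF f0]
  obtain t where t: "t \<in> Arr C" "Dom C t = Dom C f0" "Cod C t = Dom C f" "f \<cdot> t = f0"
    using kernel_factor[OF assms(1), of f0] a by metis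
  have "is_cokernel C g f"
  proof (rule is_cokernelI)
    fix h assume h: "h \<in> Arr C" "Dom C h = Cod C f" "h \<cdot> f = Null C (Dom C f) (Cod C h)"
    have "h \<cdot> f0 = Null C (Dom C f0) (Cod C h)"
      using Comp_reassoc[OF h(3), of t] a h t by simp
    thus "\<exists>k \<in> Arr C. Dom C k = Cod C g \<and> Cod C k = Cod C h \<and> k \<cdot> g = h"
      using cokernel_factor[OF f0, of h] h a by metis
  qed (use a assms in auto)
  thus ?thesis using assms by (simp add: short_exact_def)
qed

lemma mono_cokernel_short_exact:
  assumes "is_mono C f" "is_cokernel C g f"
  shows "short_exact C f g"
proof -
  interpret O: abelian_category "op_category C" by (rule op_abelian) unfold_locales
  show ?thesis using O.kernel_epi_short_exact[of g f] assms by simp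
qed

end

text \<open>The converse relation reverses each pair. Short exactness identifies the middle term,
  which one side calls \<open>Dom C g\<close> and the other \<open>Cod C f\<close>.\<close>

lemma op_injectives:
  assumes "\<And>f g. (f, g) \<in> E \<Longrightarrow> short_exact C f g"
  shows "projectives (op_category C) (E\<inverse>) = injectives C E"
proof -
  have "Dom C g = Cod C f" if "(f, g) \<in> E" for f g
    using assms[OF that] by (simp add: short_exact_def is_kernel_def)
  thus ?thesis unfolding projectives_def injectives_def Ball_def by auto
qed

lemma op_inflations: "deflations (E\<inverse>) = inflations E"
  by (auto simp: deflations_def inflations_def)

section \<open>Relative projectives, relative injectives and splittings\<close>

context preadditive_category
begin

lemma hom_group_hom_Comp:
  assumes "f \<in> Arr C" "P \<in> Obj C"
  shows "group_hom (hom_group C P (Dom C f)) (hom_group C P (Cod C f)) (\<lambda>h. f \<cdot> h)"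
proof -
  interpret G: comm_group "hom_group C P (Dom C f)" using assms by (simp add: hom_comm_group)
  interpret H: comm_group "hom_group C P (Cod C f)" using assms by (simp add: hom_comm_group)
  show ?thesis
    by unfold_locales (use assms in \<open>auto simp: hom_def hom_group_def in_Hom Comp_Add\<close>)
qed

text \<open>Hom(P,-) is left exact on any short exact sequence, so only surjectivity at the right
  end is a condition on \<open>P\<close>.\<close>

lemma short_exact_groups_Hom_iff:
  assumes fg: "short_exact C f g" and P: "P \<in> Obj C"
  shows "short_exact_groups (hom_group C P (Dom C f)) (hom_group C P (Cod C f))
       (hom_group C P (Cod C g)) (\<lambda>h. f \<cdot> h) (\<lambda>h. g \<cdot> h) \<longleftrightarrow>
     (\<forall>h \<in> Hom C P (Cod C g). \<exists>k \<in> Hom C P (Dom C g). g \<cdot> k = h)" (is "?L \<longleftrightarrow> ?R")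
proof -
  have ker: "is_kernel C f g" using fg by (simp add: short_exact_def)
  note a = kernel_Arr[OF ker]
  have hom: "group_hom (hom_group C P (Dom C f)) (hom_group C P (Cod C f)) (\<lambda>h. f \<cdot> h)"
    "group_hom (hom_group C P (Cod C f)) (hom_group C P (Cod C g)) (\<lambda>h. g \<cdot> h)"
    using hom_group_hom_Comp[of f P] hom_group_hom_Comp[of g P] a P by auto
  have im: "(\<lambda>h. f \<cdot> h) ` carrier (hom_group C P (Dom C f)) =
      kernel (hom_group C P (Cod C f)) (hom_group C P (Cod C g)) (\<lambda>h. g \<cdot> h)"
  proof (intro equalityI subsetI)
    fix x assume "x \<in> (\<lambda>h. f \<cdot> h) ` carrier (hom_group C P (Dom C f))"
    then obtain h where "h \<in> Arr C" "Dom C h = P" "Cod C h = Dom C f" "x = f \<cdot> h"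
      by (auto simp: hom_group_def in_Hom)
    thus "x \<in> kernel (hom_group C P (Cod C f)) (hom_group C P (Cod C g)) (\<lambda>h. g \<cdot> h)"
      using a P Comp_reassoc[OF a(4), of h] by (auto simp: kernel_def hom_group_def in_Hom)
  next
    fix x assume "x \<in> kernel (hom_group C P (Cod C f)) (hom_group C P (Cod C g)) (\<lambda>h. g \<cdot> h)"
    hence x: "x \<in> Arr C" "Dom C x = P" "Cod C x = Dom C g" "g \<cdot> x = Null C P (Cod C g)"
      using a by (auto simp: kernel_def hom_group_def in_Hom)
    then obtain k where "k \<in> Arr C" "Dom C k = Dom C x" "Cod C k = Dom C f" "f \<cdot> k = x"
      using kernel_factor[OF ker, of x] by auto
    thus "x \<in> (\<lambda>h. f \<cdot> h) ` carrier (hom_group C P (Dom C f))"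
      using x by (auto simp: hom_group_def in_Hom)
  qed
  have ex: "exact_seq ([hom_group C P (Cod C g), hom_group C P (Cod C f), hom_group C P (Dom C f)],
      [\<lambda>h. g \<cdot> h, \<lambda>h. f \<cdot> h])"
    using exact_seq.extension[OF exact_seq.unity[OF hom(1)] _ group_hom.homh[OF hom(2)] im[symmetric]]
      group_hom.axioms(2)[OF hom(2)] by simp
  have inj: "inj_on (\<lambda>h. f \<cdot> h) (carrier (hom_group C P (Dom C f)))"
    using kernel_cancel[OF ker] by (auto simp: inj_on_def hom_group_def in_Hom)
  have sub: "(\<lambda>h. g \<cdot> h) ` Hom C P (Dom C g) \<subseteq> Hom C P (Cod C g)"
    using a by (auto simp: in_Hom)
  have "?L \<longleftrightarrow> (\<lambda>h. g \<cdot> h) ` carrier (hom_group C P (Cod C f)) = carrier (hom_group C P (Cod C g))"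
    using ex inj by (simp add: short_exact_groups_def)
  also have "\<dots> \<longleftrightarrow> Hom C P (Cod C g) \<subseteq> (\<lambda>h. g \<cdot> h) ` Hom C P (Dom C g)"
    using sub a by (simp add: hom_group_def set_eq_subset)
  also have "\<dots> \<longleftrightarrow> ?R"
    unfolding subset_iff image_iff Ball_def Bex_def by metis
  finally show ?thesis .
qed

lemma projectives_iff:
  assumes "\<And>f g. (f, g) \<in> E \<Longrightarrow> short_exact C f g"
  shows "P \<in> projectives C E \<longleftrightarrow> P \<in> Obj C \<and>
    (\<forall>(f, g) \<in> E. \<forall>h \<in> Hom C P (Cod C g). \<exists>k \<in> Hom C P (Dom C g). g \<cdot> k = h)"
  unfolding projectives_def using short_exact_groups_Hom_iff[OF assms] by fast

lemma injectives_iff: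
  assumes "\<And>f g. (f, g) \<in> E \<Longrightarrow> short_exact C f g"
  shows "I \<in> injectives C E \<longleftrightarrow> I \<in> Obj C \<and>
    (\<forall>(f, g) \<in> E. \<forall>h \<in> Hom C (Dom C f) I. \<exists>k \<in> Hom C (Cod C f) I. k \<cdot> f = h)"
proof -
  interpret O: preadditive_category "op_category C" by (rule op_preadditive) unfold_locales
  have cod: "Cod C f = Dom C g" if "(f, g) \<in> E" for f g
    using assms[OF that] by (simp add: short_exact_def is_kernel_def)
  show ?thesis
    using O.projectives_iff[of "E\<inverse>" I] assms cod by (fastforce simp: op_injectives)
qed

text \<open>Splitting is defined through a section of \<open>g\<close> alone; the equivalent
  retraction of \<open>f\<close> makes the notion self-dual.\<close>

lemma split_short_exact_iff_retraction:
  assumes "short_exact C f g"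
  shows "split_short_exact C f g \<longleftrightarrow> (\<exists>r \<in> Hom C (Cod C f) (Dom C f). r \<cdot> f = Ident C (Dom C f))"
proof
  have ker: "is_kernel C f g" and cok: "is_cokernel C g f" using assms by (simp_all add: short_exact_def)
  note a = kernel_Arr[OF ker]
  {
    assume "split_short_exact C f g"
    then obtain s where s: "s \<in> Arr C" "Dom C s = Cod C g" "Cod C s = Dom C g" "g \<cdot> s = Ident C (Cod C g)"
      by (auto simp: split_short_exact_def in_Hom)
    \<comment> \<open>The idempotent complementary to \<open>s \<cdot> g\<close> is killed by
      \<open>g\<close>, so it factors as \<open>f \<cdot> r\<close>; then
      \<open>f \<cdot> r \<cdot> f = f\<close>, and \<open>f\<close> can be cancelled.\<close>
    let ?d = "Ident C (Dom C g) \<boxplus> Neg C (s \<cdot> g)"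
    have "g \<cdot> ?d = Null C (Dom C g) (Cod C g)"
      using a s Comp_reassoc[OF s(4), of g] by (simp add: Comp_Add)
    then obtain r where r: "r \<in> Arr C" "Dom C r = Dom C g" "Cod C r = Dom C f" "f \<cdot> r = ?d"
      using kernel_factor[OF ker, of ?d] a s by auto
    have "f \<cdot> (r \<cdot> f) = ?d \<cdot> f" using r a s Comp_reassoc[OF r(4), of f] by simp
    also have "\<dots> = f" using a s by (simp add: Add_Comp)
    finally have e: "f \<cdot> (r \<cdot> f) = f" .
    have "r \<cdot> f = Ident C (Dom C f)"
      by (rule kernel_cancel[OF ker]) (use a r(1-3) e in simp_all)
    thus "\<exists>r \<in> Hom C (Cod C f) (Dom C f). r \<cdot> f = Ident C (Dom C f)" using r a by (auto simp: in_Hom)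
  next
    assume "\<exists>r \<in> Hom C (Cod C f) (Dom C f). r \<cdot> f = Ident C (Dom C f)"
    then obtain r where r: "r \<in> Arr C" "Dom C r = Dom C g" "Cod C r = Dom C f" "r \<cdot> f = Ident C (Dom C f)"
      using a by (auto simp: in_Hom)
    \<comment> \<open>Dually, this idempotent kills \<open>f\<close> and descends along
      \<open>g\<close> to the section.\<close>
    let ?d = "Ident C (Dom C g) \<boxplus> Neg C (f \<cdot> r)"
    have "?d \<cdot> f = Null C (Dom C f) (Dom C g)"
      using a r by (simp add: Add_Comp)
    then obtain s where s: "s \<in> Arr C" "Dom C s = Cod C g" "Cod C s = Dom C g" "s \<cdot> g = ?d"
      using cokernel_factor[OF cok, of ?d] a r by auto
    have e: "g \<cdot> (s \<cdot> g) = g"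
      using a r s Comp_reassoc[OF a(4), of r] by (simp add: Comp_Add)
    have "g \<cdot> s = Ident C (Cod C g)"
      by (rule cokernel_cancel[OF cok]) (use a s(1-3) e in simp_all)
    thus "split_short_exact C f g" using assms s by (auto simp: split_short_exact_def in_Hom)
  }
qed

lemma op_split_short_exact: "split_short_exact (op_category C) g f \<longleftrightarrow> split_short_exact C f g"
  using split_short_exact_iff_retraction[of f g] by (auto simp: split_short_exact_def)

end

section \<open>Exact structures defined by faithful right adjoints\<close>

locale cat_functor = C: category C + D: category D
  for C :: "('o, 'm, 'y) category_data_scheme" and D :: "('p, 'n, 'z) category_data_scheme" +
  fixes F :: "('o, 'm, 'p, 'n) functor_data"
  assumes is_functor: "is_functor C D F"
begin

lemma fobj_Obj [simp]: "X \<in> Obj C \<Longrightarrow> fobj F X \<in> Obj D"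
  using is_functor by (auto simp: is_functor_def)

lemma farr_Arr [simp]:
  assumes "f \<in> Arr C"
  shows "farr F f \<in> Arr D" "Dom D (farr F f) = fobj F (Dom C f)" "Cod D (farr F f) = fobj F (Cod C f)"
  using is_functor assms by (auto simp: is_functor_def in_Hom)

lemma farr_Ident [simp]: "X \<in> Obj C \<Longrightarrow> farr F (Ident C X) = Ident D (fobj F X)"
  using is_functor by (auto simp: is_functor_def)

lemma farr_Comp [simp]:
  "\<lbrakk>f \<in> Arr C; g \<in> Arr C; Cod C f = Dom C g\<rbrakk> \<Longrightarrow> farr F (g \<cdot>\<^bsub>C\<^esub> f) = farr F g \<cdot>\<^bsub>D\<^esub> farr F f"
  using is_functor by (auto simp: is_functor_def in_Hom)

lemma farr_is_iso:
  assumes "is_iso C f"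
  shows "is_iso D (farr F f)"
proof -
  obtain g where g: "f \<in> Arr C" "g \<in> Arr C" "Dom C g = Cod C f" "Cod C g = Dom C f"
    "g \<cdot>\<^bsub>C\<^esub> f = Ident C (Dom C f)" "f \<cdot>\<^bsub>C\<^esub> g = Ident C (Cod C f)"
    using C.is_isoE[OF assms] by metis
  show ?thesis
    by (rule D.is_isoI[of _ "fobj F (Dom C f)" "fobj F (Cod C f)" "farr F g"])
      (use g in \<open>simp_all add: in_Hom flip: farr_Comp\<close>)
qed

end

locale additive_cat_functor = C: preadditive_category C + D: preadditive_category D + cat_functor C D F
  for C :: "('o, 'm, 'y) preadditive_data_scheme" and D :: "('p, 'n, 'z) preadditive_data_scheme"
    and F :: "('o, 'm, 'p, 'n) functor_data" +
  assumes additive: "additive_functor C D F"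
begin

lemma farr_Add [simp]:
  "\<lbrakk>f \<in> Arr C; g \<in> Arr C; Dom C f = Dom C g; Cod C f = Cod C g\<rbrakk>
    \<Longrightarrow> farr F (f \<boxplus>\<^bsub>C\<^esub> g) = farr F f \<boxplus>\<^bsub>D\<^esub> farr F g"
  using additive by (auto simp: additive_functor_def in_Hom)

lemma farr_Null [simp]:
  assumes "X \<in> Obj C" "Y \<in> Obj C"
  shows "farr F (Null C X Y) = Null D (fobj F X) (fobj F Y)"
proof -
  have *: "farr F (Null C X Y) \<boxplus>\<^bsub>D\<^esub> farr F (Null C X Y) = farr F (Null C X Y)"
    using assms by (simp flip: farr_Add)
  show ?thesis
    by (rule D.Add_left_cancel[of "farr F (Null C X Y)"]) (use * assms in simp_all)
qed

lemma farr_Neg [simp]: "f \<in> Arr C \<Longrightarrow> farr F (Neg C f) = Neg D (farr F f)"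
  by (rule D.Neg_unique[symmetric]) (simp_all flip: farr_Add)

end

locale faithful_right_adjoint = A: abelian_category A + B: abelian_category B + additive_cat_functor A B F
  for A :: "('o, 'm, 'y) preadditive_data_scheme" and B :: "('p, 'n, 'z) preadditive_data_scheme"
    and F :: "('o, 'm, 'p, 'n) functor_data" +
  fixes L :: "('p, 'n, 'o, 'm) functor_data" and \<phi>
  assumes faithful: "faithful A F"
    and adjunction: "adjunction B A L F \<phi>"
begin

abbreviation comp_A (infixr \<open>\<bullet>\<close> 70) where "comp_A \<equiv> Comp A"
abbreviation comp_B (infixr \<open>\<star>\<close> 70) where "comp_B \<equiv> Comp B"

sublocale L: cat_functor B A L
  by unfold_locales (use adjunction in \<open>simp add: adjunction_def\<close>)

lemma farr_inj:
  "\<lbrakk>farr F f = farr F g; f \<in> Arr A; g \<in> Arr A; Dom A f = Dom A g; Cod A f = Cod A g\<rbrakk> \<Longrightarrow> f = g"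
  using faithful A.Dom_Obj[of g] A.Cod_Obj[of g] unfolding faithful_def inj_on_def Ball_def in_Hom by metis

lemma phi_Arr:
  assumes "Y \<in> Obj B" "h \<in> Arr A" "Dom A h = fobj L Y"
  shows "\<phi> Y (Cod A h) h \<in> Arr B" "Dom B (\<phi> Y (Cod A h) h) = Y"
    "Cod B (\<phi> Y (Cod A h) h) = fobj F (Cod A h)"
proof -
  have "bij_betw (\<phi> Y (Cod A h)) (Hom A (fobj L Y) (Cod A h)) (Hom B Y (fobj F (Cod A h)))"
    using adjunction assms by (auto simp: adjunction_def)
  hence "\<phi> Y (Cod A h) h \<in> Hom B Y (fobj F (Cod A h))"
    by (rule bij_betw_apply) (use assms in \<open>simp add: in_Hom\<close>)
  thus "\<phi> Y (Cod A h) h \<in> Arr B" "Dom B (\<phi> Y (Cod A h) h) = Y"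
    "Cod B (\<phi> Y (Cod A h) h) = fobj F (Cod A h)"
    by (simp_all add: in_Hom)
qed

lemma phi_inj:
  assumes "h \<in> Arr A" "Dom A h = fobj L Y" "k \<in> Arr A" "Dom A k = fobj L Y" "Cod A h = X" "Cod A k = X"
    "\<phi> Y X h = \<phi> Y X k" "Y \<in> Obj B"
  shows "h = k"
proof -
  have "bij_betw (\<phi> Y X) (Hom A (fobj L Y) X) (Hom B Y (fobj F X))"
    using adjunction assms by (auto simp: adjunction_def)
  thus ?thesis using assms by (auto simp: bij_betw_def inj_on_def in_Hom)
qed

lemma phi_surj:
  assumes "k \<in> Arr B" "Cod B k = fobj F X" "X \<in> Obj A"
  obtains h where "h \<in> Arr A" "Dom A h = fobj L (Dom B k)" "Cod A h = X" "\<phi> (Dom B k) X h = k"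
proof -
  have "bij_betw (\<phi> (Dom B k) X) (Hom A (fobj L (Dom B k)) X) (Hom B (Dom B k) (fobj F X))"
    using adjunction assms by (auto simp: adjunction_def)
  hence "k \<in> \<phi> (Dom B k) X ` Hom A (fobj L (Dom B k)) X"
    using assms by (simp add: bij_betw_imp_surj_on in_Hom)
  then obtain h where "h \<in> Hom A (fobj L (Dom B k)) X" "\<phi> (Dom B k) X h = k"
    by auto
  thus thesis using that[of h] by (simp add: in_Hom)
qed

lemma phi_natural:
  assumes "h \<in> Arr A" "Dom A h = fobj L Y" "Y \<in> Obj B" "x \<in> Arr A" "Dom A x = Cod A h"
    "Cod A x = X" "Cod A h = Z"
  shows "\<phi> Y X (x \<bullet> h) = farr F x \<star> \<phi> Y Z h"
proof -
  have "h \<in> Hom A (fobj L Y) Z" "x \<in> Hom A Z X" "Ident B Y \<in> Hom B Y Y" "Z \<in> Obj A" "X \<in> Obj A"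
    using assms A.Cod_Obj[of h] A.Cod_Obj[of x] by (simp_all add: in_Hom)
  hence "\<phi> Y X (x \<bullet> h \<bullet> farr L (Ident B Y)) = farr F x \<star> \<phi> Y Z h \<star> Ident B Y"
    using adjunction assms(3) unfolding adjunction_def by blast
  thus ?thesis using assms phi_Arr[of Y h] by simp
qed

text \<open>Transposition is not assumed additive. A zero arrow equals the zero endomorphism of
  \<open>X\<close> composed with itself, and naturality turns that endomorphism into its image under
  \<open>F\<close>, which is zero.\<close>

lemma phi_Null:
  assumes "Y \<in> Obj B" "X \<in> Obj A"
  shows "\<phi> Y X (Null A (fobj L Y) X) = Null B Y (fobj F X)"
proof -
  have "\<phi> Y X (Null A X X \<bullet> Null A (fobj L Y) X) = farr F (Null A X X) \<star> \<phi> Y X (Null A (fobj L Y) X)"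
    by (rule phi_natural) (use assms in simp_all)
  thus ?thesis using assms phi_Arr[of Y "Null A (fobj L Y) X"] by simp
qed

text \<open>A right adjoint preserves limits: an arrow killed by \<open>farr F g\<close> is
  transposed to \<open>A\<close>, factored through \<open>f\<close> there, and transposed
  back.\<close>

lemma preserves_kernel:
  assumes ker: "is_kernel A f g"
  shows "is_kernel B (farr F f) (farr F g)"
proof (rule B.is_kernelI)
  note a = A.kernel_Arr[OF ker]
  show "farr F f \<in> Arr B" "farr F g \<in> Arr B" "Cod B (farr F f) = Dom B (farr F g)" using a by simp_all
  show "farr F g \<star> farr F f = Null B (Dom B (farr F f)) (Cod B (farr F g))"
    using a by (simp flip: farr_Comp)
  {
    fix h assume h: "h \<in> Arr B" "Cod B h = Dom B (farr F g)"
      "farr F g \<star> h = Null B (Dom B h) (Cod B (farr F g))"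
    obtain h' where h': "h' \<in> Arr A" "Dom A h' = fobj L (Dom B h)" "Cod A h' = Dom A g"
      "\<phi> (Dom B h) (Dom A g) h' = h"
      using phi_surj[of h "Dom A g"] h a by auto
    have "\<phi> (Dom B h) (Cod A g) (g \<bullet> h') = \<phi> (Dom B h) (Cod A g) (Null A (fobj L (Dom B h)) (Cod A g))"
      using phi_natural[of h' "Dom B h" g] h h' a by (simp add: phi_Null)
    hence "g \<bullet> h' = Null A (Dom A h') (Cod A g)"
      using phi_inj[of "g \<bullet> h'" "Dom B h" "Null A (fobj L (Dom B h)) (Cod A g)" "Cod A g"] h h' a by simp
    then obtain k where k: "k \<in> Arr A" "Dom A k = Dom A h'" "Cod A k = Dom A f" "f \<bullet> k = h'"
      using A.kernel_factor[OF ker, of h'] h' by auto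
    have "farr F f \<star> \<phi> (Dom B h) (Dom A f) k = h"
      using phi_natural[of k "Dom B h" f] k h h' a by simp
    thus "\<exists>k \<in> Arr B. Dom B k = Dom B h \<and> Cod B k = Dom B (farr F f) \<and> farr F f \<star> k = h"
      using phi_Arr[of "Dom B h" k] k h h' a by auto
  }
  show "is_mono B (farr F f)"
  proof (rule B.is_monoI)
    fix h assume h: "h \<in> Arr B" "Cod B h = Dom B (farr F f)"
      "farr F f \<star> h = Null B (Dom B h) (Cod B (farr F f))"
    obtain h' where h': "h' \<in> Arr A" "Dom A h' = fobj L (Dom B h)" "Cod A h' = Dom A f"
      "\<phi> (Dom B h) (Dom A f) h' = h"
      using phi_surj[of h "Dom A f"] h a by auto
    have "\<phi> (Dom B h) (Cod A f) (f \<bullet> h') = \<phi> (Dom B h) (Cod A f) (Null A (fobj L (Dom B h)) (Cod A f))"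
      using phi_natural[of h' "Dom B h" f] h h' a by (simp add: phi_Null)
    hence "f \<bullet> h' = Null A (Dom A h') (Cod A f)"
      using phi_inj[of "f \<bullet> h'" "Dom B h" "Null A (fobj L (Dom B h)) (Cod A f)" "Cod A f"] h h' a by simp
    hence e: "f \<bullet> h' = f \<bullet> Null A (Dom A h') (Dom A f)" using a h' h(1) by simp
    have "h' = Null A (Dom A h') (Dom A f)"
      by (rule A.kernel_cancel[OF ker _ _ _ _ _ e]) (use a h' h(1) in simp_all)
    thus "h = Null B (Dom B h) (Dom B (farr F f))"
      using h h' a phi_Null[of "Dom B h" "Dom A f"] by simp
  qed (use a in simp)
qed

text \<open>Composing with the section shows that \<open>farr F g\<close> is epi. If
  \<open>a \<bullet> g\<close> is zero, then \<open>farr F a\<close> is zero, and faithfulness gives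
  that \<open>a\<close> is zero.\<close>

lemma split_epi_imp_epi:
  assumes "g \<in> Arr A" "s \<in> Arr B" "Dom B s = fobj F (Cod A g)" "Cod B s = fobj F (Dom A g)"
    "farr F g \<star> s = Ident B (fobj F (Cod A g))"
  shows "is_epi A g" "is_epi B (farr F g)"
proof -
  show B: "is_epi B (farr F g)"
  proof (rule B.is_epiI)
    fix a assume a: "a \<in> Arr B" "Dom B a = Cod B (farr F g)"
      "a \<star> farr F g = Null B (Dom B (farr F g)) (Cod B a)"
    have "a = (a \<star> farr F g) \<star> s" using a(1,2) assms by simp
    also have "\<dots> = Null B (Cod B (farr F g)) (Cod B a)" unfolding a(3) using a(1,2) assms by simp
    finally show "a = Null B (Cod B (farr F g)) (Cod B a)" .
  qed (use assms in simp)
  show "is_epi A g"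
  proof (rule A.is_epiI)
    fix a assume a: "a \<in> Arr A" "Dom A a = Cod A g" "a \<bullet> g = Null A (Dom A g) (Cod A a)"
    have "farr F a \<star> farr F g = Null B (fobj F (Cod A g)) (fobj F (Cod A a)) \<star> farr F g"
      using a assms by (simp flip: farr_Comp)
    hence "farr F a = farr F (Null A (Cod A g) (Cod A a))"
      using B a(1,2) assms unfolding is_epi_def by (simp add: in_Hom)
    thus "a = Null A (Cod A g) (Cod A a)"
      by (rule farr_inj) (use a assms in simp_all)
  qed (use assms in simp)
qed

text \<open>The cokernel conditions in both categories follow from the section, which makes
  \<open>g\<close> and \<open>farr F g\<close> epi: in an abelian category an epimorphism is the
  cokernel of its kernel.\<close>

lemma F_split_iff:
  "(f, g) \<in> F_split A B F \<longleftrightarrow> is_kernel A f g \<and>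
    (\<exists>s \<in> Hom B (fobj F (Cod A g)) (fobj F (Dom A g)). farr F g \<star> s = Ident B (fobj F (Cod A g)))"
proof
  assume "(f, g) \<in> F_split A B F"
  hence "short_exact A f g" "split_short_exact B (farr F f) (farr F g)" by (auto simp: F_split_def)
  thus "is_kernel A f g \<and>
    (\<exists>s \<in> Hom B (fobj F (Cod A g)) (fobj F (Dom A g)). farr F g \<star> s = Ident B (fobj F (Cod A g)))"
    using A.kernel_Arr[of f g] by (auto simp: short_exact_def split_short_exact_def)
next
  assume a: "is_kernel A f g \<and>
    (\<exists>s \<in> Hom B (fobj F (Cod A g)) (fobj F (Dom A g)). farr F g \<star> s = Ident B (fobj F (Cod A g)))"
  then obtain s where s: "s \<in> Arr B" "Dom B s = fobj F (Cod A g)" "Cod B s = fobj F (Dom A g)"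
    "farr F g \<star> s = Ident B (fobj F (Cod A g))"
    by (auto simp: in_Hom)
  note k = A.kernel_Arr[of f g]
  have "is_epi A g" "is_epi B (farr F g)" using split_epi_imp_epi[of g s] s k a by auto
  hence "short_exact A f g" "short_exact B (farr F f) (farr F g)"
    using a A.kernel_epi_short_exact B.kernel_epi_short_exact preserves_kernel by auto
  thus "(f, g) \<in> F_split A B F"
    using s k a by (auto simp: F_split_def split_short_exact_def in_Hom)
qed

lemma deflations_iff:
  "g \<in> deflations (F_split A B F) \<longleftrightarrow> g \<in> Arr A \<and>
    (\<exists>s \<in> Hom B (fobj F (Cod A g)) (fobj F (Dom A g)). farr F g \<star> s = Ident B (fobj F (Cod A g)))"
  unfolding deflations_def mem_Collect_eq F_split_iff
  using A.ex_kernel[of g] A.kernel_Arr by blast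

text \<open>Both arrows are conjugates of the given ones,
  \<open>f' = b \<bullet> f \<bullet> a'\<close> and \<open>g' = c \<bullet> g \<bullet> b'\<close>,
  and the section is conjugated in the same way.\<close>

lemma F_split_iso_closed:
  assumes fg: "(f, g) \<in> F_split A B F" and iso: "is_iso A a" "is_iso A b" "is_iso A c"
    and "f' \<in> Hom A (Cod A a) (Cod A b)" "g' \<in> Hom A (Cod A b) (Cod A c)"
    and "Dom A a = Dom A f" "Dom A b = Cod A f" "Dom A c = Cod A g"
    and "f' \<bullet> a = b \<bullet> f" "g' \<bullet> b = c \<bullet> g"
  shows "(f', g') \<in> F_split A B F"
proof -
  obtain a' where a: "a \<in> Arr A" "a' \<in> Arr A" "Dom A a' = Cod A a" "Cod A a' = Dom A a"
    "a' \<bullet> a = Ident A (Dom A a)" "a \<bullet> a' = Ident A (Cod A a)"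
    using A.is_isoE[OF iso(1)] by metis
  obtain b' where b: "b \<in> Arr A" "b' \<in> Arr A" "Dom A b' = Cod A b" "Cod A b' = Dom A b"
    "b' \<bullet> b = Ident A (Dom A b)" "b \<bullet> b' = Ident A (Cod A b)"
    using A.is_isoE[OF iso(2)] by metis
  obtain c' where c: "c \<in> Arr A" "c' \<in> Arr A" "Dom A c' = Cod A c" "Cod A c' = Dom A c"
    "c' \<bullet> c = Ident A (Dom A c)" "c \<bullet> c' = Ident A (Cod A c)"
    using A.is_isoE[OF iso(3)] by metis
  have ker: "is_kernel A f g" using fg F_split_iff by blast
  obtain s where s: "s \<in> Arr B" "Dom B s = fobj F (Cod A g)" "Cod B s = fobj F (Dom A g)"
    "farr F g \<star> s = Ident B (fobj F (Cod A g))"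
    using fg F_split_iff by (auto simp: in_Hom)
  note k = A.kernel_Arr[OF ker]
  have f': "f' \<in> Arr A" "Dom A f' = Cod A a" "Cod A f' = Cod A b"
    and g': "g' \<in> Arr A" "Dom A g' = Cod A b" "Cod A g' = Cod A c"
    using assms by (auto simp: in_Hom)
  note sq = assms(7-11)
  have f'_eq: "f' = b \<bullet> (f \<bullet> a')"
    using A.Comp_reassoc[OF sq(4), of a'] a b f' k sq by simp
  have g'_eq: "g' = c \<bullet> (g \<bullet> b')"
    using A.Comp_reassoc[OF sq(5), of b'] b c g' k sq by simp
  note re = A.Comp_reassoc[OF a(5)] A.Comp_reassoc[OF a(6)] A.Comp_reassoc[OF b(5)]
    A.Comp_reassoc[OF b(6)] A.Comp_reassoc[OF c(5)] A.Comp_reassoc[OF c(6)] A.Comp_reassoc[OF k(4)]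
  have "is_kernel A f' g'"
  proof (rule A.is_kernelI)
    show "g' \<bullet> f' = Null A (Dom A f') (Cod A g')"
      unfolding f'_eq g'_eq using a b c k sq re by simp
    {
      fix h assume h: "h \<in> Arr A" "Cod A h = Dom A g'" "g' \<bullet> h = Null A (Dom A h) (Cod A g')"
      have "g \<bullet> (b' \<bullet> h) = c' \<bullet> (g' \<bullet> h)"
        unfolding g'_eq using a b c k sq re h(1,2) g' by simp
      also have "\<dots> = Null A (Dom A h) (Cod A g)" unfolding h(3) using c g' h sq by simp
      finally obtain t where t: "t \<in> Arr A" "Dom A t = Dom A h" "Cod A t = Dom A f" "f \<bullet> t = b' \<bullet> h"
        using A.kernel_factor[OF ker, of "b' \<bullet> h"] b h g' k sq by auto
      have "f' \<bullet> (a \<bullet> t) = h"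
        unfolding f'_eq using a b c k sq re h(1,2) g' t by simp
      thus "\<exists>k \<in> Arr A. Dom A k = Dom A h \<and> Cod A k = Dom A f' \<and> f' \<bullet> k = h"
        using a t f' sq by (intro bexI[of _ "a \<bullet> t"]) simp_all
    }
    show "is_mono A f'"
    proof (rule A.is_monoI)
      fix h assume h: "h \<in> Arr A" "Cod A h = Dom A f'" "f' \<bullet> h = Null A (Dom A h) (Cod A f')"
      have "f \<bullet> (a' \<bullet> h) = b' \<bullet> (f' \<bullet> h)"
        unfolding f'_eq using a b c k sq re h(1,2) f' by simp
      also have "\<dots> = f \<bullet> Null A (Dom A h) (Dom A f)" unfolding h(3) using b f' h sq k by simp
      finally have e: "f \<bullet> (a' \<bullet> h) = f \<bullet> Null A (Dom A h) (Dom A f)" .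
      have "a' \<bullet> h = Null A (Dom A h) (Dom A f)"
        by (rule A.kernel_cancel[OF ker _ _ _ _ _ e]) (use a h(1,2) f' sq k in simp_all)
      hence "a \<bullet> (a' \<bullet> h) = Null A (Dom A h) (Cod A a)" using a h f' sq k by simp
      thus "h = Null A (Dom A h) (Dom A f')" using a h f' re by simp
    qed (use f' in simp)
  qed (use f' g' in simp_all)
  moreover have "farr F g' \<star> (farr F b \<star> (s \<star> farr F c')) = Ident B (fobj F (Cod A g'))"
  proof -
    have e: "farr F g' \<star> farr F b = farr F c \<star> farr F g"
      using b c g' k sq by (simp flip: farr_Comp)
    have "farr F g' \<star> (farr F b \<star> (s \<star> farr F c')) =
        farr F c \<star> (farr F g \<star> (s \<star> farr F c'))"
      using b c g' k sq(1-3) s(1-3) B.Comp_reassoc[OF e, of "s \<star> farr F c'"] by simp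
    also have "\<dots> = farr F c \<star> farr F c'"
      using c k sq s B.Comp_reassoc[OF s(4), of "farr F c'"] by simp
    also have "\<dots> = Ident B (fobj F (Cod A g'))"
      using c g' by (simp flip: farr_Comp)
    finally show ?thesis .
  qed
  ultimately show ?thesis
    unfolding F_split_iff using a b c g' k sq s by (auto simp: in_Hom)
qed

section \<open>Closure properties of deflations\<close>

lemma zero_deflation:
  assumes "X \<in> Obj A"
  shows "Ident A X \<in> deflations (F_split A B F)"
  unfolding deflations_iff using assms
  by (auto simp: in_Hom intro!: exI[of _ "Ident B (fobj F X)"])

lemma deflations_Comp:
  assumes "d \<in> deflations (F_split A B F)" "d' \<in> deflations (F_split A B F)" "Cod A d = Dom A d'"
  shows "d' \<bullet> d \<in> deflations (F_split A B F)"
proof -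
  obtain s where s: "d \<in> Arr A" "s \<in> Arr B" "Dom B s = fobj F (Cod A d)" "Cod B s = fobj F (Dom A d)"
    "farr F d \<star> s = Ident B (fobj F (Cod A d))"
    using assms(1) by (auto simp: deflations_iff in_Hom)
  obtain s' where s': "d' \<in> Arr A" "s' \<in> Arr B" "Dom B s' = fobj F (Cod A d')" "Cod B s' = fobj F (Dom A d')"
    "farr F d' \<star> s' = Ident B (fobj F (Cod A d'))"
    using assms(2) by (auto simp: deflations_iff in_Hom)
  show ?thesis unfolding deflations_iff
    by (intro conjI bexI[of _ "s \<star> s'"])
      (use s s' assms(3) B.Comp_reassoc[OF s(5), of s'] in \<open>simp_all add: in_Hom\<close>)
qed

text \<open>If \<open>s\<close> is a section of the image of the composite, then
  \<open>farr F d \<star> s\<close> is a section of \<open>farr F d'\<close>.\<close>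

lemma deflations_cancel:
  assumes "d' \<bullet> d \<in> deflations (F_split A B F)" "d \<in> Arr A" "d' \<in> Arr A" "Cod A d = Dom A d'"
  shows "d' \<in> deflations (F_split A B F)"
proof -
  obtain s where s: "s \<in> Arr B" "Dom B s = fobj F (Cod A d')" "Cod B s = fobj F (Dom A d)"
    "farr F (d' \<bullet> d) \<star> s = Ident B (fobj F (Cod A d'))"
    using assms by (auto simp: deflations_iff in_Hom)
  show ?thesis unfolding deflations_iff
    by (intro conjI bexI[of _ "farr F d \<star> s"]) (use s assms in \<open>simp_all add: in_Hom\<close>)
qed

text \<open>The pullback is realized as the kernel of the difference
  \<open>f \<bullet> p - d \<bullet> q\<close> on a biproduct. Since \<open>F\<close> preserves this
  kernel, a section of the pulled-back arrow can be found by factoring through it in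
  \<open>B\<close>.\<close>

lemma deflations_pullback:
  assumes d: "d \<in> deflations (F_split A B F)" and f: "f \<in> Arr A" "Cod A f = Cod A d"
  shows "\<exists>d' f'. is_pullback A d' f' f d \<and> d' \<in> deflations (F_split A B F)"
proof -
  obtain s where s: "d \<in> Arr A" "s \<in> Arr B" "Dom B s = fobj F (Cod A d)" "Cod B s = fobj F (Dom A d)"
    "farr F d \<star> s = Ident B (fobj F (Cod A d))"
    using d by (auto simp: deflations_iff in_Hom)
  obtain S i j p q where bp: "A.biproduct (Dom A f) (Dom A d) S i j p q"
    by (rule A.biproductE[of "Dom A f" "Dom A d"]) (use f s in simp_all)
  note S = A.biproductD(1-13)[OF bp] and eq = A.biproductD(14-18)[OF bp]
  let ?m = "(f \<bullet> p) \<boxplus>\<^bsub>A\<^esub> Neg A (d \<bullet> q)"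
  have m: "?m \<in> Arr A" "Dom A ?m = S" "Cod A ?m = Cod A d" using S f s by simp_all
  obtain k where ker: "is_kernel A k ?m" using A.ex_kernel m by blast
  note k = A.kernel_Arr[OF ker, unfolded m]
  note re = A.Comp_reassoc[OF eq(1)] A.Comp_reassoc[OF eq(2)] A.Comp_reassoc[OF eq(3)] A.Comp_reassoc[OF eq(4)]
  have fd: "f \<bullet> (p \<bullet> k) = d \<bullet> (q \<bullet> k)"
  proof -
    have "(f \<bullet> (p \<bullet> k)) \<boxplus>\<^bsub>A\<^esub> Neg A (d \<bullet> (q \<bullet> k)) = Null A (Dom A k) (Cod A d)"
      using k f s S by (simp add: A.Add_Comp)
    thus ?thesis
      using A.Add_Neg_eq_Null_iff[of "f \<bullet> (p \<bullet> k)" "d \<bullet> (q \<bullet> k)"] k f s S by simp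
  qed
  have "is_pullback A (p \<bullet> k) (q \<bullet> k) f d"
    unfolding is_pullback_def
  proof (intro conjI allI ballI impI)
    fix W x y assume xy: "x \<in> Hom A W (Dom A f)" "y \<in> Hom A W (Dom A d)" "f \<bullet> x = d \<bullet> y"
    note xy = xy[unfolded in_Hom]
    \<comment> \<open>The arrow into the biproduct with components \<open>x\<close> and
      \<open>y\<close>.\<close>
    let ?h = "(i \<bullet> x) \<boxplus>\<^bsub>A\<^esub> (j \<bullet> y)"
    have "?m \<bullet> ?h = Null A W (Cod A d)"
      using xy S f s re by (auto simp: A.hom_algebra)
    then obtain t where t: "t \<in> Arr A" "Dom A t = W" "Cod A t = Dom A k" "k \<bullet> t = ?h"
      using A.kernel_factor[OF ker, of ?h] xy S m by auto
    show "\<exists>!t. t \<in> Hom A W (Dom A (p \<bullet> k)) \<and> (p \<bullet> k) \<bullet> t = x \<and> (q \<bullet> k) \<bullet> t = y"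
    proof (rule ex1I[of _ t])
      show "t \<in> Hom A W (Dom A (p \<bullet> k)) \<and> (p \<bullet> k) \<bullet> t = x \<and> (q \<bullet> k) \<bullet> t = y"
        using t k S xy re f s by (auto simp: in_Hom A.Comp_Add)
    next
      fix t' assume "t' \<in> Hom A W (Dom A (p \<bullet> k)) \<and> (p \<bullet> k) \<bullet> t' = x \<and> (q \<bullet> k) \<bullet> t' = y"
      hence t': "t' \<in> Arr A" "Dom A t' = W" "Cod A t' = Dom A k"
        "p \<bullet> (k \<bullet> t') = x" "q \<bullet> (k \<bullet> t') = y"
        using k S by (auto simp: in_Hom)
      have "k \<bullet> t' = ((i \<bullet> p) \<boxplus>\<^bsub>A\<^esub> (j \<bullet> q)) \<bullet> (k \<bullet> t')"
        unfolding eq using t' k S by simp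
      also have "\<dots> = ?h" using t' k S f s by (simp add: A.Add_Comp)
      finally have "k \<bullet> t' = k \<bullet> t" using t by simp
      thus "t' = t" by (rule A.kernel_cancel[OF ker, rotated 5]) (use t t' in simp_all)
    qed
  qed (use fd k S f s in auto)
  moreover have "p \<bullet> k \<in> deflations (F_split A B F)"
  proof -
    \<comment> \<open>The arrow with components the identity and \<open>s \<star> farr F f\<close>:
      its two images in \<open>fobj F (Cod A d)\<close> agree because \<open>s\<close> is a section,
      so it factors through \<open>farr F k\<close>.\<close>
    let ?h = "farr F i \<boxplus>\<^bsub>B\<^esub> (farr F j \<star> (s \<star> farr F f))"
    have Feq: "farr F p \<star> farr F i = Ident B (fobj F (Dom A f))"
      "farr F q \<star> farr F j = Ident B (fobj F (Dom A d))"
      "farr F p \<star> farr F j = Null B (fobj F (Dom A d)) (fobj F (Dom A f))"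
      "farr F q \<star> farr F i = Null B (fobj F (Dom A f)) (fobj F (Dom A d))"
      using S eq f s by (simp_all flip: farr_Comp)
    note re = B.Comp_reassoc[OF Feq(1)] B.Comp_reassoc[OF Feq(2)] B.Comp_reassoc[OF Feq(3)]
      B.Comp_reassoc[OF Feq(4)] B.Comp_reassoc[OF s(5)]
    have h: "?h \<in> Arr B" "Dom B ?h = fobj F (Dom A f)" "Cod B ?h = fobj F S" using S s f by simp_all
    have "farr F ?m = (farr F f \<star> farr F p) \<boxplus>\<^bsub>B\<^esub> Neg B (farr F d \<star> farr F q)"
      using S f s by simp
    hence "farr F ?m \<star> ?h = Null B (fobj F (Dom A f)) (fobj F (Cod A d))"
      using S f s re Feq by (simp add: B.hom_algebra)
    then obtain t where t: "t \<in> Arr B" "Dom B t = fobj F (Dom A f)" "Cod B t = fobj F (Dom A k)"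
      "farr F k \<star> t = ?h"
      using B.kernel_factor[OF preserves_kernel[OF ker], of ?h] h m k by auto
    have "farr F (p \<bullet> k) \<star> t = Ident B (fobj F (Dom A f))"
      using t k S s f re Feq by (simp add: B.Comp_Add)
    thus ?thesis unfolding deflations_iff
      by (intro conjI bexI[of _ t]) (use t(1-3) k S f in \<open>simp_all add: in_Hom\<close>)
  qed
  ultimately show ?thesis by blast
qed

section \<open>Projectives supplied by the left adjoint\<close>

lemma F_split_short_exact: "(f, g) \<in> F_split A B F \<Longrightarrow> short_exact A f g"
  by (simp add: F_split_def)

lemma projectives_F_split_iff:
  "P \<in> projectives A (F_split A B F) \<longleftrightarrow> P \<in> Obj A \<and> (\<forall>(f, g) \<in> F_split A B F.
    \<forall>h \<in> Hom A P (Cod A g). \<exists>k \<in> Hom A P (Dom A g). g \<bullet> k = h)"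
  by (rule A.projectives_iff) (rule F_split_short_exact)

text \<open>Under the adjunction, lifting an arrow out of \<open>fobj L Y\<close> along
  \<open>g\<close> becomes lifting an arrow out of \<open>Y\<close> along \<open>farr F g\<close>,
  and there the section does it.\<close>

lemma L_projective:
  assumes "Y \<in> Obj B"
  shows "fobj L Y \<in> projectives A (F_split A B F)"
proof -
  have "\<exists>k \<in> Hom A (fobj L Y) (Dom A g). g \<bullet> k = h"
    if fg: "(f, g) \<in> F_split A B F" and "h \<in> Hom A (fobj L Y) (Cod A g)" for f g h
  proof -
    from that(2)
  have h: "h \<in> Arr A" "Dom A h = fobj L Y" "Cod A h = Cod A g" by (auto simp: in_Hom)
  obtain s where s: "g \<in> Arr A" "s \<in> Arr B" "Dom B s = fobj F (Cod A g)" "Cod B s = fobj F (Dom A g)"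
    "farr F g \<star> s = Ident B (fobj F (Cod A g))"
    using fg A.kernel_Arr by (auto simp: F_split_iff in_Hom)
  note ph = phi_Arr[OF assms h(1,2), unfolded h]
  obtain k where k: "k \<in> Arr A" "Dom A k = fobj L Y" "Cod A k = Dom A g"
    "\<phi> Y (Dom A g) k = s \<star> \<phi> Y (Cod A g) h"
    using phi_surj[of "s \<star> \<phi> Y (Cod A g) h" "Dom A g"] s ph by auto
  have "\<phi> Y (Cod A g) (g \<bullet> k) = \<phi> Y (Cod A g) h"
    using phi_natural[of k Y g] k s ph assms B.Comp_reassoc[OF s(5)] by simp
  hence "g \<bullet> k = h" by (rule phi_inj[rotated 6]) (use s k h assms in simp_all)
  thus "\<exists>k \<in> Hom A (fobj L Y) (Dom A g). g \<bullet> k = h" using k by (auto simp: in_Hom)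
  qed
  thus ?thesis unfolding projectives_F_split_iff using assms by auto
qed

lemma enough_projectives: "enough_projectives A (F_split A B F)"
  unfolding enough_projectives_def
proof
  fix X assume X: "X \<in> Obj A"
  let ?Y = "fobj F X"
  obtain e where e: "e \<in> Arr A" "Dom A e = fobj L ?Y" "Cod A e = X" "\<phi> ?Y X e = Ident B ?Y"
    using phi_surj[of "Ident B ?Y" X] X by auto
  \<comment> \<open>The unit at \<open>fobj F X\<close>; by the triangle identity it is a section of
    the image of the counit \<open>e\<close>.\<close>
  let ?u = "\<phi> ?Y (fobj L ?Y) (Ident A (fobj L ?Y))"
  have u: "?u \<in> Arr B" "Dom B ?u = ?Y" "Cod B ?u = fobj F (fobj L ?Y)"
    using phi_Arr[of ?Y "Ident A (fobj L ?Y)"] X by simp_all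
  have "farr F e \<star> ?u = Ident B ?Y"
    using phi_natural[of "Ident A (fobj L ?Y)" ?Y e] X e by simp
  hence "e \<in> deflations (F_split A B F)"
    unfolding deflations_iff using e u by (auto simp: in_Hom)
  then obtain f where "(f, e) \<in> F_split A B F" by (auto simp: deflations_def)
  thus "\<exists>(f, g) \<in> F_split A B F. Dom A g \<in> projectives A (F_split A B F) \<and> Cod A g = X"
    by (intro bexI[of _ "(f, e)"]) (use e L_projective[of ?Y] X in simp_all)
qed

end

section \<open>Functors and adjunctions on opposite categories\<close>

lemma op_functor: "is_functor C D F \<Longrightarrow> is_functor (op_category C) (op_category D) F"
  unfolding is_functor_def by (auto simp: op_category_category)

lemma op_additive_functor:
  "additive_functor C D F \<Longrightarrow> additive_functor (op_category C) (op_category D) F"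
  unfolding additive_functor_def by (auto simp: op_functor)

lemma op_faithful: "faithful C F \<Longrightarrow> faithful (op_category C) F"
  unfolding faithful_def by auto

text \<open>Reversing arrows exchanges the two functors, so transposition runs the other way and is
  given by the inverse bijections; naturality is transferred by applying \<open>\<phi>\<close> to
  both sides.\<close>

lemma op_adjoint:
  assumes "adjoint D C L G"
  shows "adjoint (op_category C) (op_category D) G L"
proof -
  obtain \<phi> where ad: "adjunction D C L G \<phi>" using assms by (auto simp: adjoint_def)
  hence func: "is_functor D C L" "is_functor C D G"
    and bij: "\<And>Y X. Y \<in> Obj D \<Longrightarrow> X \<in> Obj C \<Longrightarrow> bij_betw (\<phi> Y X) (Hom C (fobj L Y) X) (Hom D Y (fobj G X))"
    and nat: "\<And>Y X Y' X' h x y. \<lbrakk>Y \<in> Obj D; X \<in> Obj C; Y' \<in> Obj D; X' \<in> Obj C; h \<in> Hom C (fobj L Y) X;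
      y \<in> Hom D Y' Y; x \<in> Hom C X X'\<rbrakk>
      \<Longrightarrow> \<phi> Y' X' (x \<cdot>\<^bsub>C\<^esub> h \<cdot>\<^bsub>C\<^esub> farr L y) = farr G x \<cdot>\<^bsub>D\<^esub> \<phi> Y X h \<cdot>\<^bsub>D\<^esub> y"
    by (auto simp: adjunction_def)
  interpret C: category C using func by (simp add: is_functor_def)
  interpret D: category D using func by (simp add: is_functor_def)
  interpret L: cat_functor D C L by unfold_locales (rule func)
  interpret G: cat_functor C D G by unfold_locales (rule func)
  define \<psi> where "\<psi> X Y = inv_into (Hom C (fobj L Y) X) (\<phi> Y X)" for X Y
  have \<psi>bij: "bij_betw (\<psi> X Y) (Hom D Y (fobj G X)) (Hom C (fobj L Y) X)" if "Y \<in> Obj D" "X \<in> Obj C" for X Y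
    unfolding \<psi>_def using bij[OF that] by (rule bij_betw_inv_into)
  have \<phi>\<psi>: "\<phi> Y X (\<psi> X Y h) = h" if "Y \<in> Obj D" "X \<in> Obj C" "h \<in> Hom D Y (fobj G X)" for X Y h
    unfolding \<psi>_def using bij[OF that(1,2)] that(3) by (simp add: bij_betw_inv_into_right)
  have \<psi>\<phi>: "\<psi> X Y (\<phi> Y X h) = h" if "Y \<in> Obj D" "X \<in> Obj C" "h \<in> Hom C (fobj L Y) X" for X Y h
    unfolding \<psi>_def using bij[OF that(1,2)] that(3) by (simp add: bij_betw_inv_into_left)
  have "adjunction (op_category C) (op_category D) G L \<psi>"
    unfolding adjunction_def
  proof (intro conjI ballI)
    fix X Y X' Y' h x y
    assume o: "X \<in> Obj (op_category C)" "Y \<in> Obj (op_category D)" "X' \<in> Obj (op_category C)" "Y' \<in> Obj (op_category D)"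
      and h: "h \<in> Hom (op_category D) (fobj G X) Y" and x: "x \<in> Hom (op_category C) X' X"
      and y: "y \<in> Hom (op_category D) Y Y'"
    have h': "\<psi> X Y h \<in> Hom C (fobj L Y) X" using \<psi>bij[of Y X] o h by (auto dest: bij_betwE)
    have m: "x \<cdot>\<^bsub>C\<^esub> \<psi> X Y h \<cdot>\<^bsub>C\<^esub> farr L y \<in> Hom C (fobj L Y') X'"
      using h' x y by (auto simp: in_Hom)
    have "\<phi> Y' X' (x \<cdot>\<^bsub>C\<^esub> \<psi> X Y h \<cdot>\<^bsub>C\<^esub> farr L y) = farr G x \<cdot>\<^bsub>D\<^esub> h \<cdot>\<^bsub>D\<^esub> y"
      using nat[OF _ _ _ _ h', of Y' X' y x] \<phi>\<psi>[of Y X h] o h x y by simp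
    hence "\<psi> X' Y' (farr G x \<cdot>\<^bsub>D\<^esub> h \<cdot>\<^bsub>D\<^esub> y) = x \<cdot>\<^bsub>C\<^esub> \<psi> X Y h \<cdot>\<^bsub>C\<^esub> farr L y"
      using \<psi>\<phi>[of Y' X'] m o by (metis op_sel(1))
    thus "\<psi> X' Y' (y \<cdot>\<^bsub>op_category D\<^esub> h \<cdot>\<^bsub>op_category D\<^esub> farr G x) =
       farr L y \<cdot>\<^bsub>op_category C\<^esub> \<psi> X Y h \<cdot>\<^bsub>op_category C\<^esub> x"
      using h' o h x y by (simp add: in_Hom)
  qed (use \<psi>bij op_functor func in auto)
  thus ?thesis unfolding adjoint_def by (rule exI[of _ \<psi>])
qed

lemma op_F_split:
  assumes "preadditive_category B"
  shows "F_split (op_category A) (op_category B) F = (F_split A B F)\<inverse>"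
  unfolding F_split_def
  by (simp add: preadditive_category.op_split_short_exact[OF assms] set_eq_iff)

section \<open>Quotients and triangles\<close>

text \<open>Only a right inverse of \<open>a\<close> and a left inverse of \<open>b\<close> enter.
  This reverses each square of an isomorphism of triangles.\<close>

lemma (in category) square_inverse:
  assumes "u \<in> Arr C" "u' \<in> Arr C" "a \<in> Arr C" "a' \<in> Arr C" "b \<in> Arr C" "b' \<in> Arr C"
    "Dom C a = Dom C u" "Cod C a = Dom C u'" "Dom C b = Cod C u" "Cod C b = Cod C u'"
    "Dom C a' = Dom C u'" "Cod C a' = Dom C u" "Dom C b' = Cod C u'" "Cod C b' = Cod C u"
    "b \<cdot> u = u' \<cdot> a" "a \<cdot> a' = Ident C (Dom C u')" "b' \<cdot> b = Ident C (Cod C u)"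
  shows "b' \<cdot> u' = u \<cdot> a'"
proof -
  have "b' \<cdot> u' = b' \<cdot> ((u' \<cdot> a) \<cdot> a')" using assms(1-14,16) by simp
  also have "\<dots> = u \<cdot> a'"
    unfolding assms(15)[symmetric]
    using assms(1-14) Comp_reassoc[OF assms(17), of "u \<cdot> a'"] by simp
  finally show ?thesis .
qed

text \<open>The two hypotheses provide a right inverse \<open>f \<cdot> r\<close> and a left inverse
  \<open>l \<cdot> h\<close> of \<open>g\<close>, and these must coincide.\<close>

lemma (in category) is_iso_two_sided:
  assumes "is_iso C (g \<cdot> f)" "is_iso C (h \<cdot> g)" "f \<in> Arr C" "g \<in> Arr C" "h \<in> Arr C"
    "Cod C f = Dom C g" "Cod C g = Dom C h"
  shows "is_iso C g"
proof -
  obtain r where r: "r \<in> Arr C" "Dom C r = Cod C g" "Cod C r = Dom C f" "(g \<cdot> f) \<cdot> r = Ident C (Cod C g)"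
    using is_isoE[OF assms(1)] assms by (metis Comp_Arr)
  obtain l where l: "l \<in> Arr C" "Dom C l = Cod C h" "Cod C l = Dom C g" "l \<cdot> (h \<cdot> g) = Ident C (Dom C g)"
    using is_isoE[OF assms(2)] assms by (metis Comp_Arr)
  let ?r = "f \<cdot> r" and ?l = "l \<cdot> h"
  have e: "g \<cdot> ?r = Ident C (Cod C g)" "?l \<cdot> g = Ident C (Dom C g)" using assms r l by simp_all
  have "?l = ?l \<cdot> (g \<cdot> ?r)" unfolding e using assms l by simp
  also have "\<dots> = (?l \<cdot> g) \<cdot> ?r" using assms(3-) r(1-3) l(1-3) by simp
  also have "\<dots> = ?r" unfolding e using assms r by simp
  finally have "?r \<cdot> g = Ident C (Dom C g)" using e by simp
  thus ?thesis
    by (intro is_isoI[of g "Dom C g" "Cod C g" ?r]) (use e assms r in \<open>simp_all add: in_Hom\<close>)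
qed

text \<open>Let n be \<open>c\<close> minus the identity. It kills \<open>v\<close>, so by the weak
  cokernel property \<open>weak\<close> it factors as \<open>d \<cdot> w\<close>; since
  \<open>w\<close> kills n, the square of n is \<open>d \<cdot> w\<close> after n, hence zero. So
  identity plus n has inverse identity minus n.\<close>

lemma (in preadditive_category) is_iso_square_zero:
  assumes c: "c \<in> Arr C" "Dom C c = Z" "Cod C c = Z" and v: "v \<in> Arr C" "Cod C v = Z"
    and w: "w \<in> Arr C" "Dom C w = Z" and cv: "c \<cdot> v = v" and wc: "w \<cdot> c = w"
    and weak: "\<And>y. \<lbrakk>y \<in> Arr C; Dom C y = Z; y \<cdot> v = Null C (Dom C v) (Cod C y)\<rbrakk>
      \<Longrightarrow> \<exists>d \<in> Arr C. Dom C d = Cod C w \<and> Cod C d = Cod C y \<and> d \<cdot> w = y"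
  shows "is_iso C c"
proof -
  let ?n = "c \<boxplus> Neg C (Ident C Z)"
  have Z: "Z \<in> Obj C" using c by auto
  have n: "?n \<in> Arr C" "Dom C ?n = Z" "Cod C ?n = Z" using c Z by simp_all
  have "?n \<cdot> v = Null C (Dom C v) Z" using c v Z cv by (simp add: Add_Comp)
  then obtain d where d: "d \<in> Arr C" "Dom C d = Cod C w" "Cod C d = Z" "d \<cdot> w = ?n"
    using weak[of ?n] n by auto
  have wn: "w \<cdot> ?n = Null C Z (Cod C w)" using c w Z wc by (simp add: Comp_Add)
  have "?n \<cdot> ?n = d \<cdot> (w \<cdot> ?n)" using Comp_reassoc[OF d(4), of ?n] d n w by simp
  hence nn: "?n \<cdot> ?n = Null C Z Z" unfolding wn using d w Z by simp
  have cn: "c = Ident C Z \<boxplus> ?n" using c Z by (simp add: Add_ac)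
  let ?i = "Ident C Z \<boxplus> Neg C ?n"
  have i: "?i \<in> Arr C" "Dom C ?i = Z" "Cod C ?i = Z" using n Z by simp_all
  have m: "n \<in> Arr C \<Longrightarrow> Dom C n = Z \<Longrightarrow> Cod C n = Z \<Longrightarrow> n \<cdot> n = Null C Z Z \<Longrightarrow>
    (Ident C Z \<boxplus> Neg C n) \<cdot> (Ident C Z \<boxplus> n) = Ident C Z \<and>
    (Ident C Z \<boxplus> n) \<cdot> (Ident C Z \<boxplus> Neg C n) = Ident C Z" for n
    using Z by (simp add: hom_algebra)
  show ?thesis
    by (rule is_isoI[of c Z Z ?i])
      (use c i m[OF n nn] in \<open>simp_all add: in_Hom flip: cn\<close>)
qed

context cat_functor
begin

text \<open>The quasi-inverse chooses for every \<open>Y\<close> a preimage object with an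
  isomorphism onto \<open>Y\<close>; on arrows it takes the unique preimage of the conjugated arrow,
  and all identities are checked after applying \<open>F\<close>.\<close>

lemma full_faithful_surj_equivalence:
  assumes faithful: "faithful C F"
    and full: "\<And>X Y g. \<lbrakk>X \<in> Obj C; Y \<in> Obj C; g \<in> Hom D (fobj F X) (fobj F Y)\<rbrakk>
      \<Longrightarrow> \<exists>f \<in> Hom C X Y. farr F f = g"
    and surj: "\<And>Y. Y \<in> Obj D \<Longrightarrow> \<exists>X \<in> Obj C. \<exists>e \<in> Hom D (fobj F X) Y. is_iso D e"
  shows "is_equivalence C D F"
proof -
  have inj: "f = g" if "farr F f = farr F g" "f \<in> Arr C" "g \<in> Arr C" "Dom C f = Dom C g" "Cod C f = Cod C g" for f g
    using faithful that C.Dom_Obj[of g] C.Cod_Obj[of g]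
    unfolding faithful_def inj_on_def Ball_def in_Hom by metis
  \<comment> \<open>Bundling the conditions into one predicate lets a single use of choice pick the
    object and both mutually inverse arrows together.\<close>
  define good where "good Y X e e' \<longleftrightarrow> X \<in> Obj C \<and> e \<in> Arr D \<and> e' \<in> Arr D \<and> Dom D e = fobj F X \<and>
      Cod D e = Y \<and> Dom D e' = Y \<and> Cod D e' = fobj F X \<and> e' \<cdot>\<^bsub>D\<^esub> e = Ident D (fobj F X) \<and>
      e \<cdot>\<^bsub>D\<^esub> e' = Ident D Y \<and> is_iso D e" for Y X e e'
  have "\<exists>X e e'. good Y X e e'" if Y: "Y \<in> Obj D" for Y
  proof -
    obtain X e where X: "X \<in> Obj C" "e \<in> Arr D" "Dom D e = fobj F X" "Cod D e = Y" "is_iso D e"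
      using surj[OF Y] by (auto simp: in_Hom)
    show ?thesis
      using D.is_isoE[OF X(5)] X unfolding good_def by metis
  qed
  then obtain G0 e e' where "\<And>Y. Y \<in> Obj D \<Longrightarrow> good Y (G0 Y) (e Y) (e' Y)" by metis
  hence G0: "\<And>Y. Y \<in> Obj D \<Longrightarrow> G0 Y \<in> Obj C"
    and e: "\<And>Y. Y \<in> Obj D \<Longrightarrow> e Y \<in> Arr D" "\<And>Y. Y \<in> Obj D \<Longrightarrow> Dom D (e Y) = fobj F (G0 Y)"
      "\<And>Y. Y \<in> Obj D \<Longrightarrow> Cod D (e Y) = Y" "\<And>Y. Y \<in> Obj D \<Longrightarrow> is_iso D (e Y)"
    and e': "\<And>Y. Y \<in> Obj D \<Longrightarrow> e' Y \<in> Arr D" "\<And>Y. Y \<in> Obj D \<Longrightarrow> Dom D (e' Y) = Y"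
      "\<And>Y. Y \<in> Obj D \<Longrightarrow> Cod D (e' Y) = fobj F (G0 Y)"
    and e'e: "\<And>Y. Y \<in> Obj D \<Longrightarrow> e' Y \<cdot>\<^bsub>D\<^esub> e Y = Ident D (fobj F (G0 Y))"
    and ee': "\<And>Y. Y \<in> Obj D \<Longrightarrow> e Y \<cdot>\<^bsub>D\<^esub> e' Y = Ident D Y"
    unfolding good_def by blast+
  note ee = e e' e'e ee' G0 D.Comp_reassoc[OF e'e] D.Comp_reassoc[OF ee']
  have "\<exists>f. f \<in> Arr C \<and> Dom C f = G0 (Dom D g) \<and> Cod C f = G0 (Cod D g) \<and>
      farr F f = e' (Cod D g) \<cdot>\<^bsub>D\<^esub> g \<cdot>\<^bsub>D\<^esub> e (Dom D g)" if "g \<in> Arr D" for g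
    using full[of "G0 (Dom D g)" "G0 (Cod D g)" "e' (Cod D g) \<cdot>\<^bsub>D\<^esub> g \<cdot>\<^bsub>D\<^esub> e (Dom D g)"] that ee(1-10)
    by (auto simp: in_Hom)
  then obtain G1 where G1: "\<And>g. g \<in> Arr D \<Longrightarrow> G1 g \<in> Arr C" "\<And>g. g \<in> Arr D \<Longrightarrow> Dom C (G1 g) = G0 (Dom D g)"
    "\<And>g. g \<in> Arr D \<Longrightarrow> Cod C (G1 g) = G0 (Cod D g)"
    and FG1: "\<And>g. g \<in> Arr D \<Longrightarrow> farr F (G1 g) = e' (Cod D g) \<cdot>\<^bsub>D\<^esub> g \<cdot>\<^bsub>D\<^esub> e (Dom D g)"
    by metis
  \<comment> \<open>The components of the isomorphism from the composite endofunctor of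
    \<open>C\<close> to the identity, with their inverses: preimages under \<open>F\<close> of the
    isomorphisms chosen at \<open>fobj F X\<close>.\<close>
  define good' where "good' X h h' \<longleftrightarrow> h \<in> Arr C \<and> h' \<in> Arr C \<and> Dom C h = G0 (fobj F X) \<and>
      Cod C h = X \<and> Dom C h' = X \<and> Cod C h' = G0 (fobj F X) \<and> farr F h = e (fobj F X) \<and>
      farr F h' = e' (fobj F X)" for X h h'
  have "\<exists>h h'. good' X h h'" if X: "X \<in> Obj C" for X
  proof -
    have "\<exists>h \<in> Hom C (G0 (fobj F X)) X. farr F h = e (fobj F X)"
      by (rule full) (use X ee(1-10) in \<open>simp_all add: in_Hom\<close>)
    moreover have "\<exists>h \<in> Hom C X (G0 (fobj F X)). farr F h = e' (fobj F X)"
      by (rule full) (use X ee(1-10) in \<open>simp_all add: in_Hom\<close>)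
    ultimately show ?thesis unfolding in_Hom Bex_def good'_def by blast
  qed
  then obtain h h' where "\<And>X. X \<in> Obj C \<Longrightarrow> good' X (h X) (h' X)" by metis
  hence h: "\<And>X. X \<in> Obj C \<Longrightarrow> h X \<in> Arr C" "\<And>X. X \<in> Obj C \<Longrightarrow> h' X \<in> Arr C"
    "\<And>X. X \<in> Obj C \<Longrightarrow> Dom C (h X) = G0 (fobj F X)" "\<And>X. X \<in> Obj C \<Longrightarrow> Cod C (h X) = X"
    "\<And>X. X \<in> Obj C \<Longrightarrow> Dom C (h' X) = X" "\<And>X. X \<in> Obj C \<Longrightarrow> Cod C (h' X) = G0 (fobj F X)"
    and Fh: "\<And>X. X \<in> Obj C \<Longrightarrow> farr F (h X) = e (fobj F X)" "\<And>X. X \<in> Obj C \<Longrightarrow> farr F (h' X) = e' (fobj F X)"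
    unfolding good'_def by blast+
  let ?G = "\<lparr>fobj = G0, farr = G1\<rparr>"
  have G: "is_functor D C ?G"
    unfolding is_functor_def
  proof (intro conjI allI ballI)
    fix X assume X: "X \<in> Obj D"
    show "farr ?G (Ident D X) = Ident C (fobj ?G X)"
      by (rule inj) (use X ee G1 FG1 in simp_all)
  next
    fix X Y Z f g assume fg: "f \<in> Hom D X Y" "g \<in> Hom D Y Z"
    have "G1 (g \<cdot>\<^bsub>D\<^esub> f) = G1 g \<cdot>\<^bsub>C\<^esub> G1 f"
      by (rule inj) (use fg ee G1 FG1 in \<open>auto simp: in_Hom\<close>)
    thus "farr ?G (g \<cdot>\<^bsub>D\<^esub> f) = farr ?G g \<cdot>\<^bsub>C\<^esub> farr ?G f" by simp
  qed (use G0 G1 C.category_axioms D.category_axioms in \<open>auto simp: in_Hom\<close>)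
  have isoh: "is_iso C (h X)" if X: "X \<in> Obj C" for X
  proof (rule C.is_isoI[of _ "G0 (fobj F X)" X "h' X"])
    show "h' X \<cdot>\<^bsub>C\<^esub> h X = Ident C (G0 (fobj F X))"
      by (rule inj) (use X ee h Fh in simp_all)
    show "h X \<cdot>\<^bsub>C\<^esub> h' X = Ident C X"
      by (rule inj) (use X ee h Fh in simp_all)
  qed (use X h in \<open>simp_all add: in_Hom\<close>)
  have nath: "h Y \<cdot>\<^bsub>C\<^esub> G1 (farr F f) = f \<cdot>\<^bsub>C\<^esub> h X" if "f \<in> Hom C X Y" for X Y f
    by (rule inj) (use that ee h Fh G1 FG1 in \<open>auto simp: in_Hom\<close>)
  have "naturally_isomorphic C C (comp_functor ?G F) id_functor"
    unfolding naturally_isomorphic_def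
    by (rule exI[of _ h]) (use isoh nath h in \<open>auto simp: in_Hom comp_functor_def id_functor_def\<close>)
  moreover have "naturally_isomorphic D D (comp_functor F ?G) id_functor"
    unfolding naturally_isomorphic_def
    by (rule exI[of _ e]) (use ee FG1 in \<open>auto simp: in_Hom comp_functor_def id_functor_def\<close>)
  ultimately show ?thesis
    unfolding is_equivalence_def using is_functor G by blast
qed

end

text \<open>Only an additive endofunctor is required, so the calculus of candidate triangles is
  available while the axioms of a triangulated category are still being proved.\<close>

locale shift_category = T: additive_category T + additive_cat_functor T T S
  for T :: "('o, 'm, 'z) preadditive_data_scheme" (structure)
    and S :: "('o, 'm, 'o, 'm) functor_data"
begin

lemma triangle_iff:
  "is_triangle T S (u, v, w) \<longleftrightarrow> u \<in> Arr T \<and> v \<in> Arr T \<and> w \<in> Arr T \<and>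
     Cod T u = Dom T v \<and> Cod T v = Dom T w \<and> Cod T w = fobj S (Dom T u)"
  by (simp add: is_triangle_def)

lemma triangle_mapI:
  assumes "a \<in> Arr T" "b \<in> Arr T" "c \<in> Arr T" "Dom T a = Dom T u" "Dom T b = Dom T v" "Dom T c = Dom T w"
    "Cod T a = Dom T u'" "Cod T b = Dom T v'" "Cod T c = Dom T w'"
    "b \<cdot> u = u' \<cdot> a" "c \<cdot> v = v' \<cdot> b" "farr S a \<cdot> w = w' \<cdot> c"
  shows "triangle_map T S (u, v, w) (u', v', w') a b c"
  using assms by (simp add: triangle_map_def in_Hom)

lemma triangle_mapD:
  assumes "triangle_map T S (u, v, w) (u', v', w') a b c"
  shows "a \<in> Arr T" "b \<in> Arr T" "c \<in> Arr T" "Dom T a = Dom T u" "Dom T b = Dom T v" "Dom T c = Dom T w"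
    "Cod T a = Dom T u'" "Cod T b = Dom T v'" "Cod T c = Dom T w'"
    "b \<cdot> u = u' \<cdot> a" "c \<cdot> v = v' \<cdot> b" "farr S a \<cdot> w = w' \<cdot> c"
  using assms by (simp_all add: triangle_map_def in_Hom)

lemma triangle_map_Comp:
  assumes t: "is_triangle T S (u, v, w)" "is_triangle T S (u', v', w')" "is_triangle T S (u'', v'', w'')"
    and m: "triangle_map T S (u, v, w) (u', v', w') a b c" "triangle_map T S (u', v', w') (u'', v'', w'') a' b' c'"
  shows "triangle_map T S (u, v, w) (u'', v'', w'') (a' \<cdot> a) (b' \<cdot> b) (c' \<cdot> c)"
proof -
  note x = t[unfolded triangle_iff] and y = triangle_mapD[OF m(1)] and z = triangle_mapD[OF m(2)]
  show ?thesis
    by (rule triangle_mapI)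
      (use x y z T.Comp_reassoc[OF z(10), of a] T.Comp_reassoc[OF z(11), of b] T.Comp_reassoc[OF z(12), of c]
        in simp_all)
qed

lemma triangle_isoI:
  assumes "is_triangle T S (u, v, w)" "is_triangle T S (u', v', w')" "is_iso T a" "is_iso T b" "is_iso T c"
    "Dom T a = Dom T u" "Dom T b = Dom T v" "Dom T c = Dom T w"
    "Cod T a = Dom T u'" "Cod T b = Dom T v'" "Cod T c = Dom T w'"
    "b \<cdot> u = u' \<cdot> a" "c \<cdot> v = v' \<cdot> b" "farr S a \<cdot> w = w' \<cdot> c"
  shows "triangle_iso T S (u, v, w) (u', v', w')"
proof -
  have "a \<in> Arr T" "b \<in> Arr T" "c \<in> Arr T" using assms(3-5) by (auto simp: is_iso_def)
  thus ?thesis using assms unfolding triangle_iso_def triangle_map_def by (auto simp: in_Hom)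
qed

lemma triangle_iso_mapsE:
  assumes "triangle_iso T S (u, v, w) (u', v', w')"
  obtains a b c a' b' c' where
    "triangle_map T S (u, v, w) (u', v', w') a b c" "triangle_map T S (u', v', w') (u, v, w) a' b' c'"
    "a' \<cdot> a = Ident T (Dom T u)" "a \<cdot> a' = Ident T (Dom T u')"
    "b' \<cdot> b = Ident T (Dom T v)" "b \<cdot> b' = Ident T (Dom T v')"
    "c' \<cdot> c = Ident T (Dom T w)" "c \<cdot> c' = Ident T (Dom T w')"
    "is_iso T a'" "is_iso T b'" "is_iso T c'"
proof -
  obtain a b c where t: "is_triangle T S (u, v, w)" "is_triangle T S (u', v', w')"
    and m: "triangle_map T S (u, v, w) (u', v', w') a b c" and iso: "is_iso T a" "is_iso T b" "is_iso T c"
    using assms unfolding triangle_iso_def by blast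
  note arr = triangle_mapD(1-9)[OF m] and eq = triangle_mapD(10-12)[OF m]
  obtain a' where a: "a' \<in> Arr T" "Dom T a' = Cod T a" "Cod T a' = Dom T a"
    "a' \<cdot> a = Ident T (Dom T a)" "a \<cdot> a' = Ident T (Cod T a)" "is_iso T a'"
    using T.is_isoE[OF iso(1)] by metis
  obtain b' where b: "b' \<in> Arr T" "Dom T b' = Cod T b" "Cod T b' = Dom T b"
    "b' \<cdot> b = Ident T (Dom T b)" "b \<cdot> b' = Ident T (Cod T b)" "is_iso T b'"
    using T.is_isoE[OF iso(2)] by metis
  obtain c' where c: "c' \<in> Arr T" "Dom T c' = Cod T c" "Cod T c' = Dom T c"
    "c' \<cdot> c = Ident T (Dom T c)" "c \<cdot> c' = Ident T (Cod T c)" "is_iso T c'"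
    using T.is_isoE[OF iso(3)] by metis
  have S: "farr S a' \<cdot> farr S a = Ident T (fobj S (Dom T a))"
    using a arr t[unfolded triangle_iff] by (simp flip: farr_Comp)
  show thesis
  proof (rule that[of a b c a' b' c'])
    show "triangle_map T S (u, v, w) (u', v', w') a b c" by (rule m)
    show "triangle_map T S (u', v', w') (u, v, w) a' b' c'"
    proof (rule triangle_mapI)
      show "b' \<cdot> u' = u \<cdot> a'"
        by (rule T.square_inverse[where a = a and b = b]) (use t arr a b eq in \<open>simp_all add: triangle_iff\<close>)
      show "c' \<cdot> v' = v \<cdot> b'"
        by (rule T.square_inverse[where a = b and b = c]) (use t arr b c eq in \<open>simp_all add: triangle_iff\<close>)
      show "farr S a' \<cdot> w' = w \<cdot> c'"
        by (rule T.square_inverse[where a = c and b = "farr S a"]) (use t arr a c eq S in \<open>simp_all add: triangle_iff\<close>)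
    qed (use t arr a b c in simp_all)
  qed (use arr a b c in simp_all)
qed

lemma triangle_iso_sym:
  assumes "triangle_iso T S (u, v, w) (u', v', w')"
  shows "triangle_iso T S (u', v', w') (u, v, w)"
proof -
  obtain a' b' c' where "triangle_map T S (u', v', w') (u, v, w) a' b' c'"
    "is_iso T a'" "is_iso T b'" "is_iso T c'"
    by (rule triangle_iso_mapsE[OF assms])
  thus ?thesis using assms unfolding triangle_iso_def by blast
qed

lemma triangle_iso_trans:
  assumes t: "triangle_iso T S (u, v, w) (u', v', w')" "triangle_iso T S (u', v', w') (u'', v'', w'')"
  shows "triangle_iso T S (u, v, w) (u'', v'', w'')"
proof -
  obtain a b c where m: "triangle_map T S (u, v, w) (u', v', w') a b c" "is_iso T a" "is_iso T b" "is_iso T c"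
    using t(1) unfolding triangle_iso_def by blast
  obtain a' b' c' where m': "triangle_map T S (u', v', w') (u'', v'', w'') a' b' c'"
    "is_iso T a'" "is_iso T b'" "is_iso T c'"
    using t(2) unfolding triangle_iso_def by blast
  have T: "is_triangle T S (u, v, w)" "is_triangle T S (u', v', w')" "is_triangle T S (u'', v'', w'')"
    using t by (simp_all add: triangle_iso_def)
  note d = triangle_mapD[OF m(1)] triangle_mapD[OF m'(1)]
  have "is_iso T (a' \<cdot> a)" "is_iso T (b' \<cdot> b)" "is_iso T (c' \<cdot> c)"
    using m(2-4) m'(2-4) d(7-9) d(16-18) by simp_all
  thus ?thesis
    using triangle_map_Comp[OF T m(1) m'(1)] T unfolding triangle_iso_def by blast
qed

lemma triangle_iso_refl: "is_triangle T S (u, v, w) \<Longrightarrow> triangle_iso T S (u, v, w) (u, v, w)"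
  by (rule triangle_isoI[of _ _ _ _ _ _ "Ident T (Dom T u)" "Ident T (Dom T v)" "Ident T (Dom T w)"])
    (auto simp: triangle_iff)

lemma triangle_iso_rotate:
  assumes "triangle_iso T S (u, v, w) (u', v', w')"
  shows "triangle_iso T S (v, w, Neg T (farr S u)) (v', w', Neg T (farr S u'))"
proof -
  obtain a b c where t: "is_triangle T S (u, v, w)" "is_triangle T S (u', v', w')"
    and m: "triangle_map T S (u, v, w) (u', v', w') a b c" and iso: "is_iso T a" "is_iso T b" "is_iso T c"
    using assms unfolding triangle_iso_def by blast
  note arr = triangle_mapD(1-9)[OF m] and eq = triangle_mapD(10-12)[OF m]
  note x = t[unfolded triangle_iff]
  have "farr S b \<cdot> farr S u = farr S u' \<cdot> farr S a" using x arr eq by (simp flip: farr_Comp)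
  thus ?thesis
    by (intro triangle_isoI[of _ _ _ _ _ _ b c "farr S a"])
      (use iso arr eq x in \<open>simp_all add: triangle_iff farr_is_iso\<close>)
qed

end

text \<open>Closure under composition on either side is automatic for arrows through
  \<open>\<P>\<close>; with zero and sums they form a two-sided ideal. Asking for sums of arrows
  avoids asking that \<open>\<P>\<close> be closed under direct sums.\<close>

locale additive_quotient = additive_category C
  for C :: "('o, 'm, 'z) preadditive_data_scheme" (structure) +
  fixes \<P> :: "'o set"
  assumes null_Null: "\<lbrakk>X \<in> Obj C; Y \<in> Obj C\<rbrakk> \<Longrightarrow> factors_through C \<P> (Null C X Y)"
    and null_Add: "\<lbrakk>f \<in> Arr C; g \<in> Arr C; Dom C f = Dom C g; Cod C f = Cod C g;
      factors_through C \<P> f; factors_through C \<P> g\<rbrakk> \<Longrightarrow> factors_through C \<P> (f \<boxplus> g)"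
begin

abbreviation "Q \<equiv> quot_category C \<P>"
abbreviation "cls \<equiv> quot_class C \<P>"
abbreviation "null \<equiv> factors_through C \<P>"
abbreviation quot_comp (infixr \<open>\<bullet>\<close> 70) where "quot_comp \<equiv> Comp (quot_category C \<P>)"

lemma null_Comp_left:
  assumes "null f" "f \<in> Arr C" "g \<in> Arr C" "Cod C f = Dom C g"
  shows "null (g \<cdot> f)"
proof -
  obtain P a b where P: "P \<in> \<P>" "a \<in> Arr C" "Dom C a = Dom C f" "Cod C a = P" "b \<in> Arr C" "Dom C b = P"
    "Cod C b = Cod C f" "f = b \<cdot> a"
    using assms(1) by (auto simp: factors_through_def in_Hom)
  show ?thesis
    unfolding factors_through_def in_Hom
    by (rule bexI[of _ P], rule bexI[of _ a], rule bexI[of _ "g \<cdot> b"])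
      (use P assms in \<open>simp_all add: in_Hom\<close>)
qed

lemma null_Comp_right:
  assumes "null g" "f \<in> Arr C" "g \<in> Arr C" "Cod C f = Dom C g"
  shows "null (g \<cdot> f)"
proof -
  obtain P a b where P: "P \<in> \<P>" "a \<in> Arr C" "Dom C a = Dom C g" "Cod C a = P" "b \<in> Arr C" "Dom C b = P"
    "Cod C b = Cod C g" "g = b \<cdot> a"
    using assms(1) by (auto simp: factors_through_def in_Hom)
  show ?thesis
    unfolding factors_through_def in_Hom
    by (rule bexI[of _ P], rule bexI[of _ "a \<cdot> f"], rule bexI[of _ b])
      (use P assms in \<open>simp_all add: in_Hom\<close>)
qed

lemma null_Neg:
  assumes "null f" "f \<in> Arr C"
  shows "null (Neg C f)"
  using null_Comp_left[of f "Neg C (Ident C (Cod C f))"] assms by simp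

lemma quot_rel_iff:
  "(f, g) \<in> quot_rel C \<P> \<longleftrightarrow> f \<in> Arr C \<and> g \<in> Arr C \<and> Dom C f = Dom C g \<and> Cod C f = Cod C g \<and>
    null (f \<boxplus> Neg C g)"
  by (auto simp: quot_rel_def in_Hom)

lemma quot_equiv: "equiv (Arr C) (quot_rel C \<P>)"
proof (rule equivI)
  show "refl_on (Arr C) (quot_rel C \<P>)"
    by (auto simp: refl_on_def quot_rel_iff null_Null)
  show "sym (quot_rel C \<P>)"
  proof (rule symI)
    fix f g assume fg: "(f, g) \<in> quot_rel C \<P>"
    hence "null (Neg C (f \<boxplus> Neg C g))" using null_Neg[of "f \<boxplus> Neg C g"] by (simp add: quot_rel_iff)
    thus "(g, f) \<in> quot_rel C \<P>" using fg by (simp add: quot_rel_iff Neg_Add_distrib Add_commute)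
  qed
  show "trans (quot_rel C \<P>)"
  proof (rule transI)
    fix f g h assume *: "(f, g) \<in> quot_rel C \<P>" "(g, h) \<in> quot_rel C \<P>"
    have "null ((f \<boxplus> Neg C g) \<boxplus> (g \<boxplus> Neg C h))"
      by (rule null_Add) (use * in \<open>simp_all add: quot_rel_iff\<close>)
    moreover have "(f \<boxplus> Neg C g) \<boxplus> (g \<boxplus> Neg C h) = f \<boxplus> Neg C h"
      using * by (simp add: quot_rel_iff Add_assoc Add_cancel)
    ultimately show "(f, h) \<in> quot_rel C \<P>" using * by (simp add: quot_rel_iff)
  qed
qed (auto simp: quot_rel_iff)

lemma cls_eq_iff:
  "\<lbrakk>f \<in> Arr C; g \<in> Arr C\<rbrakk> \<Longrightarrow> cls f = cls g \<longleftrightarrow>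
    Dom C f = Dom C g \<and> Cod C f = Cod C g \<and> null (f \<boxplus> Neg C g)"
  unfolding quot_class_def using eq_equiv_class_iff[OF quot_equiv, of f g] by (simp add: quot_rel_iff)

lemma cls_eqI:
  "\<lbrakk>f \<in> Arr C; g \<in> Arr C; Dom C f = Dom C g; Cod C f = Cod C g; null (f \<boxplus> Neg C g)\<rbrakk> \<Longrightarrow> cls f = cls g"
  by (simp add: cls_eq_iff)

lemma cls_memD:
  assumes "f \<in> Arr C" "f' \<in> cls f"
  shows "f' \<in> Arr C" "Dom C f' = Dom C f" "Cod C f' = Cod C f" "cls f' = cls f" "null (f' \<boxplus> Neg C f)"
proof -
  have "(f, f') \<in> quot_rel C \<P>" using assms by (simp add: quot_class_def)
  moreover from this have "(f', f) \<in> quot_rel C \<P>" using quot_equiv by (meson equivE symE)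
  ultimately show "f' \<in> Arr C" "Dom C f' = Dom C f" "Cod C f' = Cod C f" "cls f' = cls f" "null (f' \<boxplus> Neg C f)"
    by (auto simp: quot_rel_iff cls_eq_iff)
qed

lemma cls_self: "f \<in> Arr C \<Longrightarrow> f \<in> cls f"
  by (simp add: quot_class_def quot_rel_iff null_Null)

lemma quot_Obj [simp]: "Obj Q = Obj C"
  by (simp add: quot_category_def)

lemma cls_Arr [simp]:
  assumes "f \<in> Arr C"
  shows "cls f \<in> Arr Q" "Dom Q (cls f) = Dom C f" "Cod Q (cls f) = Cod C f"
proof -
  show "cls f \<in> Arr Q" using assms by (simp add: quot_category_def quot_class_def quotientI)
  have "(SOME f'. f' \<in> cls f) \<in> cls f" using cls_self[OF assms] by (rule someI)
  thus "Dom Q (cls f) = Dom C f" "Cod Q (cls f) = Cod C f"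
    using cls_memD[OF assms] by (simp_all add: quot_category_def)
qed

lemma quot_ArrE:
  assumes "\<phi> \<in> Arr Q"
  obtains f where "f \<in> Arr C" "\<phi> = cls f" "Dom Q \<phi> = Dom C f" "Cod Q \<phi> = Cod C f"
  using assms that cls_Arr by (auto simp: quot_category_def quot_class_def elim!: quotientE)

lemma quot_Ident [simp]: "Ident Q X = cls (Ident C X)"
  by (simp add: quot_category_def)

lemma quot_Null [simp]: "Null Q X Y = cls (Null C X Y)"
  by (simp add: quot_category_def)

lemma quot_Comp [simp]:
  assumes "f \<in> Arr C" "g \<in> Arr C" "Cod C f = Dom C g"
  shows "cls g \<bullet> cls f = cls (g \<cdot> f)"
proof -
  have "cls (g' \<cdot> f') = cls (g \<cdot> f)" if "g' \<in> cls g" "f' \<in> cls f" for f' g'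
  proof (rule cls_eqI)
    note m = cls_memD[OF assms(2) that(1)] cls_memD[OF assms(1) that(2)]
    \<comment> \<open>The difference of the two composites is telescoped as
      \<open>(g' - g) \<cdot> f' + g \<cdot> (f' - f)\<close>.\<close>
    have "null (((g' \<boxplus> Neg C g) \<cdot> f') \<boxplus> (g \<cdot> (f' \<boxplus> Neg C f)))"
      by (rule null_Add)
        (use m assms null_Comp_right[of "g' \<boxplus> Neg C g" f'] null_Comp_left[of "f' \<boxplus> Neg C f" g] in simp_all)
    thus "null ((g' \<cdot> f') \<boxplus> Neg C (g \<cdot> f))"
      using m assms by (simp add: Add_Comp Comp_Add Add_assoc Add_cancel)
  qed (use cls_memD[OF assms(2) that(1)] cls_memD[OF assms(1) that(2)] assms in simp_all)
  hence "(\<Union>g' \<in> cls g. \<Union>f' \<in> cls f. cls (g' \<cdot> f')) =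
      (\<Union>g' \<in> cls g. \<Union>f' \<in> cls f. cls (g \<cdot> f))"
    by (intro SUP_cong refl)
  also have "\<dots> = cls (g \<cdot> f)"
    using cls_self[OF assms(1)] cls_self[OF assms(2)] by auto
  finally show ?thesis by (simp add: quot_category_def)
qed

lemma quot_Add [simp]:
  assumes "f \<in> Arr C" "g \<in> Arr C" "Dom C f = Dom C g" "Cod C f = Cod C g"
  shows "cls f \<boxplus>\<^bsub>Q\<^esub> cls g = cls (f \<boxplus> g)"
proof -
  have "cls (f' \<boxplus> g') = cls (f \<boxplus> g)" if "g' \<in> cls g" "f' \<in> cls f" for f' g'
  proof (rule cls_eqI)
    note m = cls_memD[OF assms(2) that(1)] cls_memD[OF assms(1) that(2)]
    have "null ((f' \<boxplus> Neg C f) \<boxplus> (g' \<boxplus> Neg C g))"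
      by (rule null_Add) (use m assms in simp_all)
    thus "null ((f' \<boxplus> g') \<boxplus> Neg C (f \<boxplus> g))"
      using m assms by (simp add: Neg_Add_distrib Add_ac)
  qed (use cls_memD[OF assms(2) that(1)] cls_memD[OF assms(1) that(2)] assms in simp_all)
  hence "(\<Union>f' \<in> cls f. \<Union>g' \<in> cls g. cls (f' \<boxplus> g')) =
      (\<Union>f' \<in> cls f. \<Union>g' \<in> cls g. cls (f \<boxplus> g))"
    by (intro SUP_cong refl)
  also have "\<dots> = cls (f \<boxplus> g)"
    using cls_self[OF assms(1)] cls_self[OF assms(2)] by auto
  finally show ?thesis by (simp add: quot_category_def)
qed

lemma quot_category_category: "category Q"
proof unfold_locales
  fix f assume "f \<in> Arr Q"
  then obtain f' where "f' \<in> Arr C" "f = cls f'" by (rule quot_ArrE)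
  thus "Dom Q f \<in> Obj Q" "Cod Q f \<in> Obj Q" by simp_all
next
  fix X assume "X \<in> Obj Q"
  thus "Ident Q X \<in> Hom Q X X" by (simp add: in_Hom)
next
  fix f g X Y Z assume "f \<in> Hom Q X Y" "g \<in> Hom Q Y Z"
  moreover from this obtain f' g' where "f' \<in> Arr C" "f = cls f'" "g' \<in> Arr C" "g = cls g'"
    by (auto simp: in_Hom elim!: quot_ArrE)
  ultimately show "g \<bullet> f \<in> Hom Q X Z" by (auto simp: in_Hom)
next
  fix f X Y assume "f \<in> Hom Q X Y"
  moreover from this obtain f' where "f' \<in> Arr C" "f = cls f'"
    by (auto simp: in_Hom elim!: quot_ArrE)
  ultimately show "f \<bullet> Ident Q X = f" "Ident Q Y \<bullet> f = f" by (auto simp: in_Hom)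
next
  fix f g h W X Y Z assume "f \<in> Hom Q W X" "g \<in> Hom Q X Y" "h \<in> Hom Q Y Z"
  moreover from this obtain f' g' h' where "f' \<in> Arr C" "f = cls f'" "g' \<in> Arr C" "g = cls g'"
      "h' \<in> Arr C" "h = cls h'"
    by (auto simp: in_Hom elim!: quot_ArrE)
  ultimately show "(h \<bullet> g) \<bullet> f = h \<bullet> (g \<bullet> f)" by (auto simp: in_Hom)
qed

lemma quot_hom_comm_group:
  assumes "X \<in> Obj C" "Y \<in> Obj C"
  shows "comm_group (hom_group Q X Y)"
proof (rule comm_groupI)
  have E: "\<exists>f'. f' \<in> Arr C \<and> f = cls f' \<and> Dom C f' = X \<and> Cod C f' = Y" if "f \<in> carrier (hom_group Q X Y)" for f
    using that by (auto simp: hom_group_def in_Hom elim!: quot_ArrE)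
  fix f g assume "f \<in> carrier (hom_group Q X Y)" "g \<in> carrier (hom_group Q X Y)"
  then obtain f' g' where *: "f' \<in> Arr C" "f = cls f'" "Dom C f' = X" "Cod C f' = Y"
    "g' \<in> Arr C" "g = cls g'" "Dom C g' = X" "Cod C g' = Y"
    using E by metis
  show "f \<otimes>\<^bsub>hom_group Q X Y\<^esub> g \<in> carrier (hom_group Q X Y)"
    "f \<otimes>\<^bsub>hom_group Q X Y\<^esub> g = g \<otimes>\<^bsub>hom_group Q X Y\<^esub> f"
    using * by (simp_all add: hom_group_def in_Hom Add_commute)
  {
    fix h assume "h \<in> carrier (hom_group Q X Y)"
    then obtain h' where "h' \<in> Arr C" "h = cls h'" "Dom C h' = X" "Cod C h' = Y"
      using E by metis
    thus "f \<otimes>\<^bsub>hom_group Q X Y\<^esub> g \<otimes>\<^bsub>hom_group Q X Y\<^esub> h =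
      f \<otimes>\<^bsub>hom_group Q X Y\<^esub> (g \<otimes>\<^bsub>hom_group Q X Y\<^esub> h)"
      using * by (simp add: hom_group_def Add_assoc)
  }
next
  fix f assume "f \<in> carrier (hom_group Q X Y)"
  then obtain f' where *: "f' \<in> Arr C" "f = cls f'" "Dom C f' = X" "Cod C f' = Y"
    by (auto simp: hom_group_def in_Hom elim!: quot_ArrE)
  show "\<one>\<^bsub>hom_group Q X Y\<^esub> \<otimes>\<^bsub>hom_group Q X Y\<^esub> f = f"
    using * assms by (simp add: hom_group_def)
  show "\<exists>g \<in> carrier (hom_group Q X Y). g \<otimes>\<^bsub>hom_group Q X Y\<^esub> f = \<one>\<^bsub>hom_group Q X Y\<^esub>"
    by (rule bexI[of _ "cls (Neg C f')"]) (use * in \<open>simp_all add: hom_group_def in_Hom\<close>)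
qed (use assms in \<open>simp add: hom_group_def in_Hom\<close>)

lemma quot_preadditive: "preadditive_category Q"
proof -
  interpret Q: category Q by (rule quot_category_category)
  show ?thesis
  proof (intro preadditive_category.intro preadditive_category_axioms.intro Q.category_axioms)
    fix f f' g X Y Z assume "f \<in> Hom Q X Y" "f' \<in> Hom Q X Y" "g \<in> Hom Q Y Z"
    moreover from this obtain a b c where "a \<in> Arr C" "f = cls a" "b \<in> Arr C" "f' = cls b"
        "c \<in> Arr C" "g = cls c"
      by (auto simp: in_Hom elim!: quot_ArrE)
    ultimately show "g \<bullet> (f \<boxplus>\<^bsub>Q\<^esub> f') = (g \<bullet> f) \<boxplus>\<^bsub>Q\<^esub> (g \<bullet> f')"
      by (auto simp: in_Hom Comp_Add)
  next
    fix f g g' X Y Z assume "f \<in> Hom Q X Y" "g \<in> Hom Q Y Z" "g' \<in> Hom Q Y Z"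
    moreover from this obtain a b c where "a \<in> Arr C" "f = cls a" "b \<in> Arr C" "g = cls b"
        "c \<in> Arr C" "g' = cls c"
      by (auto simp: in_Hom elim!: quot_ArrE)
    ultimately show "(g \<boxplus>\<^bsub>Q\<^esub> g') \<bullet> f = (g \<bullet> f) \<boxplus>\<^bsub>Q\<^esub> (g' \<bullet> f)"
      by (auto simp: in_Hom Add_Comp)
  qed (simp add: quot_hom_comm_group)
qed

lemma quot_zero_object:
  assumes "zero_object C Z"
  shows "zero_object Q Z"
proof -
  have Z: "Z \<in> Obj C" using assms by (simp add: zero_object_def)
  have "\<exists>!f. f \<in> Hom Q X Z" "\<exists>!f. f \<in> Hom Q Z X" if X: "X \<in> Obj C" for X
  proof -
    have u: "f \<in> Arr C \<Longrightarrow> Dom C f = X \<Longrightarrow> Cod C f = Z \<Longrightarrow> f = Null C X Z"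
      "f \<in> Arr C \<Longrightarrow> Dom C f = Z \<Longrightarrow> Cod C f = X \<Longrightarrow> f = Null C Z X" for f
      using assms X Null_Arr[OF X Z] Null_Arr[OF Z X] unfolding zero_object_def in_Hom by blast+
    show "\<exists>!f. f \<in> Hom Q X Z"
      by (rule ex1I[of _ "cls (Null C X Z)"]) (use X Z u in \<open>auto simp: in_Hom elim!: quot_ArrE\<close>)
    show "\<exists>!f. f \<in> Hom Q Z X"
      by (rule ex1I[of _ "cls (Null C Z X)"]) (use X Z u in \<open>auto simp: in_Hom elim!: quot_ArrE\<close>)
  qed
  thus ?thesis using Z by (simp add: zero_object_def)
qed

lemma quot_additive: "additive_category Q"
proof -
  interpret Q: preadditive_category Q by (rule quot_preadditive)
  show ?thesis
  proof unfold_locales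
    show "\<exists>Z. zero_object Q Z" using ex_zero_object quot_zero_object by blast
  next
    fix X Y assume XY: "X \<in> Obj Q" "Y \<in> Obj Q"
    then obtain S i j p q where S: "S \<in> Obj C" "i \<in> Hom C X S" "j \<in> Hom C Y S" "p \<in> Hom C S X"
      "q \<in> Hom C S Y" "p \<cdot> i = Ident C X" "q \<cdot> j = Ident C Y" "p \<cdot> j = Null C Y X" "q \<cdot> i = Null C X Y"
      "(i \<cdot> p) \<boxplus> (j \<cdot> q) = Ident C S"
      using ex_biproduct[of X Y] by auto
    show "\<exists>S\<in>Obj Q. \<exists>i\<in>Hom Q X S. \<exists>j\<in>Hom Q Y S. \<exists>p\<in>Hom Q S X. \<exists>q\<in>Hom Q S Y.
       p \<bullet> i = Ident Q X \<and> q \<bullet> j = Ident Q Y \<and> p \<bullet> j = Null Q Y X \<and> q \<bullet> i = Null Q X Y \<and>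
       (i \<bullet> p) \<boxplus>\<^bsub>Q\<^esub> (j \<bullet> q) = Ident Q S"
      by (rule bexI[of _ S], rule bexI[of _ "cls i"], rule bexI[of _ "cls j"], rule bexI[of _ "cls p"],
          rule bexI[of _ "cls q"])
        (use S in \<open>auto simp: in_Hom\<close>)
  qed
qed

sublocale Q: additive_category Q
  by (rule quot_additive)

lemma quot_Dom_Obj [simp]: "\<phi> \<in> Arr Q \<Longrightarrow> Dom Q \<phi> \<in> Obj C"
  and quot_Cod_Obj [simp]: "\<phi> \<in> Arr Q \<Longrightarrow> Cod Q \<phi> \<in> Obj C"
  using Q.Dom_Obj[of \<phi>] Q.Cod_Obj[of \<phi>] by simp_all

lemma quot_Comp_Ident [simp]: "\<lbrakk>\<phi> \<in> Arr Q; Dom Q \<phi> = X\<rbrakk> \<Longrightarrow> \<phi> \<bullet> cls (Ident C X) = \<phi>"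
  using Q.Comp_Ident'[of \<phi> X] by simp

lemma quot_Ident_Comp [simp]: "\<lbrakk>\<phi> \<in> Arr Q; Cod Q \<phi> = X\<rbrakk> \<Longrightarrow> cls (Ident C X) \<bullet> \<phi> = \<phi>"
  using Q.Ident_Comp'[of \<phi> X] by simp

lemma quot_Comp_Null [simp]:
  "\<lbrakk>\<phi> \<in> Arr Q; Dom Q \<phi> = Y; X \<in> Obj C\<rbrakk> \<Longrightarrow> \<phi> \<bullet> cls (Null C X Y) = cls (Null C X (Cod Q \<phi>))"
  using Q.Comp_Null[of \<phi> Y X] by simp

lemma quot_repE:
  assumes "\<phi> \<in> Arr Q" "Dom Q \<phi> = X" "Cod Q \<phi> = Y"
  obtains a where "a \<in> Arr C" "\<phi> = cls a" "Dom C a = X" "Cod C a = Y"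
proof -
  obtain a where "a \<in> Arr C" "\<phi> = cls a" "Dom Q \<phi> = Dom C a" "Cod Q \<phi> = Cod C a"
    by (rule quot_ArrE[OF assms(1)])
  thus thesis using that[of a] assms by simp
qed

lemma quot_Neg [simp]: "f \<in> Arr C \<Longrightarrow> Neg Q (cls f) = cls (Neg C f)"
  by (rule Q.Neg_unique) simp_all

lemma quot_functor_additive: "additive_functor C Q (quot_functor C \<P>)"
  unfolding additive_functor_def is_functor_def quot_functor_def
  using category_axioms Q.category_axioms by (auto simp: in_Hom)

lemma cls_is_iso:
  assumes "is_iso C f"
  shows "is_iso Q (cls f)"
proof -
  obtain g where "f \<in> Arr C" "g \<in> Arr C" "Dom C g = Cod C f" "Cod C g = Dom C f"
    "g \<cdot> f = Ident C (Dom C f)" "f \<cdot> g = Ident C (Cod C f)"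
    using is_isoE[OF assms] by metis
  thus ?thesis
    by (intro Q.is_isoI[of "cls f" "Dom C f" "Cod C f" "cls g"]) (simp_all add: in_Hom)
qed

end

section \<open>Frobenius exact structures\<close>

text \<open>The cancellation laws hold for every exact structure on an abelian category. For \<open>F\<close>-split
  sequences they are immediate, so they are taken as axioms here.\<close>

locale frobenius_exact = abelian_category C
  for C :: "('o, 'm, 'z) preadditive_data_scheme" (structure) +
  fixes E :: "('m \<times> 'm) set" and \<P> :: "'o set"
  assumes E_short_exact: "(f, g) \<in> E \<Longrightarrow> short_exact C f g"
    and inflation_E: "\<lbrakk>f \<in> inflations E; short_exact C f g\<rbrakk> \<Longrightarrow> (f, g) \<in> E"
    and deflation_E: "\<lbrakk>g \<in> deflations E; short_exact C f g\<rbrakk> \<Longrightarrow> (f, g) \<in> E"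
    and inflation_Comp: "\<lbrakk>i \<in> inflations E; i' \<in> inflations E; Cod C i = Dom C i'\<rbrakk>
      \<Longrightarrow> i' \<cdot> i \<in> inflations E"
    and inflation_cancel: "\<lbrakk>i' \<cdot> i \<in> inflations E; i \<in> Arr C; i' \<in> Arr C; Cod C i = Dom C i'\<rbrakk>
      \<Longrightarrow> i \<in> inflations E"
    and deflation_cancel: "\<lbrakk>d' \<cdot> d \<in> deflations E; d \<in> Arr C; d' \<in> Arr C; Cod C d = Dom C d'\<rbrakk>
      \<Longrightarrow> d' \<in> deflations E"
    and enough_proj: "enough_projectives C E"
    and enough_inj: "enough_injectives C E"
    and projectives_eq: "\<P> = projectives C E"
    and injectives_eq: "\<P> = injectives C E"
begin

lemma E_Arr:
  assumes "(f, g) \<in> E"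
  shows "f \<in> Arr C" "g \<in> Arr C" "Cod C f = Dom C g" "g \<cdot> f = Null C (Dom C f) (Cod C g)"
  using E_short_exact[OF assms] kernel_Arr[of f g] by (auto simp: short_exact_def)

lemma E_kernel: "(f, g) \<in> E \<Longrightarrow> is_kernel C f g"
  and E_cokernel: "(f, g) \<in> E \<Longrightarrow> is_cokernel C g f"
  using E_short_exact by (auto simp: short_exact_def)

lemma extend:
  assumes "(f, g) \<in> E" "a \<in> Arr C" "Dom C a = Dom C f" "Cod C a \<in> \<P>"
  obtains e where "e \<in> Arr C" "Dom C e = Dom C g" "Cod C e = Cod C a" "e \<cdot> f = a"
proof -
  have "\<exists>k \<in> Hom C (Cod C f) (Cod C a). k \<cdot> f = a"
    using assms injectives_iff[of E "Cod C a", OF E_short_exact] by (fastforce simp: injectives_eq in_Hom)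
  then obtain k where "k \<in> Arr C" "Dom C k = Cod C f" "Cod C k = Cod C a" "k \<cdot> f = a"
    unfolding in_Hom Bex_def by blast
  thus thesis using that[of k] E_Arr[OF assms(1)] by simp
qed

lemma lift:
  assumes "(f, g) \<in> E" "a \<in> Arr C" "Cod C a = Cod C g" "Dom C a \<in> \<P>"
  obtains e where "e \<in> Arr C" "Dom C e = Dom C a" "Cod C e = Dom C g" "g \<cdot> e = a"
proof -
  have "\<exists>k \<in> Hom C (Dom C a) (Dom C g). g \<cdot> k = a"
    using assms projectives_iff[of E "Dom C a", OF E_short_exact] by (fastforce simp: projectives_eq in_Hom)
  then obtain k where "k \<in> Arr C" "Dom C k = Dom C a" "Cod C k = Dom C g" "g \<cdot> k = a"
    unfolding in_Hom Bex_def by blast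
  thus thesis using that[of k] by simp
qed

lemma injective_rowE:
  assumes "X \<in> Obj C"
  obtains f g where "(f, g) \<in> E" "Dom C f = X" "Dom C g \<in> \<P>"
  using assms enough_inj E_Arr(3) unfolding enough_injectives_def injectives_eq by fastforce

lemma projective_rowE:
  assumes "X \<in> Obj C"
  obtains f g where "(f, g) \<in> E" "Cod C g = X" "Dom C g \<in> \<P>"
  using assms enough_proj unfolding enough_projectives_def projectives_eq by fastforce

lemma nullI:
  assumes "a \<in> Arr C" "b \<in> Arr C" "Cod C a = Dom C b" "Dom C b \<in> \<P>"
  shows "factors_through C \<P> (b \<cdot> a)"
  unfolding factors_through_def
  by (rule bexI[of _ "Dom C b"], rule bexI[of _ a], rule bexI[of _ b]) (use assms in \<open>simp_all add: in_Hom\<close>)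

text \<open>The object of \<open>\<P>\<close> through which \<open>h\<close> factors is injective,
  so the first factor of \<open>h\<close> extends along the inflation; the extension of
  \<open>h\<close> passes through the same object.\<close>

lemma null_extend:
  assumes null: "factors_through C \<P> h" and h: "h \<in> Arr C" and fg: "(f, g) \<in> E" "Dom C f = Dom C h"
  obtains k where "k \<in> Arr C" "Dom C k = Dom C g" "Cod C k = Cod C h" "k \<cdot> f = h" "factors_through C \<P> k"
proof -
  obtain a b where ab: "a \<in> Arr C" "Dom C a = Dom C h" "b \<in> Arr C" "Cod C a = Dom C b" "Dom C b \<in> \<P>"
    "Cod C b = Cod C h" "h = b \<cdot> a"
    using null by (auto simp: factors_through_def in_Hom)
  obtain e where e: "e \<in> Arr C" "Dom C e = Dom C g" "Cod C e = Dom C b" "e \<cdot> f = a"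
    using extend[OF fg(1), of a] ab(1-6) fg by auto
  show thesis
    by (rule that[of "b \<cdot> e"]) (use e ab E_Arr[OF fg(1)] nullI[of e b] in simp_all)
qed

text \<open>Dual argument: the intermediate object is also projective, so the second factor of
  \<open>h\<close> lifts along the deflation.\<close>

lemma null_lift:
  assumes null: "factors_through C \<P> h" and h: "h \<in> Arr C" and fg: "(f, g) \<in> E" "Cod C g = Cod C h"
  obtains k where "k \<in> Arr C" "Dom C k = Dom C h" "Cod C k = Dom C g" "g \<cdot> k = h"
proof -
  obtain a b where ab: "a \<in> Arr C" "Dom C a = Dom C h" "b \<in> Arr C" "Cod C a = Dom C b" "Dom C b \<in> \<P>"
    "Cod C b = Cod C h" "h = b \<cdot> a"
    using null by (auto simp: factors_through_def in_Hom)
  obtain e where e: "e \<in> Arr C" "Dom C e = Dom C b" "Cod C e = Dom C g" "g \<cdot> e = b"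
    using lift[OF fg(1), of b] ab(1-6) fg by auto
  show thesis
    by (rule that[of "e \<cdot> a"])
      (use e ab E_Arr[OF fg(1)] Comp_reassoc[OF e(4), of a] in simp_all)
qed

sublocale additive_quotient C \<P>
proof
  fix X Y assume XY: "X \<in> Obj C" "Y \<in> Obj C"
  obtain f g where f: "(f, g) \<in> E" "Dom C f = X" "Dom C g \<in> \<P>" by (rule injective_rowE[OF XY(1)])
  show "factors_through C \<P> (Null C X Y)"
    using nullI[of f "Null C (Dom C g) Y"] E_Arr[OF f(1)] f XY by simp
next
  fix h k assume hk: "h \<in> Arr C" "k \<in> Arr C" "Dom C h = Dom C k" "Cod C h = Cod C k"
    "factors_through C \<P> h" "factors_through C \<P> k"
  \<comment> \<open>Both summands are extended along one inflation into an object of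
    \<open>\<P>\<close>, so the sum factors through that single object.\<close>
  obtain f g where f: "(f, g) \<in> E" "Dom C f = Dom C k" "Dom C g \<in> \<P>"
    by (rule injective_rowE[of "Dom C k"]) (use hk in auto)
  obtain a where a: "a \<in> Arr C" "Dom C a = Dom C g" "Cod C a = Cod C h" "a \<cdot> f = h"
    by (rule null_extend[OF hk(5,1) f(1)]) (use hk f in auto)
  obtain b where b: "b \<in> Arr C" "Dom C b = Dom C g" "Cod C b = Cod C k" "b \<cdot> f = k"
    by (rule null_extend[OF hk(6,2) f(1)]) (use hk f in auto)
  show "factors_through C \<P> (h \<boxplus> k)"
    using nullI[of f "a \<boxplus> b"] a b E_Arr[OF f(1)] f hk by (simp add: Add_Comp)
qed

section \<open>Maps of exact pairs\<close>

lemma induces_iff: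
  "induces C a (f, g) (f', g') h \<longleftrightarrow> a \<in> Arr C \<and> Dom C a = Dom C f \<and> Cod C a = Dom C f' \<and>
    h \<in> Arr C \<and> Dom C h = Cod C g \<and> Cod C h = Cod C g' \<and>
    (\<exists>e \<in> Arr C. Dom C e = Cod C f \<and> Cod C e = Cod C f' \<and> e \<cdot> f = f' \<cdot> a \<and> h \<cdot> g = g' \<cdot> e)"
  by (auto simp: induces_def in_Hom)

lemma inducesI:
  assumes "a \<in> Arr C" "Dom C a = Dom C f" "Cod C a = Dom C f'" "h \<in> Arr C" "Dom C h = Cod C g"
    "Cod C h = Cod C g'" "e \<in> Arr C" "Dom C e = Cod C f" "Cod C e = Cod C f'" "e \<cdot> f = f' \<cdot> a"
    "h \<cdot> g = g' \<cdot> e"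
  shows "induces C a (f, g) (f', g') h"
  unfolding induces_iff using assms by blast

lemma induces_Arr:
  assumes "induces C a (f, g) (f', g') h"
  shows "a \<in> Arr C" "Dom C a = Dom C f" "Cod C a = Dom C f'" "h \<in> Arr C" "Dom C h = Cod C g" "Cod C h = Cod C g'"
  using assms by (auto simp: induces_iff)

lemma inducesE:
  assumes "induces C a (f, g) (f', g') h"
  obtains e where "e \<in> Arr C" "Dom C e = Cod C f" "Cod C e = Cod C f'" "e \<cdot> f = f' \<cdot> a" "h \<cdot> g = g' \<cdot> e"
  using assms by (auto simp: induces_iff)

lemma induces_Comp:
  assumes "induces C a (f, g) (f', g') h" "induces C a' (f', g') (f'', g'') h'"
    and r: "(f, g) \<in> E" "(f', g') \<in> E" "(f'', g'') \<in> E"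
  shows "induces C (a' \<cdot> a) (f, g) (f'', g'') (h' \<cdot> h)"
proof -
  obtain e where e: "e \<in> Arr C" "Dom C e = Cod C f" "Cod C e = Cod C f'" "e \<cdot> f = f' \<cdot> a" "h \<cdot> g = g' \<cdot> e"
    using assms(1) by (rule inducesE)
  obtain e' where e': "e' \<in> Arr C" "Dom C e' = Cod C f'" "Cod C e' = Cod C f''" "e' \<cdot> f' = f'' \<cdot> a'"
    "h' \<cdot> g' = g'' \<cdot> e'"
    using assms(2) by (rule inducesE)
  note t = induces_Arr[OF assms(1)] induces_Arr[OF assms(2)] E_Arr[OF r(1)] E_Arr[OF r(2)] E_Arr[OF r(3)]
  show ?thesis
    by (rule inducesI[of _ _ _ _ _ _ "e' \<cdot> e"])
      (use t e e' Comp_reassoc[OF e'(4), of a] Comp_reassoc[OF e'(5), of e] in simp_all)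
qed

lemma induces_Add:
  assumes "induces C a (f, g) (f', g') h" "induces C a' (f, g) (f', g') h'"
    and r: "(f, g) \<in> E" "(f', g') \<in> E"
  shows "induces C (a \<boxplus> a') (f, g) (f', g') (h \<boxplus> h')"
proof -
  obtain e where e: "e \<in> Arr C" "Dom C e = Cod C f" "Cod C e = Cod C f'" "e \<cdot> f = f' \<cdot> a" "h \<cdot> g = g' \<cdot> e"
    using assms(1) by (rule inducesE)
  obtain e' where e': "e' \<in> Arr C" "Dom C e' = Cod C f" "Cod C e' = Cod C f'" "e' \<cdot> f = f' \<cdot> a'"
    "h' \<cdot> g = g' \<cdot> e'"
    using assms(2) by (rule inducesE)
  note t = induces_Arr[OF assms(1)] induces_Arr[OF assms(2)] E_Arr[OF r(1)] E_Arr[OF r(2)]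
  show ?thesis
    by (rule inducesI[of _ _ _ _ _ _ "e \<boxplus> e'"])
      (use t e e' in \<open>simp_all add: Add_Comp Comp_Add\<close>)
qed

lemma induces_Neg:
  assumes "induces C a (f, g) (f', g') h"
    and r: "(f, g) \<in> E" "(f', g') \<in> E"
  shows "induces C (Neg C a) (f, g) (f', g') (Neg C h)"
proof -
  obtain e where e: "e \<in> Arr C" "Dom C e = Cod C f" "Cod C e = Cod C f'" "e \<cdot> f = f' \<cdot> a" "h \<cdot> g = g' \<cdot> e"
    using assms(1) by (rule inducesE)
  note t = induces_Arr[OF assms(1)] E_Arr[OF r(1)] E_Arr[OF r(2)]
  show ?thesis
    by (rule inducesI[of _ _ _ _ _ _ "Neg C e"]) (use t e in simp_all)
qed

lemma induces_Ident:
  assumes "(f, g) \<in> E"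
  shows "induces C (Ident C (Dom C f)) (f, g) (f, g) (Ident C (Cod C g))"
  by (rule inducesI[of _ _ _ _ _ _ "Ident C (Dom C g)"]) (use E_Arr[OF assms] in simp_all)

lemma cokernel_map:
  assumes r: "(f, g) \<in> E" "(f', g') \<in> E" and e: "e \<in> Arr C" "Dom C e = Dom C g" "Cod C e = Dom C g'"
    and a: "a \<in> Arr C" "Dom C a = Dom C f" "Cod C a = Dom C f'" and eq: "e \<cdot> f = f' \<cdot> a"
  obtains h where "h \<in> Arr C" "Dom C h = Cod C g" "Cod C h = Cod C g'" "h \<cdot> g = g' \<cdot> e"
    "induces C a (f, g) (f', g') h"
proof -
  note t = E_Arr[OF r(1)] E_Arr[OF r(2)]
  have "(g' \<cdot> e) \<cdot> f = Null C (Dom C f) (Cod C g')"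
    using t e a eq Comp_reassoc[OF t(8), of a] by simp
  then obtain h where h: "h \<in> Arr C" "Dom C h = Cod C g" "Cod C h = Cod C g'" "h \<cdot> g = g' \<cdot> e"
    using cokernel_factor[OF E_cokernel[OF r(1)], of "g' \<cdot> e"] t e by auto
  moreover have "induces C a (f, g) (f', g') h"
    by (rule inducesI[of _ _ _ _ _ _ e]) (use t e a eq h in simp_all)
  ultimately show thesis by (rule that)
qed

lemma kernel_map:
  assumes r: "(f, g) \<in> E" "(f', g') \<in> E" and e: "e \<in> Arr C" "Dom C e = Dom C g" "Cod C e = Dom C g'"
    and h: "h \<in> Arr C" "Dom C h = Cod C g" "Cod C h = Cod C g'" and eq: "h \<cdot> g = g' \<cdot> e"
  obtains a where "a \<in> Arr C" "Dom C a = Dom C f" "Cod C a = Dom C f'" "f' \<cdot> a = e \<cdot> f"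
    "induces C a (f, g) (f', g') h"
proof -
  note t = E_Arr[OF r(1)] E_Arr[OF r(2)]
  have "g' \<cdot> (e \<cdot> f) = h \<cdot> (g \<cdot> f)"
    using t(1-3,5-7) e h Comp_reassoc[OF eq[symmetric], of f] by simp
  hence "g' \<cdot> (e \<cdot> f) = Null C (Dom C f) (Cod C g')" unfolding t(4) using t h by simp
  then obtain a where a: "a \<in> Arr C" "Dom C a = Dom C f" "Cod C a = Dom C f'" "f' \<cdot> a = e \<cdot> f"
    using kernel_factor[OF E_kernel[OF r(2)], of "e \<cdot> f"] t e by auto
  moreover have "induces C a (f, g) (f', g') h"
    by (rule inducesI[of _ _ _ _ _ _ e]) (use t e a eq h in simp_all)
  ultimately show thesis by (rule that)
qed

lemma induces_ex:
  assumes r: "(f, g) \<in> E" "(f', g') \<in> E" and inj: "Dom C g' \<in> \<P>"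
    and a: "a \<in> Arr C" "Dom C a = Dom C f" "Cod C a = Dom C f'"
  obtains h where "induces C a (f, g) (f', g') h"
proof -
  note t = E_Arr[OF r(1)] E_Arr[OF r(2)]
  obtain e where e: "e \<in> Arr C" "Dom C e = Dom C g" "Cod C e = Cod C f'" "e \<cdot> f = f' \<cdot> a"
    by (rule extend[OF r(1), of "f' \<cdot> a"]) (use t a inj in simp_all)
  show thesis
    by (rule cokernel_map[OF r e(1,2) _ a e(4)], use t e in simp, rule that)
qed

lemma induced_by_ex:
  assumes r: "(f, g) \<in> E" "(f', g') \<in> E" and proj: "Dom C g \<in> \<P>"
    and h: "h \<in> Arr C" "Dom C h = Cod C g" "Cod C h = Cod C g'"
  obtains a where "induces C a (f, g) (f', g') h"
proof -
  note t = E_Arr[OF r(1)] E_Arr[OF r(2)]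
  obtain e where e: "e \<in> Arr C" "Dom C e = Dom C g" "Cod C e = Dom C g'" "g' \<cdot> e = h \<cdot> g"
    by (rule lift[OF r(2), of "h \<cdot> g"]) (use t h proj in simp_all)
  show thesis
    by (rule kernel_map[OF r e(1-3) h e(4)[symmetric]], rule that)
qed

text \<open>Extend the null arrow \<open>a\<close> to \<open>k\<close> along \<open>f\<close>. The
  corrected middle arrow \<open>e - f' \<cdot> k\<close> kills \<open>f\<close>, so it is
  \<open>l \<cdot> g\<close>; composing with \<open>g'\<close> and cancelling \<open>g\<close> gives
  \<open>h = g' \<cdot> l\<close>, which passes through the object \<open>Dom C g'\<close> of
  \<open>\<P>\<close>.\<close>

lemma induces_unique_Null:
  assumes r: "(f, g) \<in> E" "(f', g') \<in> E" and inj: "Dom C g' \<in> \<P>"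
    and ind: "induces C a (f, g) (f', g') h" and null: "null a"
  shows "null h"
proof -
  note t = E_Arr[OF r(1)] E_Arr[OF r(2)] induces_Arr[OF ind]
  obtain e where e: "e \<in> Arr C" "Dom C e = Cod C f" "Cod C e = Cod C f'" "e \<cdot> f = f' \<cdot> a" "h \<cdot> g = g' \<cdot> e"
    using ind by (rule inducesE)
  obtain k where k: "k \<in> Arr C" "Dom C k = Dom C g" "Cod C k = Cod C a" "k \<cdot> f = a"
    by (rule null_extend[OF null _ r(1)]) (use t in auto)
  let ?d = "e \<boxplus> Neg C (f' \<cdot> k)"
  have "?d \<cdot> f = Null C (Dom C f) (Cod C ?d)"
    using t e k by (simp add: Add_Comp)
  then obtain l where l: "l \<in> Arr C" "Dom C l = Cod C g" "Cod C l = Dom C g'" "l \<cdot> g = ?d"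
    using cokernel_factor[OF E_cokernel[OF r(1)], of ?d] t e k by auto
  have eq: "h \<cdot> g = (g' \<cdot> l) \<cdot> g"
    using t e k l Comp_reassoc[OF t(8), of k] by (simp add: Comp_Add)
  have "h = g' \<cdot> l"
    by (rule cokernel_cancel[OF E_cokernel[OF r(1)] _ _ _ _ _ eq]) (use t l in simp_all)
  thus ?thesis using nullI[of l g'] t l inj by simp
qed

text \<open>Dually, \<open>h\<close> lifts to \<open>k\<close>, the arrow
  \<open>e - k \<cdot> g\<close> is killed by \<open>g'\<close> and equals
  \<open>f' \<cdot> l\<close>, and cancelling \<open>f'\<close> gives
  \<open>a = l \<cdot> f\<close>, through the object \<open>Dom C g\<close> of
  \<open>\<P>\<close>.\<close>

lemma induced_by_unique_Null:
  assumes r: "(f, g) \<in> E" "(f', g') \<in> E" and proj: "Dom C g \<in> \<P>"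
    and ind: "induces C a (f, g) (f', g') h" and null: "null h"
  shows "null a"
proof -
  note t = E_Arr[OF r(1)] E_Arr[OF r(2)] induces_Arr[OF ind]
  obtain e where e: "e \<in> Arr C" "Dom C e = Cod C f" "Cod C e = Cod C f'" "e \<cdot> f = f' \<cdot> a" "h \<cdot> g = g' \<cdot> e"
    using ind by (rule inducesE)
  obtain k where k: "k \<in> Arr C" "Dom C k = Dom C h" "Cod C k = Dom C g'" "g' \<cdot> k = h"
    by (rule null_lift[OF null _ r(2)]) (use t in auto)
  let ?d = "e \<boxplus> Neg C (k \<cdot> g)"
  have "g' \<cdot> ?d = Null C (Dom C ?d) (Cod C g')"
    using t e k Comp_reassoc[OF k(4), of g] by (simp add: Comp_Add)
  then obtain l where l: "l \<in> Arr C" "Dom C l = Dom C g" "Cod C l = Dom C f'" "f' \<cdot> l = ?d"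
    using kernel_factor[OF E_kernel[OF r(2)], of ?d] t e k by auto
  have eq: "f' \<cdot> a = f' \<cdot> (l \<cdot> f)"
    using t e k l Comp_reassoc[OF l(4), of f] by (simp add: Add_Comp)
  have "a = l \<cdot> f"
    by (rule kernel_cancel[OF E_kernel[OF r(2)] _ _ _ _ _ eq]) (use t l in simp_all)
  thus ?thesis using nullI[of f l] t l proj by simp
qed

lemma induces_unique:
  assumes r: "(f, g) \<in> E" "(f', g') \<in> E" and inj: "Dom C g' \<in> \<P>"
    and ind: "induces C a (f, g) (f', g') h" "induces C a' (f, g) (f', g') h'" and cls: "cls a = cls a'"
  shows "cls h = cls h'"
proof -
  have "null (h \<boxplus> Neg C h')"
    by (rule induces_unique_Null[OF r inj induces_Add[OF ind(1) induces_Neg[OF ind(2) r] r]])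
      (use cls induces_Arr[OF ind(1)] induces_Arr[OF ind(2)] in \<open>simp add: cls_eq_iff\<close>)
  thus ?thesis using induces_Arr[OF ind(1)] induces_Arr[OF ind(2)] by (simp add: cls_eq_iff)
qed

lemma induced_by_unique:
  assumes r: "(f, g) \<in> E" "(f', g') \<in> E" and proj: "Dom C g \<in> \<P>"
    and ind: "induces C a (f, g) (f', g') h" "induces C a' (f, g) (f', g') h'" and cls: "cls h = cls h'"
  shows "cls a = cls a'"
proof -
  have "null (a \<boxplus> Neg C a')"
    by (rule induced_by_unique_Null[OF r proj induces_Add[OF ind(1) induces_Neg[OF ind(2) r] r]])
      (use cls induces_Arr[OF ind(1)] induces_Arr[OF ind(2)] in \<open>simp add: cls_eq_iff\<close>)
  thus ?thesis using induces_Arr[OF ind(1)] induces_Arr[OF ind(2)] by (simp add: cls_eq_iff)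
qed

text \<open>A stable form of Schanuel's lemma: comparison arrows exist in both directions, and each
  composite is induced by the identity of the common left-hand object, just as an identity arrow
  is.\<close>

lemma induces_Ident_is_iso:
  assumes r: "(f, g) \<in> E" "(f', g') \<in> E" and inj: "Dom C g \<in> \<P>" "Dom C g' \<in> \<P>"
    and ind: "induces C (Ident C (Dom C f)) (f, g) (f', g') h"
  shows "is_iso Q (cls h)"
proof -
  note t = E_Arr[OF r(1)] E_Arr[OF r(2)] induces_Arr[OF ind]
  have D: "Dom C f' = Dom C f" using t by simp
  obtain h' where h': "induces C (Ident C (Dom C f)) (f', g') (f, g) h'"
    by (rule induces_ex[OF r(2,1) inj(1), of "Ident C (Dom C f)"]) (use t D in auto)
  note t' = induces_Arr[OF h']
  have "cls (h' \<cdot> h) = cls (Ident C (Cod C g))"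
    by (rule induces_unique[OF r(1,1) inj(1) induces_Comp[OF ind h' r r(1)] induces_Ident[OF r(1)]])
      (use t in simp)
  moreover have "cls (h \<cdot> h') = cls (Ident C (Cod C g'))"
    by (rule induces_unique[OF r(2,2) inj(2) induces_Comp[OF h' ind r(2,1,2)] induces_Ident[OF r(2)]])
      (use t D in simp)
  ultimately show ?thesis
    by (intro Q.is_isoI[of "cls h" "Cod C g" "Cod C g'" "cls h'"]) (use t t' in \<open>simp_all add: in_Hom\<close>)
qed

text \<open>A map of exact pairs that is the identity on the left has a bicartesian right-hand
  square. The resulting exact pair, from \<open>Dom C g\<close> through \<open>Cod C g\<close>
  \<oplus> \<open>Dom C g'\<close> to \<open>Cod C g'\<close>, is what rotates a standard
  triangle.\<close>

lemma bicartesian_from_left: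
  assumes r: "(f, g) \<in> E" "(f', g') \<in> E" and D: "Dom C f = Dom C f'"
    and e: "e \<in> Arr C" "Dom C e = Dom C g" "Cod C e = Dom C g'" "e \<cdot> f = f'"
    and h: "h \<in> Arr C" "Dom C h = Cod C g" "Cod C h = Cod C g'" "h \<cdot> g = g' \<cdot> e"
    and bp: "biproduct (Cod C g) (Dom C g') S i j p q"
  shows "((i \<cdot> g) \<boxplus> (j \<cdot> e), (h \<cdot> p) \<boxplus> Neg C (g' \<cdot> q)) \<in> E" (is "(?m, ?n) \<in> E")
proof (rule deflation_E)
  note S = biproductD(2-13)[OF bp] and pq = biproductD(14-18)[OF bp]
  note t = E_Arr[OF r(1)] E_Arr[OF r(2)]
  note re = pq Comp_reassoc[OF pq(1)] Comp_reassoc[OF pq(2)] Comp_reassoc[OF pq(3)] Comp_reassoc[OF pq(4)]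
  have m: "?m \<in> Arr C" "Dom C ?m = Dom C g" "Cod C ?m = S" using t e S by simp_all
  have n: "?n \<in> Arr C" "Dom C ?n = S" "Cod C ?n = Cod C g'" using t h S by simp_all
  have pm: "p \<cdot> ?m = g" and qm: "q \<cdot> ?m = e" using t e S re by (simp_all add: Comp_Add)
  \<comment> \<open>On the summand \<open>Dom C g'\<close> the arrow \<open>?n\<close> is
    \<open>-g'\<close>; changing the sign of \<open>j\<close> exhibits the deflation
    \<open>g'\<close> as a composite ending in \<open>?n\<close>, so cancellation applies.\<close>
  have "?n \<cdot> Neg C j = g'" using t h S re by (simp add: Add_Comp)
  moreover have "g' \<in> deflations E" using r(2) by (auto simp: deflations_def)
  ultimately show n_defl: "?n \<in> deflations E"
    by (intro deflation_cancel[of ?n "Neg C j"]) (use n S in simp_all)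
  have nm: "?n \<cdot> ?m = Null C (Dom C ?m) (Cod C ?n)"
    using t e h S re by (simp add: Add_Comp Comp_Add)
  have n_epi: "is_epi C ?n" using n_defl E_cokernel cokernel_is_epi by (auto simp: deflations_def)
  have "is_mono C ?m"
  proof (rule is_monoI)
    fix a assume a: "a \<in> Arr C" "Cod C a = Dom C ?m" "?m \<cdot> a = Null C (Dom C a) (Cod C ?m)"
    \<comment> \<open>Both components kill \<open>a\<close>: the first makes it factor as
      \<open>f \<cdot> b\<close>, the second then says that \<open>f' \<cdot> b\<close> is
      zero.\<close>
    have ga: "g \<cdot> a = Null C (Dom C a) (Cod C g)" and ea: "e \<cdot> a = Null C (Dom C a) (Dom C g')"
      using arg_cong[OF a(3), of "\<lambda>x. p \<cdot> x"] arg_cong[OF a(3), of "\<lambda>x. q \<cdot> x"]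
        Comp_reassoc[OF pm, of a] Comp_reassoc[OF qm, of a] a(1,2) m t e S by simp_all
    obtain b where b: "b \<in> Arr C" "Dom C b = Dom C a" "Cod C b = Dom C f" "f \<cdot> b = a"
      by (rule kernel_factor[OF E_kernel[OF r(1)], of a]) (use a m t ga in auto)
    have eq: "f' \<cdot> b = f' \<cdot> Null C (Dom C a) (Dom C f')"
      using Comp_reassoc[OF e(4), of b] b t e a(1) ea D by simp
    have "b = Null C (Dom C a) (Dom C f')"
      by (rule kernel_cancel[OF E_kernel[OF r(2)] _ _ _ _ _ eq]) (use b D t a(1) in simp_all)
    thus "a = Null C (Dom C a) (Dom C ?m)" using b t m a(1) D by auto
  qed (rule m)
  moreover have "is_cokernel C ?n ?m"
  proof (rule is_cokernelI)
    fix w assume w: "w \<in> Arr C" "Dom C w = Cod C ?m" "w \<cdot> ?m = Null C (Dom C ?m) (Cod C w)"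
    note w' = w(1) w(2)[unfolded m]
    \<comment> \<open>Composing with \<open>f\<close> shows that \<open>w \<cdot> j\<close> kills
      \<open>f'\<close>, so it is \<open>d \<cdot> g'\<close>. Comparing after \<open>g\<close>
      gives \<open>w \<cdot> i = -(d \<cdot> h)\<close>, so \<open>-d\<close> is the required
      factor.\<close>
    have wm: "(w \<cdot> (i \<cdot> g)) \<boxplus> (w \<cdot> (j \<cdot> e)) = Null C (Dom C g) (Cod C w)"
      using w(3) w' t e S m by (simp add: Comp_Add)
    have "((w \<cdot> (i \<cdot> g)) \<boxplus> (w \<cdot> (j \<cdot> e))) \<cdot> f = w \<cdot> (j \<cdot> f')"
      using w' t e S D by (simp add: Add_Comp)
    hence "(w \<cdot> j) \<cdot> f' = Null C (Dom C f') (Cod C w)"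
      unfolding wm using w' t S D by simp
    then obtain d where d: "d \<in> Arr C" "Dom C d = Cod C g'" "Cod C d = Cod C w" "d \<cdot> g' = w \<cdot> j"
      using cokernel_factor[OF E_cokernel[OF r(2)], of "w \<cdot> j"] w' t S by auto
    have "w \<cdot> (j \<cdot> e) = d \<cdot> (h \<cdot> g)"
      unfolding h(4) using Comp_reassoc[OF d(4), of e] d(1-3) w' t e S by simp
    hence "Neg C (w \<cdot> (i \<cdot> g)) = d \<cdot> (h \<cdot> g)"
      using Neg_unique[of "w \<cdot> (i \<cdot> g)" "w \<cdot> (j \<cdot> e)"] wm w' t e S d(1-3) h(1-3) by simp
    hence "w \<cdot> (i \<cdot> g) = Neg C (d \<cdot> (h \<cdot> g))"
      using Neg_Neg[of "w \<cdot> (i \<cdot> g)"] w' t S by simp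
    hence eq: "(w \<cdot> i) \<cdot> g = Neg C (d \<cdot> h) \<cdot> g" using w' t S d(1-3) h(1-3) by simp
    have wi: "w \<cdot> i = Neg C (d \<cdot> h)"
      by (rule cokernel_cancel[OF E_cokernel[OF r(1)] _ _ _ _ _ eq]) (use w' t S d h in simp_all)
    have "w = w \<cdot> ((i \<cdot> p) \<boxplus> (j \<cdot> q))" unfolding pq using w' by simp
    also have "\<dots> = Neg C d \<cdot> ?n"
      using w' t S d(1-3) h(1-3) Comp_reassoc[OF wi, of p] Comp_reassoc[OF d(4), of q]
      by (simp add: Comp_Add)
    finally show "\<exists>k \<in> Arr C. Dom C k = Cod C ?n \<and> Cod C k = Cod C w \<and> k \<cdot> ?n = w"
      by (intro bexI[of _ "Neg C d"]) (use d n in simp_all)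
  qed (use m n nm n_epi in simp_all)
  ultimately show "short_exact C ?m ?n" by (rule mono_cokernel_short_exact)
qed

lemma null_via_P: "\<lbrakk>a \<in> Arr C; b \<in> Arr C; Cod C a = X; Dom C b = X; X \<in> \<P>\<rbrakk> \<Longrightarrow> null (b \<cdot> a)"
  using nullI by simp

text \<open>The identity of the biproduct differs from \<open>i \<cdot> p\<close> by
  \<open>j \<cdot> q\<close>, which factors through the summand in \<open>\<P>\<close>.\<close>

lemma biproduct_is_iso:
  assumes "Y \<in> \<P>" and bp: "biproduct X Y S i j p q"
  shows "is_iso Q (cls i)" "is_iso Q (cls p)"
proof -
  note S = biproductD(1-13)[OF bp] and pq = biproductD(14,18)[OF bp]
  have "null (Neg C (j \<cdot> q))" using null_via_P[of q j Y] null_Neg S assms(1) by simp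
  moreover have "(i \<cdot> p) \<boxplus> Neg C (Ident C S) = Neg C (j \<cdot> q)"
    using S by (simp flip: pq(2) add: Neg_Add_distrib Add_cancel)
  ultimately have e: "cls (i \<cdot> p) = cls (Ident C S)"
    by (intro cls_eqI) (use S in auto)
  show "is_iso Q (cls i)"
    by (rule Q.is_isoI[of _ X S "cls p"]) (use S pq e in \<open>simp_all add: in_Hom\<close>)
  show "is_iso Q (cls p)"
    by (rule Q.is_isoI[of _ S X "cls i"]) (use S pq e in \<open>simp_all add: in_Hom\<close>)
qed

end

section \<open>Happel's triangulation\<close>

locale frobenius_choice = frobenius_exact C E \<P>
  for C :: "('o, 'm, 'z) preadditive_data_scheme" (structure) and E :: "('m \<times> 'm) set" and \<P> :: "'o set" +
  fixes c :: "'o \<Rightarrow> 'm \<times> 'm"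
  assumes choice: "injective_choice C E c"
begin

abbreviation "\<iota> X \<equiv> fst (c X)"
abbreviation "\<pi> X \<equiv> snd (c X)"
abbreviation "S \<equiv> shift_functor C \<P> c"
abbreviation "\<Delta> \<equiv> distinguished_triangles C E \<P> c"

section \<open>The shift functor on the quotient\<close>

lemma row:
  assumes "X \<in> Obj C"
  shows "(\<iota> X, \<pi> X) \<in> E" "Dom C (\<iota> X) = X" "Dom C (\<pi> X) \<in> \<P>"
proof -
  show E: "(\<iota> X, \<pi> X) \<in> E" and "Dom C (\<iota> X) = X"
    using choice assms by (auto simp: injective_choice_def)
  have "Cod C (\<iota> X) \<in> \<P>"
    using choice assms by (simp add: injective_choice_def injectives_eq)
  thus "Dom C (\<pi> X) \<in> \<P>" using E_Arr(3)[OF E] by simp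
qed

lemma row_Arr [simp]:
  assumes "X \<in> Obj C"
  shows "\<iota> X \<in> Arr C" "\<pi> X \<in> Arr C" "Dom C (\<iota> X) = X" "Cod C (\<iota> X) = Dom C (\<pi> X)"
  using E_Arr[OF row(1)[OF assms]] row(2)[OF assms] by auto

lemma fobj_shift [simp]: "fobj S X = Cod C (\<pi> X)"
  by (simp add: shift_functor_def)

abbreviation shifts where
  "shifts a h \<equiv> induces C a (\<iota> (Dom C a), \<pi> (Dom C a)) (\<iota> (Cod C a), \<pi> (Cod C a)) h"

text \<open>The double union defining the shift of a class collapses, because by
  \<open>induces_unique\<close> the class of the induced arrow depends neither on the representative
  nor on the extension chosen.\<close>

lemma shift_cls:
  assumes ind: "shifts a h"
  shows "farr S (cls a) = cls h"
proof -
  have a: "a \<in> Arr C" using induces_Arr[OF ind] by simp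
  have eq: "cls h' = cls h" if "a' \<in> cls a" "shifts a' h'" for a' h'
  proof (rule induces_unique)
    note m = cls_memD[OF a that(1)]
    show "induces C a' (\<iota> (Dom C a), \<pi> (Dom C a)) (\<iota> (Cod C a), \<pi> (Cod C a)) h'"
      using that m by simp
    show "cls a' = cls a" by (rule m)
  qed (use row a ind in auto)
  have "(\<Union>a' \<in> cls a. \<Union>h' \<in> {h'. shifts a' h'}. cls h') = cls h"
  proof (intro equalityI subsetI)
    fix x assume "x \<in> (\<Union>a' \<in> cls a. \<Union>h' \<in> {h'. shifts a' h'}. cls h')"
    then obtain a' h' where "a' \<in> cls a" "shifts a' h'" "x \<in> cls h'" by blast
    thus "x \<in> cls h" using eq by simp
  next
    fix x assume "x \<in> cls h"
    thus "x \<in> (\<Union>a' \<in> cls a. \<Union>h' \<in> {h'. shifts a' h'}. cls h')"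
      using ind cls_self[OF a] by (intro UN_I[of a] UN_I[of h]) simp_all
  qed
  thus ?thesis by (simp add: shift_functor_def)
qed

lemma shifts_ex:
  assumes "a \<in> Arr C"
  obtains h where "shifts a h"
  by (rule induces_ex[of "\<iota> (Dom C a)" "\<pi> (Dom C a)" "\<iota> (Cod C a)" "\<pi> (Cod C a)" a])
    (use row[of "Dom C a"] row[of "Cod C a"] assms in simp_all)

lemma shiftsD:
  assumes "shifts a h"
  shows "farr S (cls a) = cls h" "h \<in> Arr C" "Dom C h = Cod C (\<pi> (Dom C a))" "Cod C h = Cod C (\<pi> (Cod C a))"
  using shift_cls[OF assms] induces_Arr[OF assms] by simp_all

lemma shift_functor_functor: "is_functor Q Q S"
  unfolding is_functor_def
proof (intro conjI allI ballI)
  fix X assume "X \<in> Obj Q"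
  hence X: "X \<in> Obj C" by simp
  have "farr S (cls (Ident C X)) = cls (Ident C (Cod C (\<pi> X)))"
    by (rule shift_cls) (use induces_Ident[OF row(1)[OF X]] X in simp)
  thus "farr S (Ident Q X) = Ident Q (fobj S X)" by simp
next
  fix X Y f assume "f \<in> Hom Q X Y"
  then obtain a where a: "a \<in> Arr C" "f = cls a" "Dom C a = X" "Cod C a = Y"
    by (auto simp: in_Hom elim!: quot_ArrE)
  obtain h where h: "shifts a h" by (rule shifts_ex[OF a(1)])
  show "farr S f \<in> Hom Q (fobj S X) (fobj S Y)" using a shiftsD[OF h] by (simp add: in_Hom)
next
  fix X Y Z f g assume "f \<in> Hom Q X Y" "g \<in> Hom Q Y Z"
  then obtain a b where a: "a \<in> Arr C" "f = cls a" "Dom C a = X" "Cod C a = Y"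
    and b: "b \<in> Arr C" "g = cls b" "Dom C b = Y" "Cod C b = Z"
    by (auto simp: in_Hom elim!: quot_ArrE)
  obtain h where h: "shifts a h" by (rule shifts_ex[OF a(1)])
  note h = h shiftsD[OF h]
  obtain k where k: "shifts b k" by (rule shifts_ex[OF b(1)])
  note k = k shiftsD[OF k]
  have O: "X \<in> Obj C" "Y \<in> Obj C" "Z \<in> Obj C" using a b by auto
  have "farr S (cls (b \<cdot> a)) = cls (k \<cdot> h)"
    by (rule shift_cls)
      (use induces_Comp[OF h(1)[unfolded a] k(1)[unfolded b] row(1)[OF O(1)] row(1)[OF O(2)] row(1)[OF O(3)]] a b in simp)
  thus "farr S (g \<bullet> f) = farr S g \<bullet> farr S f" using a b h k by simp
qed (use Q.category_axioms in simp_all)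

lemma shift_functor_additive: "additive_functor Q Q S"
  unfolding additive_functor_def
proof (intro conjI allI ballI shift_functor_functor)
  fix X Y f g assume "f \<in> Hom Q X Y" "g \<in> Hom Q X Y"
  then obtain a b where a: "a \<in> Arr C" "f = cls a" "Dom C a = X" "Cod C a = Y"
    and b: "b \<in> Arr C" "g = cls b" "Dom C b = X" "Cod C b = Y"
    by (auto simp: in_Hom elim!: quot_ArrE)
  obtain h where h: "shifts a h" by (rule shifts_ex[OF a(1)])
  note h = h shiftsD[OF h]
  obtain k where k: "shifts b k" by (rule shifts_ex[OF b(1)])
  note k = k shiftsD[OF k]
  have O: "X \<in> Obj C" "Y \<in> Obj C" using a by auto
  have "farr S (cls (a \<boxplus> b)) = cls (h \<boxplus> k)"
    by (rule shift_cls)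
      (use induces_Add[OF h(1)[unfolded a] k(1)[unfolded b] row(1)[OF O(1)] row(1)[OF O(2)]] a b in simp)
  thus "farr S (f \<boxplus>\<^bsub>Q\<^esub> g) = farr S f \<boxplus>\<^bsub>Q\<^esub> farr S g" using a b h k by simp
qed

section \<open>The shift as an equivalence\<close>

sublocale shift_category Q S
  by unfold_locales (rule shift_functor_functor, rule shift_functor_additive)

text \<open>The middle terms of the chosen rows are projective as well as injective, so the dual
  uniqueness statement recovers the left-hand arrow from the right-hand one.\<close>

lemma shift_faithful:
  assumes "f \<in> Arr Q" "g \<in> Arr Q" "Dom Q f = Dom Q g" "Cod Q f = Cod Q g" "farr S f = farr S g"
  shows "f = g"
proof -
  obtain a where a: "a \<in> Arr C" "f = cls a" by (rule quot_ArrE[OF assms(1)])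
  obtain b where b: "b \<in> Arr C" "g = cls b" by (rule quot_ArrE[OF assms(2)])
  have ab: "Dom C a = Dom C b" "Cod C a = Cod C b" using assms a b by simp_all
  obtain h where h: "shifts a h" by (rule shifts_ex[OF a(1)])
  note h = h shiftsD[OF h]
  obtain k where k: "shifts b k" by (rule shifts_ex[OF b(1)])
  note k = k shiftsD[OF k]
  have "cls a = cls b"
    by (rule induced_by_unique[OF _ _ _ h(1)[unfolded ab] k(1)]) (use row b h k a assms in auto)
  thus ?thesis using a b by simp
qed

text \<open>Projectivity of the middle term of the row of \<open>X\<close> lets an arrow between the
  right-hand ends be pulled back to the left-hand ends.\<close>

lemma shift_full:
  assumes "X \<in> Obj C" "Y \<in> Obj C" "h \<in> Arr Q" "Dom Q h = fobj S X" "Cod Q h = fobj S Y"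
  obtains f where "f \<in> Arr Q" "Dom Q f = X" "Cod Q f = Y" "farr S f = h"
proof -
  obtain k where k: "k \<in> Arr C" "h = cls k" "Dom C k = Cod C (\<pi> X)" "Cod C k = Cod C (\<pi> Y)"
    by (rule quot_repE[OF assms(3), of "Cod C (\<pi> X)" "Cod C (\<pi> Y)"]) (use assms in simp_all)
  obtain a where a: "induces C a (\<iota> X, \<pi> X) (\<iota> Y, \<pi> Y) k"
    by (rule induced_by_ex[OF row(1)[OF assms(1)] row(1)[OF assms(2)] row(3)[OF assms(1)] k(1,3,4)])
  note t = induces_Arr[OF a]
  have "farr S (cls a) = cls k" by (rule shift_cls) (use a t assms in simp)
  thus thesis by (intro that[of "cls a"]) (use t k assms in simp_all)
qed

lemma shift_reflects_iso:
  assumes f: "f \<in> Arr Q" and iso: "is_iso Q (farr S f)"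
  shows "is_iso Q f"
proof -
  obtain h where h: "h \<in> Arr Q" "Dom Q h = fobj S (Cod Q f)" "Cod Q h = fobj S (Dom Q f)"
    "h \<bullet> farr S f = Ident Q (fobj S (Dom Q f))" "farr S f \<bullet> h = Ident Q (fobj S (Cod Q f))"
    using Q.is_isoE[OF iso] farr_Arr[OF f] by metis
  have O: "Dom Q f \<in> Obj C" "Cod Q f \<in> Obj C" using Q.Dom_Obj[OF f] Q.Cod_Obj[OF f] by simp_all
  obtain g where g: "g \<in> Arr Q" "Dom Q g = Cod Q f" "Cod Q g = Dom Q f" "farr S g = h"
    by (rule shift_full[OF O(2,1) h(1-3)])
  have gf: "g \<bullet> f = Ident Q (Dom Q f)"
    by (rule shift_faithful) (use f g h O farr_Ident[of "Dom Q f"] in \<open>simp_all del: fobj_shift quot_Ident\<close>)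
  have fg: "f \<bullet> g = Ident Q (Cod Q f)"
    by (rule shift_faithful) (use f g h O farr_Ident[of "Cod Q f"] in \<open>simp_all del: fobj_shift quot_Ident\<close>)
  show ?thesis by (rule Q.is_isoI[OF _ _ gf fg]) (use f g in \<open>simp_all add: in_Hom\<close>)
qed

text \<open>Essential surjectivity of the shift: the middle term of a projective row ending in
  \<open>Y\<close> is also injective, so that row computes the shift of its kernel up to
  isomorphism.\<close>

lemma desuspension:
  assumes "Y \<in> Obj C"
  obtains \<kappa> \<rho> \<delta> where "(\<kappa>, \<rho>) \<in> E" "Dom C \<rho> \<in> \<P>" "Cod C \<rho> = Y"
    "induces C (Ident C (Dom C \<kappa>)) (\<kappa>, \<rho>) (\<iota> (Dom C \<kappa>), \<pi> (Dom C \<kappa>)) \<delta>" "is_iso Q (cls \<delta>)"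
proof -
  obtain \<kappa> \<rho> where r: "(\<kappa>, \<rho>) \<in> E" "Cod C \<rho> = Y" "Dom C \<rho> \<in> \<P>" by (rule projective_rowE[OF assms])
  have K: "Dom C \<kappa> \<in> Obj C" using E_Arr[OF r(1)] by simp
  obtain \<delta> where d: "induces C (Ident C (Dom C \<kappa>)) (\<kappa>, \<rho>) (\<iota> (Dom C \<kappa>), \<pi> (Dom C \<kappa>)) \<delta>"
    by (rule induces_ex[OF r(1) row(1)[OF K] row(3)[OF K], of "Ident C (Dom C \<kappa>)"]) (use K in simp_all)
  have "is_iso Q (cls \<delta>)" by (rule induces_Ident_is_iso[OF r(1) row(1)[OF K] r(3) row(3)[OF K] d])
  thus thesis by (rule that[OF r(1,3,2) d])
qed

lemma shift_equivalence: "is_equivalence Q Q S"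
proof (rule full_faithful_surj_equivalence)
  show "faithful Q S"
    unfolding faithful_def inj_on_def
  proof (intro ballI impI)
    fix X Y f g assume *: "f \<in> Hom Q X Y" "g \<in> Hom Q X Y" "farr S f = farr S g"
    show "f = g" by (rule shift_faithful) (use * in \<open>simp_all add: in_Hom\<close>)
  qed
next
  fix X Y g assume "X \<in> Obj Q" "Y \<in> Obj Q" "g \<in> Hom Q (fobj S X) (fobj S Y)"
  then obtain f where "f \<in> Arr Q" "Dom Q f = X" "Cod Q f = Y" "farr S f = g"
    using shift_full[of X Y g] by (auto simp: in_Hom)
  thus "\<exists>f \<in> Hom Q X Y. farr S f = g" by (auto simp: in_Hom)
next
  fix Y assume "Y \<in> Obj Q"
  hence "Y \<in> Obj C" by simp
  then obtain \<kappa> \<rho> \<delta> where d: "(\<kappa>, \<rho>) \<in> E" "Cod C \<rho> = Y"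
    "induces C (Ident C (Dom C \<kappa>)) (\<kappa>, \<rho>) (\<iota> (Dom C \<kappa>), \<pi> (Dom C \<kappa>)) \<delta>" "is_iso Q (cls \<delta>)"
    by (rule desuspension)
  note t = induces_Arr[OF d(3)] E_Arr[OF d(1)]
  obtain e where "e \<in> Arr Q" "Dom Q e = Cod C \<delta>" "Cod Q e = Dom C \<delta>" "is_iso Q e"
    using Q.is_isoE[OF d(4)] t cls_Arr[of \<delta>] by metis
  thus "\<exists>X \<in> Obj Q. \<exists>e \<in> Hom Q (fobj S X) Y. is_iso Q e"
    using t d(2) by (intro bexI[of _ "Dom C \<kappa>"] bexI[of _ e]) (simp_all add: in_Hom)
qed

section \<open>Standard triangles and maps between them\<close>

definition std where
  "std f g h \<longleftrightarrow> (f, g) \<in> E \<and> induces C (Ident C (Dom C f)) (f, g) (\<iota> (Dom C f), \<pi> (Dom C f)) h"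

lemma stdD:
  assumes "std f g h"
  shows "(f, g) \<in> E" "f \<in> Arr C" "g \<in> Arr C" "h \<in> Arr C" "Cod C f = Dom C g" "Dom C h = Cod C g"
    "Cod C h = Cod C (\<pi> (Dom C f))" "induces C (Ident C (Dom C f)) (f, g) (\<iota> (Dom C f), \<pi> (Dom C f)) h"
proof -
  have r: "(f, g) \<in> E" and i: "induces C (Ident C (Dom C f)) (f, g) (\<iota> (Dom C f), \<pi> (Dom C f)) h"
    using assms by (simp_all add: std_def)
  show "(f, g) \<in> E" "induces C (Ident C (Dom C f)) (f, g) (\<iota> (Dom C f), \<pi> (Dom C f)) h"
    by (fact r i)+
  show "f \<in> Arr C" "g \<in> Arr C" "h \<in> Arr C" "Cod C f = Dom C g" "Dom C h = Cod C g"
    "Cod C h = Cod C (\<pi> (Dom C f))"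
    using E_Arr[OF r] induces_Arr[OF i] by simp_all
qed

lemma std_ex:
  assumes "(f, g) \<in> E"
  obtains h where "std f g h"
proof -
  have X: "Dom C f \<in> Obj C" using E_Arr[OF assms] by simp
  obtain h where "induces C (Ident C (Dom C f)) (f, g) (\<iota> (Dom C f), \<pi> (Dom C f)) h"
    by (rule induces_ex[OF assms row(1)[OF X] row(3)[OF X], of "Ident C (Dom C f)"]) (use X in simp_all)
  thus thesis using assms that by (simp add: std_def)
qed

lemma std_triangle: "std f g h \<Longrightarrow> is_triangle Q S (cls f, cls g, cls h)"
  using stdD[of f g h] by (simp add: triangle_iff)

lemma standard_triangles_eq:
  "standard_triangles C E \<P> c = {(cls f, cls g, cls h) | f g h. std f g h}"
  by (simp add: standard_triangles_def std_def)

lemma distI: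
  "\<lbrakk>std f g h; triangle_iso Q S (cls f, cls g, cls h) t\<rbrakk> \<Longrightarrow> t \<in> \<Delta>"
  unfolding distinguished_triangles_def standard_triangles_eq by blast

lemma distE:
  assumes "t \<in> \<Delta>"
  obtains f g h where "std f g h" "triangle_iso Q S (cls f, cls g, cls h) t"
  using assms by (auto simp: distinguished_triangles_def standard_triangles_eq)

lemma std_dist: "std f g h \<Longrightarrow> (cls f, cls g, cls h) \<in> \<Delta>"
  by (rule distI[OF _ triangle_iso_refl[OF std_triangle]])

lemma dist_triangle: "t \<in> \<Delta> \<Longrightarrow> is_triangle Q S t"
  by (erule distE) (simp add: triangle_iso_def)

lemma dist_iso_closed:
  assumes "t \<in> \<Delta>" "triangle_iso Q S t t'"
  shows "t' \<in> \<Delta>"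
proof -
  obtain u v w where t: "t = (u, v, w)" by (cases t)
  obtain u' v' w' where t': "t' = (u', v', w')" by (cases t')
  obtain f g h where "std f g h" "triangle_iso Q S (cls f, cls g, cls h) t" by (rule distE[OF assms(1)])
  thus ?thesis using assms(2) triangle_iso_trans unfolding t t' by (blast intro: distI)
qed

text \<open>The given square commutes only modulo \<open>\<P>\<close>. Its defect extends to a null
  arrow \<open>k\<close> along \<open>f\<close>, and replacing \<open>b\<close> by
  \<open>b - k\<close>, which has the same class, makes it commute strictly; the third arrow is then
  induced on cokernels.\<close>

lemma std_fill:
  assumes s: "std f g h" "std f' g' h'"
    and a: "a \<in> Arr C" "Dom C a = Dom C f" "Cod C a = Dom C f'"
    and b: "b \<in> Arr C" "Dom C b = Dom C g" "Cod C b = Dom C g'"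
    and eq: "cls (b \<cdot> f) = cls (f' \<cdot> a)"
  shows "\<exists>x. triangle_map Q S (cls f, cls g, cls h) (cls f', cls g', cls h') (cls a) (cls b) x"
proof -
  note t = stdD[OF s(1)] and t' = stdD[OF s(2)]
  have O: "Dom C f \<in> Obj C" "Dom C f' \<in> Obj C" using t t' by simp_all
  let ?d = "(b \<cdot> f) \<boxplus> Neg C (f' \<cdot> a)"
  have d: "null ?d" "?d \<in> Arr C" "Dom C ?d = Dom C f" "Cod C ?d = Dom C g'"
    using eq t t' a b by (simp_all add: cls_eq_iff)
  obtain k where k: "k \<in> Arr C" "Dom C k = Dom C g" "Cod C k = Dom C g'" "k \<cdot> f = ?d" "null k"
    by (rule null_extend[OF d(1,2) t(1)]) (use d in simp_all)
  let ?b = "b \<boxplus> Neg C k"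
  have b': "?b \<in> Arr C" "Dom C ?b = Dom C g" "Cod C ?b = Dom C g'" using b k by simp_all
  have "?b \<cdot> f = f' \<cdot> a"
    using b k t t' a by (simp add: Add_Comp Neg_Add_distrib Add_cancel)
  then obtain x where x: "x \<in> Arr C" "Dom C x = Cod C g" "Cod C x = Cod C g'" "x \<cdot> g = g' \<cdot> ?b"
    "induces C a (f, g) (f', g') x"
    by (rule cokernel_map[OF t(1) t'(1) b' a])
  have bb: "cls ?b = cls b"
  proof (rule cls_eqI)
    have "?b \<boxplus> Neg C b = Neg C k" using b k by (simp add: Add_ac Add_cancel)
    thus "null (?b \<boxplus> Neg C b)" using null_Neg k by simp
  qed (use b k in simp_all)
  have xg: "cls (x \<cdot> g) = cls g' \<bullet> cls b"
    using x(4) quot_Comp[OF b'(1), of g'] b' t' bb by simp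
  obtain r where r: "shifts a r" by (rule shifts_ex[OF a(1)])
  note r = r shiftsD[OF r]
  \<comment> \<open>Both composites are induced by \<open>a\<close> between the pair
    \<open>(f, g)\<close> and the chosen row of \<open>Dom C f'\<close>.\<close>
  have "cls (r \<cdot> h) = cls (h' \<cdot> x)"
    by (rule induces_unique[OF t(1) row(1)[OF O(2)] row(3)[OF O(2)]
        induces_Comp[OF t(8) r(1)[unfolded a] t(1) row(1)[OF O(1)] row(1)[OF O(2)]]
        induces_Comp[OF x(5) t'(8) t(1) t'(1) row(1)[OF O(2)]]]) (use a O in simp)
  thus ?thesis
    by (intro exI[of _ "cls x"] triangle_mapI) (use t t' a b x xg r eq in simp_all)
qed

text \<open>The arrows are conjugated to the isomorphic standard triangles, filled in there, and the
  resulting map is conjugated back.\<close>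

lemma dist_fill:
  assumes d: "(u, v, w) \<in> \<Delta>" "(u', v', w') \<in> \<Delta>"
    and a: "a \<in> Arr Q" "Dom Q a = Dom Q u" "Cod Q a = Dom Q u'"
    and b: "b \<in> Arr Q" "Dom Q b = Dom Q v" "Cod Q b = Dom Q v'" and eq: "b \<bullet> u = u' \<bullet> a"
  obtains x where "triangle_map Q S (u, v, w) (u', v', w') a b x"
proof -
  obtain f g h where s: "std f g h" "triangle_iso Q S (cls f, cls g, cls h) (u, v, w)" by (rule distE[OF d(1)])
  obtain f' g' h' where s': "std f' g' h'" "triangle_iso Q S (cls f', cls g', cls h') (u', v', w')"
    by (rule distE[OF d(2)])
  note T = dist_triangle[OF d(1)] dist_triangle[OF d(2)] std_triangle[OF s(1)] std_triangle[OF s'(1)]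
  note Tx = T[unfolded triangle_iff]
  obtain p1 p2 p3 q1 q2 q3 where p: "triangle_map Q S (cls f, cls g, cls h) (u, v, w) p1 p2 p3"
    and q: "triangle_map Q S (u, v, w) (cls f, cls g, cls h) q1 q2 q3"
    and pq: "p1 \<bullet> q1 = Ident Q (Dom Q u)" "p2 \<bullet> q2 = Ident Q (Dom Q v)"
    by (rule triangle_iso_mapsE[OF s(2)])
  obtain p1' p2' p3' q1' q2' q3' where p': "triangle_map Q S (cls f', cls g', cls h') (u', v', w') p1' p2' p3'"
    and q': "triangle_map Q S (u', v', w') (cls f', cls g', cls h') q1' q2' q3'"
    and pq': "p1' \<bullet> q1' = Ident Q (Dom Q u')" "p2' \<bullet> q2' = Ident Q (Dom Q v')"
    by (rule triangle_iso_mapsE[OF s'(2)])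
  note pd = triangle_mapD[OF p] and qd = triangle_mapD[OF q] and pd' = triangle_mapD[OF p'] and qd' = triangle_mapD[OF q']
  let ?a = "q1' \<bullet> (a \<bullet> p1)" and ?b = "q2' \<bullet> (b \<bullet> p2)"
  have ta: "?a \<in> Arr Q" "Dom Q ?a = Dom C f" "Cod Q ?a = Dom C f'"
    and tb: "?b \<in> Arr Q" "Dom Q ?b = Dom C g" "Cod Q ?b = Dom C g'"
    using a b pd(1-9) qd'(1-9) stdD[OF s(1)] stdD[OF s'(1)] by simp_all
  obtain a0 where a0: "a0 \<in> Arr C" "?a = cls a0" "Dom C a0 = Dom C f" "Cod C a0 = Dom C f'"
    by (rule quot_repE[OF ta])
  obtain b0 where b0: "b0 \<in> Arr C" "?b = cls b0" "Dom C b0 = Dom C g" "Cod C b0 = Dom C g'"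
    by (rule quot_repE[OF tb])
  have "?b \<bullet> cls f = q2' \<bullet> (b \<bullet> (u \<bullet> p1))"
    using b pd qd' Tx by simp
  also have "\<dots> = q2' \<bullet> (u' \<bullet> (a \<bullet> p1))"
    using a b pd(1-9) Tx Q.Comp_reassoc[OF eq, of p1] by simp
  also have "\<dots> = cls f' \<bullet> ?a"
    using a pd(1-9) qd' Tx Q.Comp_reassoc[OF qd'(10), of "a \<bullet> p1"] by simp
  finally have "cls (b0 \<cdot> f) = cls (f' \<cdot> a0)"
    unfolding a0(2) b0(2) using a0(1,3,4) b0(1,3,4) stdD[OF s(1)] stdD[OF s'(1)] by simp
  then obtain x where x: "triangle_map Q S (cls f, cls g, cls h) (cls f', cls g', cls h') ?a ?b x"
    using std_fill[OF s(1) s'(1) a0(1,3,4) b0(1,3,4)] unfolding a0(2) b0(2) by blast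
  have "triangle_map Q S (u, v, w) (u', v', w') (p1' \<bullet> (?a \<bullet> q1)) (p2' \<bullet> (?b \<bullet> q2)) (p3' \<bullet> (x \<bullet> q3))"
    by (rule triangle_map_Comp[OF T(1,4,2) triangle_map_Comp[OF T(1,3,4) q x] p'])
  moreover have "p1' \<bullet> (?a \<bullet> q1) = a"
    using a pd(1-9) qd(1-9) pd'(1-9) qd'(1-9) pq(1) Q.Comp_reassoc[OF pq'(1)] by simp
  moreover have "p2' \<bullet> (?b \<bullet> q2) = b"
    using b pd(1-9) qd(1-9) pd'(1-9) qd'(1-9) pq(2) Q.Comp_reassoc[OF pq'(2)] by simp
  ultimately show thesis using that by simp
qed

section \<open>Cones, identity triangles and forward rotation\<close>

lemma farr_cls_Ident [simp]: "X \<in> Obj C \<Longrightarrow> farr S (cls (Ident C X)) = cls (Ident C (Cod C (\<pi> X)))"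
  using farr_Ident[of X] by simp

lemma row_inflation: "X \<in> Obj C \<Longrightarrow> \<iota> X \<in> inflations E"
  unfolding inflations_def using row(1) by blast

lemma std_extE:
  assumes "std f g h"
  obtains e where "e \<in> Arr C" "Dom C e = Dom C g" "Cod C e = Dom C (\<pi> (Dom C f))"
    "e \<cdot> f = \<iota> (Dom C f)" "h \<cdot> g = \<pi> (Dom C f) \<cdot> e"
proof -
  note t = stdD[OF assms]
  obtain e where "e \<in> Arr C" "Dom C e = Cod C f" "Cod C e = Cod C (\<iota> (Dom C f))"
    "e \<cdot> f = \<iota> (Dom C f) \<cdot> Ident C (Dom C f)" "h \<cdot> g = \<pi> (Dom C f) \<cdot> e"
    by (rule inducesE[OF t(8)])
  thus thesis using that[of e] t by simp
qed

lemma stdI: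
  assumes "(f, g) \<in> E" "h \<in> Arr C" "Dom C h = Cod C g" "Cod C h = Cod C (\<pi> (Dom C f))"
    "e \<in> Arr C" "Dom C e = Dom C g" "Cod C e = Dom C (\<pi> (Dom C f))" "e \<cdot> f = \<iota> (Dom C f)"
    "h \<cdot> g = \<pi> (Dom C f) \<cdot> e"
  shows "std f g h"
  unfolding std_def
  by (intro conjI assms(1) inducesI[of _ _ _ _ _ _ e]) (use assms E_Arr[OF assms(1)] in simp_all)

text \<open>Up to an isomorphism \<open>b\<close> of the codomain every arrow of the quotient is the
  class of an inflation: add the component \<open>\<iota>\<close> to a representative. The
  projection to that component gives back \<open>\<iota>\<close>, so cancellation applies, and the
  inclusion of the old codomain is invertible in the quotient.\<close>

lemma std_cone:
  assumes u: "u \<in> Arr Q"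
  obtains f g h b where "std f g h" "Dom C f = Dom Q u" "b \<in> Arr Q" "Dom Q b = Cod Q u"
    "Cod Q b = Dom C g" "is_iso Q b" "b \<bullet> u = cls f"
proof -
  obtain a where a: "a \<in> Arr C" "u = cls a" "Dom C a = Dom Q u" "Cod C a = Cod Q u"
    by (rule quot_repE[OF u refl refl])
  let ?X = "Dom C a"
  have X: "?X \<in> Obj C" and I: "Dom C (\<pi> ?X) \<in> Obj C" using a by simp_all
  obtain T i j p q where bp: "biproduct (Cod C a) (Dom C (\<pi> ?X)) T i j p q"
    by (rule biproductE[OF Cod_Obj[OF a(1)] I])
  note S = biproductD(1-13)[OF bp] and pq = biproductD(14-18)[OF bp]
  let ?f = "(i \<cdot> a) \<boxplus> (j \<cdot> \<iota> ?X)"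
  have f: "?f \<in> Arr C" "Dom C ?f = ?X" "Cod C ?f = T" using a(1) S X by simp_all
  have "q \<cdot> ?f = \<iota> ?X"
    using a(1) S X Comp_reassoc[OF pq(4), of a] Comp_reassoc[OF pq(2), of "\<iota> ?X"] by (simp add: Comp_Add)
  moreover have "\<iota> ?X \<in> inflations E" by (rule row_inflation[OF X])
  ultimately have "?f \<in> inflations E"
    by (intro inflation_cancel[of q ?f]) (use f S in simp_all)
  then obtain g where E: "(?f, g) \<in> E" by (auto simp: inflations_def)
  obtain h where h: "std ?f g h" by (rule std_ex[OF E])
  have iso: "is_iso Q (cls i)"
    by (rule biproduct_is_iso(1)[OF row(3)[OF X] bp])
  have "?f \<boxplus> Neg C (i \<cdot> a) = j \<cdot> \<iota> ?X" using a(1) S X by (simp add: Add_ac Add_cancel)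
  hence "null (?f \<boxplus> Neg C (i \<cdot> a))"
    using null_via_P[of "\<iota> ?X" j "Dom C (\<pi> ?X)"] S X row(3)[OF X] by simp
  hence "cls ?f = cls (i \<cdot> a)" using a(1) S f by (intro cls_eqI) simp_all
  thus thesis
    by (intro that[OF h _ _ _ _ iso]) (use a(1) S f E_Arr(3)[OF E] in \<open>simp_all add: a(2)\<close>)
qed

lemma dist_cone:
  assumes u: "u \<in> Arr Q"
  shows "\<exists>v w. (u, v, w) \<in> \<Delta>"
proof -
  obtain f g h b where s: "std f g h" "Dom C f = Dom Q u" and b: "b \<in> Arr Q" "Dom Q b = Cod Q u"
    "Cod Q b = Dom C g" "is_iso Q b" "b \<bullet> u = cls f" by (rule std_cone[OF u])
  note t = stdD[OF s(1)]
  obtain b' where b': "b' \<in> Arr Q" "Dom Q b' = Cod Q b" "Cod Q b' = Dom Q b"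
    "b' \<bullet> b = Ident Q (Dom Q b)" "b \<bullet> b' = Ident Q (Cod Q b)" "is_iso Q b'"
    using Q.is_isoE[OF b(4)] by metis
  have X: "Dom C f \<in> Obj C" "Cod C g \<in> Obj C" using t by simp_all
  have "b' \<bullet> cls f = u"
    unfolding b(5)[symmetric] using u b(1-3) b' Q.Comp_reassoc[OF b'(4), of u] by simp
  hence "triangle_iso Q S (cls f, cls g, cls h) (u, cls g \<bullet> b, cls h)"
    by (intro triangle_isoI[of _ _ _ _ _ _ "cls (Ident C (Dom C f))" b' "cls (Ident C (Cod C g))"])
      (use u b(1-4) b' t s X in \<open>simp_all add: triangle_iff cls_is_iso\<close>)
  thus ?thesis using distI[OF s(1)] by blast
qed

text \<open>\<open>Z\<close> is a zero object only in the quotient and may be any object of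
  \<open>\<P>\<close>. The standard triangle on the identity ends in an object \<open>?W\<close>
  that vanishes already in \<open>C\<close>, and the zero arrow between the two is invertible in the
  quotient.\<close>

lemma dist_Ident:
  assumes X: "X \<in> Obj C" and Z: "zero_object Q Z"
  shows "(Ident Q X, Null Q X Z, Null Q Z (fobj S X)) \<in> \<Delta>"
proof -
  have ZO: "Z \<in> Obj C" using Z by (simp add: zero_object_def)
  have "\<iota> X \<in> inflations E" by (rule row_inflation[OF X])
  hence "Ident C X \<in> inflations E"
    by (intro inflation_cancel[of "\<iota> X" "Ident C X"]) (use X in simp_all)
  then obtain g where E: "(Ident C X, g) \<in> E" by (auto simp: inflations_def)
  obtain h where s: "std (Ident C X) g h" by (rule std_ex[OF E])
  note t = stdD[OF s]
  let ?W = "Cod C g"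
  have D: "Dom C g = X" using t X by simp
  have W: "?W \<in> Obj C" using t by simp
  have g0: "g = Null C X ?W" using E_Arr[OF E] X D by simp
  \<comment> \<open>The cokernel \<open>g\<close> of an identity is zero; being epi, it forces the
    identity of \<open>?W\<close> to be zero.\<close>
  have eq: "Ident C ?W \<cdot> g = Null C ?W ?W \<cdot> g" using t W g0 D by (metis Ident_Comp' Null_Comp)
  have W0: "Ident C ?W = Null C ?W ?W"
    by (rule cokernel_cancel[OF E_cokernel[OF E] _ _ _ _ _ eq]) (use W in simp_all)
  have "\<exists>!f. f \<in> Hom Q Z Z" using Z ZO unfolding zero_object_def by simp
  moreover have "cls (Ident C Z) \<in> Hom Q Z Z" "cls (Null C Z Z) \<in> Hom Q Z Z" using ZO by (simp_all add: in_Hom)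
  ultimately have Z0: "cls (Ident C Z) = cls (Null C Z Z)" by blast
  let ?k = "cls (Null C ?W Z)"
  have iso: "is_iso Q ?k"
    by (rule Q.is_isoI[of _ ?W Z "cls (Null C Z ?W)"]) (use W ZO W0 Z0 in \<open>simp_all add: in_Hom\<close>)
  have h0: "h = Null C ?W (Cod C h)" using t W W0 Comp_Ident'[of h ?W] Comp_Null[of h ?W ?W] by simp
  have "triangle_iso Q S (cls (Ident C X), cls g, cls h) (Ident Q X, Null Q X Z, Null Q Z (fobj S X))"
  proof (rule triangle_isoI[of _ _ _ _ _ _ "cls (Ident C X)" "cls (Ident C X)" ?k])
    show "farr S (cls (Ident C X)) \<bullet> cls h = Null Q Z (fobj S X) \<bullet> ?k"
      using t(4,6,7) X W ZO h0 by simp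
    show "?k \<bullet> cls g = Null Q X Z \<bullet> cls (Ident C X)"
      using t(3) X W ZO D by simp
  qed (use t X W ZO D iso in \<open>simp_all add: triangle_iff cls_is_iso\<close>)
  thus ?thesis by (rule distI[OF s])
qed

text \<open>Extending \<open>\<iota>\<close> along \<open>f\<close> maps \<open>(f, g)\<close> to
  the chosen row of \<open>?X\<close>, and the bicartesian square of this map gives an exact pair
  \<open>(?m, ?n)\<close>. Modulo the summand in \<open>\<P>\<close> its arrows are \<open>g\<close>
  and \<open>h\<close>; the work lies in showing that its third arrow is minus the shift of
  \<open>f\<close>.\<close>

lemma std_rotate:
  assumes s: "std f g h"
  shows "(cls g, cls h, Neg Q (farr S (cls f))) \<in> \<Delta>"
proof -
  note t = stdD[OF s]
  let ?X = "Dom C f" and ?Y = "Dom C g" and ?Z = "Cod C g"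
  have X: "?X \<in> Obj C" and Y: "?Y \<in> Obj C" and Z: "?Z \<in> Obj C" and I: "Dom C (\<pi> ?X) \<in> Obj C"
    using t by simp_all
  obtain e where e: "e \<in> Arr C" "Dom C e = ?Y" "Cod C e = Dom C (\<pi> ?X)" "e \<cdot> f = \<iota> ?X" "h \<cdot> g = \<pi> ?X \<cdot> e"
    by (rule std_extE[OF s])
  obtain r where r: "shifts f r" by (rule shifts_ex[OF t(2)])
  note r = r shiftsD[OF r]
  \<comment> \<open>The middle arrow of the map of chosen rows that computes the shift
    \<open>r\<close> of \<open>f\<close>.\<close>
  obtain k where k: "k \<in> Arr C" "Dom C k = Cod C (\<iota> ?X)" "Cod C k = Cod C (\<iota> (Cod C f))"
    "k \<cdot> \<iota> ?X = \<iota> (Cod C f) \<cdot> f" "r \<cdot> \<pi> ?X = \<pi> (Cod C f) \<cdot> k"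
    by (rule inducesE[OF r(1)])
  note r = r[unfolded t(5)] and k = k[unfolded t(5)]
  obtain T i j p q where bp: "biproduct ?Z (Dom C (\<pi> ?X)) T i j p q"
    by (rule biproductE[OF Z I])
  note S = biproductD(1-13)[OF bp] and pq = biproductD(14-18)[OF bp]
  note re = pq Comp_reassoc[OF pq(1)] Comp_reassoc[OF pq(2)] Comp_reassoc[OF pq(3)] Comp_reassoc[OF pq(4)]
  let ?m = "(i \<cdot> g) \<boxplus> (j \<cdot> e)" and ?n = "(h \<cdot> p) \<boxplus> Neg C (\<pi> ?X \<cdot> q)"
  have mn: "(?m, ?n) \<in> E"
    by (rule bicartesian_from_left[OF t(1) row(1)[OF X] row(2)[OF X, symmetric] e(1-4) t(4,6,7) e(5) bp])
  have m: "?m \<in> Arr C" "Dom C ?m = ?Y" "Cod C ?m = T" and n: "?n \<in> Arr C" "Dom C ?n = T" "Cod C ?n = Cod C (\<pi> ?X)"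
    using t e(1-3) S X by simp_all
  \<comment> \<open>\<open>\<iota> ?Y\<close> and \<open>k \<cdot> e\<close> agree after
    \<open>f\<close>, so their difference descends along \<open>g\<close> to an arrow
    \<open>l\<close>.\<close>
  let ?d = "\<iota> ?Y \<boxplus> Neg C (k \<cdot> e)"
  have d: "?d \<in> Arr C" "Dom C ?d = ?Y" "Cod C ?d = Dom C (\<pi> ?Y)" using e(1-3) k(1-3) X Y by simp_all
  have df: "?d \<cdot> f = Null C (Dom C f) (Cod C ?d)"
    using t e k X Y by (simp add: Add_Comp)
  obtain l where l: "l \<in> Arr C" "Dom C l = ?Z" "Cod C l = Dom C (\<pi> ?Y)" "l \<cdot> g = ?d"
    by (rule cokernel_factor[OF E_cokernel[OF t(1)] d(1) _ df]) (use d t in simp_all)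
  \<comment> \<open>This extends \<open>\<iota> ?Y\<close> along \<open>?m\<close>, since
    \<open>l \<cdot> g + k \<cdot> e\<close> is \<open>\<iota> ?Y\<close> by the choice of
    \<open>l\<close>.\<close>
  let ?e = "(l \<cdot> p) \<boxplus> (k \<cdot> q)"
  have em: "?e \<cdot> ?m = \<iota> ?Y"
  proof -
    have "?e \<cdot> ?m = (l \<cdot> g) \<boxplus> (k \<cdot> e)"
      using l(1-3) k(1-3) e(1-3) S t X Y re by (simp add: Comp_Add Add_Comp)
    thus ?thesis unfolding l(4) using k(1-3) e(1-3) X Y by (simp add: Add_assoc)
  qed
  have "(\<pi> ?Y \<cdot> l) \<cdot> g = \<pi> ?Y \<cdot> ?d" using l t Y by simp
  \<comment> \<open>The sign of the rotated triangle originates here: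
    \<open>\<pi> ?Y \<cdot> \<iota> ?Y\<close> vanishes and only the negative term is left.\<close>
  also have "\<dots> = Neg C (r \<cdot> (\<pi> ?X \<cdot> e))"
    using E_Arr(4)[OF row(1)[OF Y]] Comp_reassoc[OF k(5), of e] k(1-3) e(1-3) r(3-5) X Y by (simp add: Comp_Add)
  also have "\<dots> = Neg C (r \<cdot> h) \<cdot> g" unfolding e(5)[symmetric] using r(3-5) t X Y by simp
  finally have eq: "(\<pi> ?Y \<cdot> l) \<cdot> g = Neg C (r \<cdot> h) \<cdot> g" .
  have pl: "\<pi> ?Y \<cdot> l = Neg C (r \<cdot> h)"
    by (rule cokernel_cancel[OF E_cokernel[OF t(1)] _ _ _ _ _ eq]) (use l r(3-5) t X Y in simp_all)
  have "Neg C r \<cdot> ?n = \<pi> ?Y \<cdot> ?e"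
    using Comp_reassoc[OF pl, of p] Comp_reassoc[OF k(5), of q] r(3-5) l(1-3) k(1-3) t S X Y
    by (simp add: Comp_Add Neg_Add_distrib)
  hence sm: "std ?m ?n (Neg C r)"
    by (intro stdI[OF mn, of _ ?e]) (use r(3-5) n m em l(1-3) k(1-3) S t X Y in simp_all)
  have hp: "cls ?n = cls (h \<cdot> p)"
  proof (rule cls_eqI)
    have "?n \<boxplus> Neg C (h \<cdot> p) = Neg C (\<pi> ?X \<cdot> q)" using t S X by (simp add: Add_ac Add_cancel)
    moreover have "null (Neg C (\<pi> ?X \<cdot> q))"
      using null_Neg[of "\<pi> ?X \<cdot> q"] null_via_P[of q "\<pi> ?X" "Dom C (\<pi> ?X)"] S X row(3)[OF X] by simp
    ultimately show "null (?n \<boxplus> Neg C (h \<cdot> p))" by simp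
  qed (use n t S in simp_all)
  have pm: "p \<cdot> ?m = g" using t e(1-3) S X re by (simp add: Comp_Add)
  have iso: "is_iso Q (cls p)" by (rule biproduct_is_iso(2)[OF row(3)[OF X] bp])
  have "triangle_iso Q S (cls ?m, cls ?n, cls (Neg C r)) (cls g, cls h, Neg Q (farr S (cls f)))"
  proof (rule triangle_isoI[of _ _ _ _ _ _ "cls (Ident C ?Y)" "cls p" "cls (Ident C (Cod C (\<pi> ?X)))"])
    show "is_triangle Q S (cls ?m, cls ?n, cls (Neg C r))" by (rule std_triangle[OF sm])
    show "cls p \<bullet> cls ?m = cls g \<bullet> cls (Ident C ?Y)"
      using pm m S t Y quot_Comp[of ?m p] by (simp del: quot_Add)
    show "cls (Ident C (Cod C (\<pi> ?X))) \<bullet> cls ?n = cls h \<bullet> cls p"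
      unfolding hp using n S t X by simp
  qed (use m n r t S X Y iso in \<open>simp_all add: triangle_iff cls_is_iso\<close>)
  thus ?thesis by (rule distI[OF sm])
qed

lemma dist_rotate:
  assumes d: "(u, v, w) \<in> \<Delta>"
  shows "(v, w, Neg Q (farr S u)) \<in> \<Delta>"
proof -
  obtain f g h where s: "std f g h" "triangle_iso Q S (cls f, cls g, cls h) (u, v, w)" by (rule distE[OF d])
  show ?thesis by (rule dist_iso_closed[OF std_rotate[OF s(1)] triangle_iso_rotate[OF s(2)]])
qed

text \<open>The pair \<open>0 \<rightarrow> W \<rightarrow> W\<close> is exact, and an arrow \<open>y : Z \<rightarrow> W\<close> with \<open>y v = 0\<close> maps the rotated
  triangle to the one given by this pair.\<close>

lemma dist_weak_cokernel:
  assumes d: "(u, v, w) \<in> \<Delta>" and y: "y \<in> Arr Q" "Dom Q y = Cod Q v"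
    and null: "y \<bullet> v = Null Q (Dom Q v) (Cod Q y)"
  shows "\<exists>d \<in> Arr Q. Dom Q d = Cod Q w \<and> Cod Q d = Cod Q y \<and> d \<bullet> w = y"
proof -
  let ?W = "Cod Q y"
  note T = dist_triangle[OF d, unfolded triangle_iff]
  have W: "?W \<in> Obj C" using y by simp
  obtain \<kappa> \<rho> where K: "(\<kappa>, \<rho>) \<in> E" "Cod C \<rho> = ?W" by (rule projective_rowE[OF W])
  \<comment> \<open>Any deflation onto \<open>?W\<close> factors through the identity of
    \<open>?W\<close>, which is therefore a deflation by cancellation.\<close>
  have "\<rho> \<in> deflations E" using K(1) by (auto simp: deflations_def)
  hence "Ident C ?W \<in> deflations E"
    by (intro deflation_cancel[of "Ident C ?W" \<rho>]) (use E_Arr[OF K(1)] K(2) W in simp_all)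
  then obtain k where k: "(k, Ident C ?W) \<in> E" by (auto simp: deflations_def)
  note t = E_Arr[OF k]
  have k0: "k = Null C (Dom C k) ?W" and Dk: "Dom C k \<in> Obj C" using t W by simp_all
  have ck: "cls k = cls (Null C (Dom C k) ?W)" using k0 by simp
  obtain h where s: "std k (Ident C ?W) h" by (rule std_ex[OF k])
  have D: "(cls k, cls (Ident C ?W), cls h) \<in> \<Delta>"
    by (rule std_dist[OF s])
  let ?a = "cls (Null C (Dom Q v) (Dom C k))"
  have eq: "y \<bullet> v = cls k \<bullet> ?a"
    unfolding ck null using T W Dk by simp
  \<comment> \<open>As the second arrow of the target triangle is an identity, commutation of the
    middle square reads \<open>x \<bullet> w = y\<close>.\<close>
  obtain x where x: "triangle_map Q S (v, w, Neg Q (farr S u)) (cls k, cls (Ident C ?W), cls h) ?a y x"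
    by (rule dist_fill[OF dist_rotate[OF d] D _ _ _ _ _ _ eq]) (use y T t(1,3) W Dk in simp_all)
  note xd = triangle_mapD[OF x]
  have "x \<bullet> w = y" using xd(11) y by simp
  thus ?thesis using xd(3,6,9) T stdD[OF s] W farr_Arr[of u] by (intro bexI[of _ x]) simp_all
qed

text \<open>An endomorphism of a triangle which is the identity on the first two objects differs from the
  identity on the third by a map of square zero, so it is invertible.\<close>

lemma dist_map_iso:
  assumes d: "(u, v, w) \<in> \<Delta>" "(u', v', w') \<in> \<Delta>" and m: "triangle_map Q S (u, v, w) (u', v', w') a b x"
    and iso: "is_iso Q a" "is_iso Q b"
  shows "is_iso Q x"
proof -
  note T = dist_triangle[OF d(1)] dist_triangle[OF d(2)]
  note Tx = T[unfolded triangle_iff] and md = triangle_mapD[OF m]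
  have endo: "is_iso Q y" if d: "(u, v, w) \<in> \<Delta>"
    and y: "triangle_map Q S (u, v, w) (u, v, w) (Ident Q (Dom Q u)) (Ident Q (Dom Q v)) y" for u v w y
  proof -
    note X = dist_triangle[OF d, unfolded triangle_iff] and yd = triangle_mapD[OF y]
    have "farr S (Ident Q (Dom Q u)) = Ident Q (fobj S (Dom Q u))"
      by (rule farr_Ident) (use X Q.Dom_Obj[of u] in simp)
    hence wy: "w \<bullet> y = w"
      using yd(12) Q.Ident_Comp'[of w "fobj S (Dom Q u)"] X by (simp del: quot_Ident fobj_shift)
    show ?thesis
    proof (rule Q.is_iso_square_zero[of y "Dom Q w" v w])
      fix z assume "z \<in> Arr Q" "Dom Q z = Dom Q w" "z \<bullet> v = Null Q (Dom Q v) (Cod Q z)"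
      thus "\<exists>d \<in> Arr Q. Dom Q d = Cod Q w \<and> Cod Q d = Cod Q z \<and> d \<bullet> w = z"
        using X by (intro dist_weak_cokernel[OF d]) simp_all
    qed (use yd(1-9) yd(11) X wy in simp_all)
  qed
  obtain a' where a: "a' \<in> Arr Q" "Dom Q a' = Cod Q a" "Cod Q a' = Dom Q a"
    "a' \<bullet> a = Ident Q (Dom Q a)" "a \<bullet> a' = Ident Q (Cod Q a)"
    using Q.is_isoE[OF iso(1)] by metis
  obtain b' where b: "b' \<in> Arr Q" "Dom Q b' = Cod Q b" "Cod Q b' = Dom Q b"
    "b' \<bullet> b = Ident Q (Dom Q b)" "b \<bullet> b' = Ident Q (Cod Q b)"
    using Q.is_isoE[OF iso(2)] by metis
  have "b' \<bullet> u' = u \<bullet> a'"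
    by (rule Q.square_inverse[where a = a and b = b]) (use Tx md a b in simp_all)
  \<comment> \<open>The inverses of \<open>a\<close> and \<open>b\<close> are filled in by some
    \<open>x'\<close>. It need not be inverse to \<open>x\<close>, but both composites with
    \<open>x\<close> belong to endomorphisms that are identities on the first two objects, hence are
    invertible.\<close>
  then obtain x' where m': "triangle_map Q S (u', v', w') (u, v, w) a' b' x'"
    by (rule dist_fill[OF d(2,1), rotated 6]) (use a b md in simp_all)
  have "is_iso Q (x' \<bullet> x)"
    using endo[OF d(1)] triangle_map_Comp[OF T(1,2,1) m m'] a b md by simp
  moreover have "is_iso Q (x \<bullet> x')"
    using endo[OF d(2)] triangle_map_Comp[OF T(2,1,2) m' m] a b md by simp
  ultimately show ?thesis
    using Q.is_iso_two_sided[of x x' x'] md triangle_mapD[OF m'] by simp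
qed

text \<open>After three rotations both \<open>(u, v, w)\<close> and a cone of \<open>u\<close> become triangles on \<open>-S u\<close>, which are
  isomorphic, and \<open>S\<close> is fully faithful.\<close>

lemma dist_rotate_back:
  assumes T: "is_triangle Q S (u, v, w)" and d: "(v, w, Neg Q (farr S u)) \<in> \<Delta>"
  shows "(u, v, w) \<in> \<Delta>"
proof -
  note Tx = T[unfolded triangle_iff fobj_shift]
  have u: "u \<in> Arr Q" and v: "v \<in> Arr Q" and w: "w \<in> Arr Q" using Tx by simp_all
  obtain v' w' where d': "(u, v', w') \<in> \<Delta>" using dist_cone[OF u] by blast
  note T' = dist_triangle[OF d'] and Tx' = dist_triangle[OF d', unfolded triangle_iff fobj_shift]
  have v': "v' \<in> Arr Q" and w': "w' \<in> Arr Q" using Tx' by simp_all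
  \<comment> \<open>The triangle \<open>d\<close> is already rotated once, so two further rotations
    bring it level with the threefold rotation of \<open>d'\<close>; both then start with
    \<open>Neg Q (farr S u)\<close>.\<close>
  note r = dist_rotate[OF dist_rotate[OF d]] and r' = dist_rotate[OF dist_rotate[OF dist_rotate[OF d']]]
  note S = farr_Arr[OF u] farr_Arr[OF v] farr_Arr[OF w] farr_Arr[OF v'] farr_Arr[OF w']
  have O: "Dom Q u \<in> Obj C" "Dom Q v \<in> Obj C" "Cod Q v \<in> Obj C" "Cod Q v' \<in> Obj C"
    "Cod C (\<pi> (Dom Q u)) \<in> Obj C" "Cod C (\<pi> (Dom Q v)) \<in> Obj C"
    using u v v' by simp_all
  let ?a = "cls (Ident C (Cod C (\<pi> (Dom Q u))))" and ?b = "cls (Ident C (Cod C (\<pi> (Dom Q v))))"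
  obtain x where x: "triangle_map Q S (Neg Q (farr S u), Neg Q (farr S v), Neg Q (farr S w))
      (Neg Q (farr S u), Neg Q (farr S v'), Neg Q (farr S w')) ?a ?b x"
    by (rule dist_fill[OF r r', of ?a ?b]) (use S Tx Tx' O in simp_all)
  note xd = triangle_mapD[OF x]
  have x_iso: "is_iso Q x"
    by (rule dist_map_iso[OF r r' x]) (use O in \<open>simp_all add: cls_is_iso\<close>)
  \<comment> \<open>By fullness the comparison of the shifted third objects is a shift; the squares
    for \<open>y\<close> follow by faithfulness once the signs are removed.\<close>
  obtain y where y: "y \<in> Arr Q" "Dom Q y = Cod Q v" "Cod Q y = Cod Q v'" "farr S y = x"
    by (rule shift_full[OF O(3,4), of x]) (use xd(3,6,9) S Tx Tx' in simp_all)
  have y_iso: "is_iso Q y" by (rule shift_reflects_iso) (use y x_iso in simp_all)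
  have "Neg Q (x \<bullet> farr S v) = Neg Q (farr S v')"
    using xd(11) xd(3,6,9) S Tx Tx' by simp
  hence "Neg Q (Neg Q (x \<bullet> farr S v)) = Neg Q (Neg Q (farr S v'))" by simp
  hence "x \<bullet> farr S v = farr S v'" using xd(3,6,9) S Tx Tx' by simp
  hence yv: "y \<bullet> v = v'"
    by (intro shift_faithful[of "y \<bullet> v" v']) (use y v v' Tx Tx' in simp_all)
  have "Neg Q (farr S w) = Neg Q (farr S w' \<bullet> x)"
    using xd(12) xd(3,6,9) S Tx Tx' O by simp
  hence "Neg Q (Neg Q (farr S w)) = Neg Q (Neg Q (farr S w' \<bullet> x))" by simp
  hence "farr S w = farr S w' \<bullet> x" using xd(3,6,9) S Tx Tx' by simp
  hence wy: "w = w' \<bullet> y"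
    by (intro shift_faithful[of w "w' \<bullet> y"]) (use y w w' Tx Tx' in simp_all)
  have "triangle_iso Q S (u, v, w) (u, v', w')"
    by (rule triangle_isoI[OF T T' _ _ y_iso, of "cls (Ident C (Dom Q u))" "cls (Ident C (Dom Q v))"])
      (use y u v w v' w' Tx Tx' O yv wy in \<open>simp_all add: cls_is_iso\<close>)
  thus ?thesis by (intro dist_iso_closed[OF d' triangle_iso_sym])
qed

text \<open>The third isomorphism theorem for the composable inflations \<open>f\<close> and
  \<open>f'\<close>: the cokernels of \<open>f\<close>, of \<open>f' \<cdot> f\<close> and of
  \<open>f'\<close> form an exact pair.\<close>

lemma noether:
  assumes r: "(f, g) \<in> E" "(f', g') \<in> E" "(f' \<cdot> f, g'') \<in> E" and D: "Cod C f = Dom C f'"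
    and p: "p \<in> Arr C" "Dom C p = Cod C g" "Cod C p = Cod C g''" "p \<cdot> g = g'' \<cdot> f'"
    and q: "q \<in> Arr C" "Dom C q = Cod C g''" "Cod C q = Cod C g'" "q \<cdot> g'' = g'"
  shows "(p, q) \<in> E"
proof (rule deflation_E)
  note t = E_Arr[OF r(1)] E_Arr[OF r(2)] E_Arr[OF r(3)]
  have Dg: "Dom C g'' = Dom C g'" "Dom C (f' \<cdot> f) = Dom C f" using t D by simp_all
  have "g' \<in> deflations E" using r(2) by (auto simp: deflations_def)
  thus qd: "q \<in> deflations E"
    by (intro deflation_cancel[of q g'']) (use q t in simp_all)
  have "is_mono C p"
  proof (rule is_monoI)
    fix a assume a: "a \<in> Arr C" "Cod C a = Dom C p" "p \<cdot> a = Null C (Dom C a) (Cod C p)"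
    \<comment> \<open>A generalized element: along a deflation \<open>\<rho>\<close> from a
      projective, \<open>a\<close> lifts through \<open>g\<close> to \<open>b\<close>. That
      \<open>f' \<cdot> b\<close> comes from \<open>f' \<cdot> f\<close> puts \<open>b\<close> in
      the image of \<open>f\<close>, so \<open>a \<cdot> \<rho>\<close> is zero, and
      \<open>\<rho>\<close> is epi.\<close>
    obtain \<kappa> \<rho> where K: "(\<kappa>, \<rho>) \<in> E" "Cod C \<rho> = Dom C a" "Dom C \<rho> \<in> \<P>"
      by (rule projective_rowE[of "Dom C a"]) (use a in simp_all)
    note k = E_Arr[OF K(1)]
    obtain b where b: "b \<in> Arr C" "Dom C b = Dom C \<rho>" "Cod C b = Dom C g" "g \<cdot> b = a \<cdot> \<rho>"
      by (rule lift[OF r(1), of "a \<cdot> \<rho>"]) (use a k K p in simp_all)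
    have "g'' \<cdot> (f' \<cdot> b) = p \<cdot> (a \<cdot> \<rho>)"
      using Comp_reassoc[OF p(4), of b] b a(1,2) p(1-3) t D Dg by simp
    also have "\<dots> = Null C (Dom C \<rho>) (Cod C g'')"
      using Comp_reassoc[OF a(3), of \<rho>] a(1,2) k K(2) p(1-3) t by simp
    finally obtain y where y: "y \<in> Arr C" "Dom C y = Dom C \<rho>" "Cod C y = Dom C f" "(f' \<cdot> f) \<cdot> y = f' \<cdot> b"
      using kernel_factor[OF E_kernel[OF r(3)], of "f' \<cdot> b"] b t D Dg by (metis Comp_Arr)
    have eq: "f' \<cdot> (f \<cdot> y) = f' \<cdot> b" using y t D by simp
    have "f \<cdot> y = b"
      by (rule kernel_cancel[OF E_kernel[OF r(2)] _ _ _ _ _ eq]) (use y b t D in simp_all)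
    hence "g \<cdot> b = g \<cdot> (f \<cdot> y)" by simp
    also have "\<dots> = Null C (Dom C \<rho>) (Cod C g)" using Comp_reassoc[OF t(4), of y] y t by simp
    finally have e2: "a \<cdot> \<rho> = Null C (Dom C a) (Cod C g) \<cdot> \<rho>" using b k K(2) a(1) t by simp
    show "a = Null C (Dom C a) (Dom C p)"
      unfolding p(2)
      by (rule cokernel_cancel[OF E_cokernel[OF K(1)] _ _ _ _ _ e2]) (use a(1,2) p(2) t K(2) in simp_all)
  qed (rule p)
  moreover have "is_cokernel C q p"
  proof (rule is_cokernelI)
    have "(q \<cdot> p) \<cdot> g = g' \<cdot> f'"
      using Comp_reassoc[OF q(4), of f'] p q(1-3) t Dg by simp
    also have "\<dots> = Null C (Dom C p) (Cod C q) \<cdot> g" using t p(1-3) q(1-3) D by simp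
    finally have eq: "(q \<cdot> p) \<cdot> g = Null C (Dom C p) (Cod C q) \<cdot> g" .
    show "q \<cdot> p = Null C (Dom C p) (Cod C q)"
      by (rule cokernel_cancel[OF E_cokernel[OF r(1)] _ _ _ _ _ eq]) (use p(1-3) q(1-3) t in simp_all)
    fix y assume y: "y \<in> Arr C" "Dom C y = Cod C p" "y \<cdot> p = Null C (Dom C p) (Cod C y)"
    \<comment> \<open>This composite is \<open>y \<cdot> p \<cdot> g\<close>, hence zero, so
      \<open>y \<cdot> g''\<close> descends along \<open>g'\<close>. The same factor serves for
      \<open>q\<close> because \<open>g''\<close> is epi.\<close>
    have "(y \<cdot> g'') \<cdot> f' = Null C (Dom C f') (Cod C y)"
      using Comp_reassoc[OF y(3), of g] y(1,2) p t Dg D by simp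
    then obtain s where s: "s \<in> Arr C" "Dom C s = Cod C g'" "Cod C s = Cod C y" "s \<cdot> g' = y \<cdot> g''"
      using cokernel_factor[OF E_cokernel[OF r(2)], of "y \<cdot> g''"] y(1,2) t p Dg by (metis Comp_Arr)
    have eq: "(s \<cdot> q) \<cdot> g'' = y \<cdot> g''" using s q t by simp
    have "s \<cdot> q = y"
      by (rule cokernel_cancel[OF E_cokernel[OF r(3)] _ _ _ _ _ eq]) (use s q y p t in simp_all)
    thus "\<exists>k \<in> Arr C. Dom C k = Cod C q \<and> Cod C k = Cod C y \<and> k \<cdot> q = y"
      using s q by auto
  next
    show "is_epi C q" using qd E_cokernel cokernel_is_epi by (auto simp: deflations_def)
  qed (use p q in simp_all)
  ultimately show "short_exact C p q" by (rule mono_cokernel_short_exact)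
qed

text \<open>For composable inflations the octahedron consists of the three cokernels. Each identity
  between third arrows is settled by \<open>induces_unique\<close>, as two maps of exact pairs with
  the same left-hand arrow.\<close>

lemma std_octahedron:
  assumes s: "std f g h" "std f' g' h'" and D: "Cod C f = Dom C f'"
  obtains g'' h'' p q where "std (f' \<cdot> f) g'' h''" "(cls p, cls q, farr S (cls g) \<bullet> cls h') \<in> \<Delta>"
    "p \<in> Arr C" "Dom C p = Cod C g" "Cod C p = Cod C g''"
    "q \<in> Arr C" "Dom C q = Cod C g''" "Cod C q = Cod C g'"
    "p \<cdot> g = g'' \<cdot> f'" "q \<cdot> g'' = g'" "cls (h'' \<cdot> p) = cls h"
    "cls h' \<bullet> cls q = farr S (cls f) \<bullet> cls h''"
proof -
  note t = stdD[OF s(1)] and t' = stdD[OF s(2)]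
  have "f \<in> inflations E" "f' \<in> inflations E" using t(1) t'(1) by (auto simp: inflations_def)
  hence "f' \<cdot> f \<in> inflations E" using D by (rule inflation_Comp)
  then obtain g'' where E: "(f' \<cdot> f, g'') \<in> E" by (auto simp: inflations_def)
  obtain h'' where s'': "std (f' \<cdot> f) g'' h''" by (rule std_ex[OF E])
  note t'' = stdD[OF s'']
  let ?X = "Dom C f" and ?Y = "Dom C f'"
  have X: "?X \<in> Obj C" and Y: "?Y \<in> Obj C" and O: "Cod C g \<in> Obj C" using t t' by simp_all
  have Dg: "Dom C (f' \<cdot> f) = ?X" "Dom C g'' = Dom C g'" "Cod C (f' \<cdot> f) = Dom C g'" "Dom C g = ?Y"
    using t t' t'' D by simp_all
  have e1: "f' \<cdot> f = (f' \<cdot> f) \<cdot> Ident C ?X" using t t' D by simp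
  obtain p where p: "p \<in> Arr C" "Dom C p = Cod C g" "Cod C p = Cod C g''" "p \<cdot> g = g'' \<cdot> f'"
    "induces C (Ident C ?X) (f, g) (f' \<cdot> f, g'') p"
    by (rule cokernel_map[OF t(1) E t'(2) _ _ _ _ _ e1]) (use t t' X Dg in simp_all)
  have e2: "Ident C (Dom C g') \<cdot> (f' \<cdot> f) = f' \<cdot> f" using t t' D by simp
  obtain q where q: "q \<in> Arr C" "Dom C q = Cod C g''" "Cod C q = Cod C g'" "q \<cdot> g'' = g' \<cdot> Ident C (Dom C g')"
    "induces C f (f' \<cdot> f, g'') (f', g') q"
    by (rule cokernel_map[OF E t'(1) _ _ _ t(2) _ D e2]) (use t t' X Dg in simp_all)
  have q4: "q \<cdot> g'' = g'" using q(4) t' by simp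
  have pq: "(p, q) \<in> E" by (rule noether[OF t(1) t'(1) E D p(1-4) q(1-3) q4])
  obtain k where k: "std p q k" by (rule std_ex[OF pq])
  note tk = stdD[OF k]
  obtain rf where rf: "shifts f rf" by (rule shifts_ex[OF t(2)])
  note rf = rf shiftsD[OF rf]
  obtain rg where rg: "shifts g rg" by (rule shifts_ex[OF t(3)])
  note rg = rg shiftsD[OF rg]
  note rf = rf[unfolded D] and rg = rg[unfolded Dg]
  have t8: "induces C (Ident C ?X) (f' \<cdot> f, g'') (\<iota> ?X, \<pi> ?X) h''" using t''(8) Dg by simp
  have tk8: "induces C (Ident C (Cod C g)) (p, q) (\<iota> (Cod C g), \<pi> (Cod C g)) k" using tk(8) p by simp
  have h1: "cls (h'' \<cdot> p) = cls h"
    by (rule induces_unique[OF t(1) row(1)[OF X] row(3)[OF X]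
        induces_Comp[OF p(5) t8 t(1) E row(1)[OF X]] t(8)]) (use X in simp)
  have h2: "cls (h' \<cdot> q) = cls (rf \<cdot> h'')"
    by (rule induces_unique[OF E row(1)[OF Y] row(3)[OF Y]
        induces_Comp[OF q(5) t'(8) E t'(1) row(1)[OF Y]]
        induces_Comp[OF t8 rf(1) E row(1)[OF X] row(1)[OF Y]]]) (use t D X Y in simp)
  \<comment> \<open>With \<open>g''\<close> in the middle, \<open>g\<close> on the left and an
    identity on the right, \<open>(f', g')\<close> maps to \<open>(p, q)\<close>. This expresses the
    third arrow of \<open>(p, q)\<close> through \<open>h'\<close> and the shift of
    \<open>g\<close>.\<close>
  have gi: "induces C g (f', g') (p, q) (Ident C (Cod C g'))"
    by (rule inducesI[of _ _ _ _ _ _ g'']) (use t t' p q q4 Dg t'' D in simp_all)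
  have h3: "cls (k \<cdot> Ident C (Cod C g')) = cls (rg \<cdot> h')"
    by (rule induces_unique[OF t'(1) row(1)[OF O] row(3)[OF O]
        induces_Comp[OF gi tk8 t'(1) pq row(1)[OF O]]
        induces_Comp[OF t'(8) rg(1) t'(1) row(1)[OF Y] row(1)[OF O]]]) (use t Dg O Y in simp)
  have kc: "cls k = farr S (cls g) \<bullet> cls h'"
    using h3 rg tk t' q by simp
  have dk: "(cls p, cls q, cls k) \<in> \<Delta>" by (rule std_dist[OF k])
  show thesis
    by (rule that[OF s'' _ p(1-3) q(1-3) p(4) q4 h1])
      (use dk kc h2 rf t' q t'' Dg in simp_all)
qed

text \<open>\<open>u\<close> and \<open>v\<close> are replaced by composable inflations
  \<open>f1\<close> and \<open>f2\<close>. Fill-ins give isomorphisms \<open>c1\<close>,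
  \<open>c2\<close>, \<open>c3\<close> from the given triangles to the standard ones, along which
  the octahedron of inflations is carried back.\<close>

lemma octahedral:
  assumes D: "Cod Q u = Dom Q v" and d: "(u, j, k) \<in> \<Delta>" "(v, l, i) \<in> \<Delta>" "(v \<bullet> u, m, n) \<in> \<Delta>"
  shows "\<exists>f \<in> Hom Q (Cod Q j) (Cod Q m). \<exists>g \<in> Hom Q (Cod Q m) (Cod Q l).
     (f, g, farr S j \<bullet> i) \<in> \<Delta> \<and> f \<bullet> j = m \<bullet> v \<and> n \<bullet> f = k \<and>
     g \<bullet> m = l \<and> i \<bullet> g = farr S u \<bullet> n"
proof -
  note T = d[THEN dist_triangle, unfolded triangle_iff fobj_shift]
  have u: "u \<in> Arr Q" and v: "v \<in> Arr Q" using T by simp_all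
  obtain f1 g1 h1 b where s1: "std f1 g1 h1" "Dom C f1 = Dom Q u" and b: "b \<in> Arr Q" "Dom Q b = Cod Q u"
    "Cod Q b = Dom C g1" "is_iso Q b" "b \<bullet> u = cls f1" by (rule std_cone[OF u])
  obtain b' where b': "b' \<in> Arr Q" "Dom Q b' = Dom C g1" "Cod Q b' = Cod Q u"
    "b' \<bullet> b = Ident Q (Cod Q u)" "b \<bullet> b' = Ident Q (Dom C g1)" "is_iso Q b'"
    using Q.is_isoE[OF b(4)] b by metis
  \<comment> \<open>The second replacement is made for \<open>v \<bullet> b'\<close> rather than
    \<open>v\<close>, so that its inflation starts at the new codomain of the first one.\<close>
  have vb: "v \<bullet> b' \<in> Arr Q" using v b' D by simp
  obtain f2 g2 h2 e where s2: "std f2 g2 h2" "Dom C f2 = Dom Q (v \<bullet> b')" and e: "e \<in> Arr Q"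
    "Dom Q e = Cod Q (v \<bullet> b')" "Cod Q e = Dom C g2" "is_iso Q e" "e \<bullet> (v \<bullet> b') = cls f2"
    by (rule std_cone[OF vb])
  note t1 = stdD[OF s1(1)] and t2 = stdD[OF s2(1)]
  have D2: "Dom C f2 = Dom C g1" and De: "Dom Q e = Cod Q v" using s2 e v b' D by simp_all
  have D12: "Cod C f1 = Dom C f2" using D2 t1 by simp
  obtain g3 h3 p q where s3: "std (f2 \<cdot> f1) g3 h3" and dpq: "(cls p, cls q, farr S (cls g1) \<bullet> cls h2) \<in> \<Delta>"
    and p: "p \<in> Arr C" "Dom C p = Cod C g1" "Cod C p = Cod C g3"
    and q: "q \<in> Arr C" "Dom C q = Cod C g3" "Cod C q = Cod C g2"
    and pq: "p \<cdot> g1 = g3 \<cdot> f2" "q \<cdot> g3 = g2" "cls (h3 \<cdot> p) = cls h1"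
      "cls h2 \<bullet> cls q = farr S (cls f1) \<bullet> cls h3"
    by (rule std_octahedron[OF s1(1) s2(1) D12])
  note t3 = stdD[OF s3]
  have D3: "Dom C (f2 \<cdot> f1) = Dom C f1" "Dom C g3 = Dom C g2" using t1 t2 t3 D12 by simp_all
  have UO: "Dom Q u \<in> Obj C" using Q.Dom_Obj[OF u] by simp
  let ?I = "cls (Ident C (Dom Q u))"
  have ev: "e \<bullet> v = cls f2 \<bullet> b"
  proof -
    have "cls f2 \<bullet> b = e \<bullet> (v \<bullet> (b' \<bullet> b))"
      unfolding e(5)[symmetric] using e(1-3) v b b' De D by simp
    also have "\<dots> = e \<bullet> v" unfolding b'(4) using v D by simp
    finally show ?thesis ..
  qed
  have evu: "e \<bullet> (v \<bullet> u) = cls (f2 \<cdot> f1)"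
  proof -
    have "e \<bullet> (v \<bullet> u) = cls f2 \<bullet> (b \<bullet> u)"
      using Q.Comp_reassoc[OF ev, of u] e(1-3) v u b(1-3) t2 D D2 De by simp
    thus ?thesis unfolding b(5) using t1 t2 D12 by simp
  qed
  obtain c1 where c1: "triangle_map Q S (u, j, k) (cls f1, cls g1, cls h1) ?I b c1"
    by (rule dist_fill[OF d(1) std_dist[OF s1(1)], of ?I b]) (use u b s1 t1 T UO in simp_all)
  obtain c2 where c2: "triangle_map Q S (v, l, i) (cls f2, cls g2, cls h2) b e c2"
    by (rule dist_fill[OF d(2) std_dist[OF s2(1)], of b e]) (use v b e t2 T D D2 De ev in simp_all)
  obtain c3 where c3: "triangle_map Q S (v \<bullet> u, m, n) (cls (f2 \<cdot> f1), cls g3, cls h3) ?I e c3"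
    by (rule dist_fill[OF d(3) std_dist[OF s3], of ?I e])
      (use u v e s1 t1 t2 t3 D3 T UO evu D De in \<open>simp_all del: quot_Comp\<close>)
  have I_iso: "is_iso Q ?I" using UO by (simp add: cls_is_iso)
  have iso: "is_iso Q c1" "is_iso Q c2" "is_iso Q c3"
    by (rule dist_map_iso[OF d(1) std_dist[OF s1(1)] c1 I_iso b(4)],
        rule dist_map_iso[OF d(2) std_dist[OF s2(1)] c2 b(4) e(4)],
        rule dist_map_iso[OF d(3) std_dist[OF s3] c3 I_iso e(4)])
  note m1 = triangle_mapD[OF c1] and m2 = triangle_mapD[OF c2] and m3 = triangle_mapD[OF c3]
  have ty: "Dom Q c1 = Cod Q j" "Cod Q c1 = Cod C g1" "Dom Q c2 = Cod Q l" "Cod Q c2 = Cod C g2"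
    "Dom Q c3 = Cod Q m" "Cod Q c3 = Cod C g3"
    using m1(6,9) m2(6,9) m3(6,9) T t1(2-7) t2(2-7) t3(2-7) by simp_all
  obtain c2' where "c2' \<in> Arr Q" "Dom Q c2' = Cod Q c2" "Cod Q c2' = Dom Q c2"
    "c2' \<bullet> c2 = Ident Q (Dom Q c2)" "c2 \<bullet> c2' = Ident Q (Cod Q c2)"
    by (rule Q.is_isoE[OF iso(2)])
  note i2 = this[unfolded ty]
  obtain c3' where "c3' \<in> Arr Q" "Dom Q c3' = Cod Q c3" "Cod Q c3' = Dom Q c3"
    "c3' \<bullet> c3 = Ident Q (Dom Q c3)" "c3 \<bullet> c3' = Ident Q (Cod Q c3)"
    by (rule Q.is_isoE[OF iso(3)])
  note i3 = this[unfolded ty]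
  note re = Q.Comp_reassoc[OF i2(4)] Q.Comp_reassoc[OF i2(5)] Q.Comp_reassoc[OF i3(4)] Q.Comp_reassoc[OF i3(5)]
  \<comment> \<open>The arrows of the triangle of cokernels, conjugated by the comparison
    isomorphisms.\<close>
  let ?f = "c3' \<bullet> (cls p \<bullet> c1)" and ?g = "c2' \<bullet> (cls q \<bullet> c3)"
  have f: "?f \<in> Arr Q" "Dom Q ?f = Cod Q j" "Cod Q ?f = Cod Q m"
    and g: "?g \<in> Arr Q" "Dom Q ?g = Cod Q m" "Cod Q ?g = Cod Q l"
    using m1(3) m3(3) i2(1-3) i3(1-3) p q ty by simp_all
  have fj: "?f \<bullet> j = m \<bullet> v"
  proof -
    have "?f \<bullet> j = c3' \<bullet> ((cls p \<bullet> cls g1) \<bullet> b)"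
      using m1(1-9,11) i3(1-3) p ty T b(1-3) t1 by (simp del: quot_Comp)
    also have "\<dots> = c3' \<bullet> ((cls g3 \<bullet> cls f2) \<bullet> b)" using p t1 t2 t3 pq(1) D3 by simp
    also have "\<dots> = c3' \<bullet> (cls g3 \<bullet> (e \<bullet> v))"
      unfolding ev using i3(1-3) b(1-3) t1 t2 t3 D2 D3 by (simp del: quot_Comp)
    also have "\<dots> = c3' \<bullet> (c3 \<bullet> (m \<bullet> v))"
      using Q.Comp_reassoc[OF m3(11)[symmetric], of v] e(1-3) t3 v T D De ty D3 m3(3) u by simp
    also have "\<dots> = m \<bullet> v" using re(3)[of "m \<bullet> v"] m3(3) i3(1-3) ty T v u D by simp
    finally show ?thesis .
  qed
  have SI: "farr S ?I = cls (Ident C (Cod C (\<pi> (Dom Q u))))" using UO by simp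
  have k': "cls h1 \<bullet> c1 = k" using m1(12) UO T by simp
  have n': "cls h3 \<bullet> c3 = n" using m3(12) UO T u v D by simp
  have nf: "n \<bullet> ?f = k"
  proof -
    have "n \<bullet> ?f = (cls h3 \<bullet> cls p) \<bullet> c1"
      unfolding n'[symmetric] using re(4)[of "cls p \<bullet> c1"] m1(3) m3(3) i3(1-3) p ty t3 by (simp del: quot_Comp)
    also have "\<dots> = cls h1 \<bullet> c1" using pq(3) t3 p by simp
    finally show ?thesis unfolding k' .
  qed
  have gm: "?g \<bullet> m = l"
  proof -
    have "?g \<bullet> m = c2' \<bullet> ((cls q \<bullet> cls g3) \<bullet> e)"
      using m3(1-9,11) i2(1-3) q ty T e(1-3) t3 D3 by (simp del: quot_Comp)
    also have "\<dots> = c2' \<bullet> (c2 \<bullet> l)" using m2(11) pq(2) q t3 by simp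
    also have "\<dots> = l" using re(1)[of l] m2(3) i2(1-3) ty T by simp
    finally show ?thesis .
  qed
  have Su: "farr S u \<in> Arr Q" "Dom Q (farr S u) = Cod C (\<pi> (Dom Q u))" "Cod Q (farr S u) = Cod C (\<pi> (Cod Q u))"
    "farr S b \<in> Arr Q" "Dom Q (farr S b) = Cod C (\<pi> (Cod Q u))" "Cod Q (farr S b) = Cod C (\<pi> (Dom C g1))"
    "farr S b' \<in> Arr Q" "Dom Q (farr S b') = Cod C (\<pi> (Dom C g1))" "Cod Q (farr S b') = Cod C (\<pi> (Cod Q u))"
    using farr_Arr[OF u] farr_Arr[OF b(1)] farr_Arr[OF b'(1)] b b' by simp_all
  have VO: "Cod Q u \<in> Obj C" using Q.Cod_Obj[OF u] by simp
  have Sbb: "farr S b' \<bullet> farr S b = cls (Ident C (Cod C (\<pi> (Cod Q u))))"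
    using farr_Comp[of b b'] b b' VO by simp
  have ig: "i \<bullet> ?g = farr S u \<bullet> n"
  proof -
    have ia: "i \<in> Arr Q" "Dom Q i = Cod Q l" "Cod Q i = Cod C (\<pi> (Cod Q u))" using T D by simp_all
    \<comment> \<open>The comparison square relates \<open>i\<close> to \<open>h2\<close> only after
      \<open>farr S b\<close>; the equation is proved with this factor in front, and
      \<open>farr S b'\<close> then removes it.\<close>
    have "farr S b \<bullet> (i \<bullet> ?g) = cls h2 \<bullet> (c2 \<bullet> ?g)"
      using Q.Comp_reassoc[OF m2(12), of ?g] Su ia m2(3) g ty t2 by simp
    also have "\<dots> = (cls h2 \<bullet> cls q) \<bullet> c3"
      using re(2)[of "cls q \<bullet> c3"] m2(3) m3(3) i2(1-3) q ty t2 by (simp del: quot_Comp)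
    also have "\<dots> = farr S (cls f1) \<bullet> n"
      unfolding pq(4) n'[symmetric] using t1 t3 m3(3) ty D3 by (simp del: quot_Comp)
    also have "\<dots> = farr S b \<bullet> (farr S u \<bullet> n)"
      unfolding b(5)[symmetric] using b(1-3) u T Su v D by simp
    finally have eq: "farr S b \<bullet> (i \<bullet> ?g) = farr S b \<bullet> (farr S u \<bullet> n)" .
    have cancel: "farr S b' \<bullet> (farr S b \<bullet> x) = x" if "x \<in> Arr Q" "Cod Q x = Cod C (\<pi> (Cod Q u))" for x
      using Q.Comp_reassoc[OF Sbb, of x] Su that by simp
    have "i \<bullet> ?g = farr S b' \<bullet> (farr S b \<bullet> (i \<bullet> ?g))"
      by (rule cancel[symmetric]) (use ia g in simp_all)
    also have "\<dots> = farr S u \<bullet> n"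
      unfolding eq by (rule cancel) (use Su T u v D in simp_all)
    finally show ?thesis .
  qed
  have Tpq: "is_triangle Q S (cls p, cls q, farr S (cls g1) \<bullet> cls h2)" by (rule dist_triangle[OF dpq])
  have Sj: "farr S j \<in> Arr Q" "Dom Q (farr S j) = Cod C (\<pi> (Cod Q u))" "Cod Q (farr S j) = Cod C (\<pi> (Cod Q j))"
    "farr S c1 \<in> Arr Q" "Dom Q (farr S c1) = Cod C (\<pi> (Cod Q j))" "Cod Q (farr S c1) = Cod C (\<pi> (Cod C g1))"
    "farr S (cls g1) \<in> Arr Q" "Dom Q (farr S (cls g1)) = Cod C (\<pi> (Dom C g1))"
      "Cod Q (farr S (cls g1)) = Cod C (\<pi> (Cod C g1))"
    using farr_Arr[of j] farr_Arr[OF m1(3)] farr_Arr[of "cls g1"] T ty t1 by simp_all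
  have "triangle_iso Q S (?f, ?g, farr S j \<bullet> i) (cls p, cls q, farr S (cls g1) \<bullet> cls h2)"
  proof (rule triangle_isoI[OF _ Tpq iso(1,3,2)])
    show "is_triangle Q S (?f, ?g, farr S j \<bullet> i)"
      using f g Sj T D by (simp add: triangle_iff)
    show "c3 \<bullet> ?f = cls p \<bullet> c1"
      using re(4)[of "cls p \<bullet> c1"] m1(3) m3(3) i3(1-3) p ty by simp
    show "c2 \<bullet> ?g = cls q \<bullet> c3"
      using re(2)[of "cls q \<bullet> c3"] m2(3) m3(3) i2(1-3) q ty by simp
    have "farr S c1 \<bullet> farr S j = farr S (cls g1) \<bullet> farr S b"
      using farr_Comp[of j c1] farr_Comp[of b "cls g1"] m1(3,11) ty T b(1-3) t1 by simp
    hence "farr S c1 \<bullet> (farr S j \<bullet> i) = farr S (cls g1) \<bullet> (farr S b \<bullet> i)"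
      using Q.Comp_reassoc[of "farr S c1" "farr S j" _ i] Sj Su T D by simp
    also have "\<dots> = farr S (cls g1) \<bullet> (cls h2 \<bullet> c2)" unfolding m2(12) ..
    also have "\<dots> = (farr S (cls g1) \<bullet> cls h2) \<bullet> c2"
      using Sj t2 m2(3) ty D2 by simp
    finally show "farr S c1 \<bullet> (farr S j \<bullet> i) = (farr S (cls g1) \<bullet> cls h2) \<bullet> c2" .
  qed (use f g Sj T D ty p q t2 D2 in simp_all)
  hence "(?f, ?g, farr S j \<bullet> i) \<in> \<Delta>" by (intro dist_iso_closed[OF dpq triangle_iso_sym])
  thus ?thesis using f g fj nf gm ig by (intro bexI[of _ ?f] bexI[of _ ?g]) (simp_all add: in_Hom)
qed

lemma happel: "triangulated_category Q S \<Delta>"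
proof (intro triangulated_category.intro triangulated_category_axioms.intro)
  show "additive_category Q" by (rule Q.additive_category_axioms)
  show "additive_functor Q Q S" by (rule shift_functor_additive)
  show "is_equivalence Q Q S" by (rule shift_equivalence)
next
  fix X Z assume "X \<in> Obj Q" "zero_object Q Z"
  thus "(Ident Q X, Null Q X Z, Null Q Z (fobj S X)) \<in> \<Delta>" by (intro dist_Ident) simp_all
next
  fix u v w assume "is_triangle Q S (u, v, w)"
  thus "(u, v, w) \<in> \<Delta> \<longleftrightarrow> (v, w, Neg Q (farr S u)) \<in> \<Delta>"
    using dist_rotate dist_rotate_back by blast
next
  fix u v w u' v' w' a b
  assume d: "(u, v, w) \<in> \<Delta>" "(u', v', w') \<in> \<Delta>"
    and a: "a \<in> Hom Q (Dom Q u) (Dom Q u')" and b: "b \<in> Hom Q (Dom Q v) (Dom Q v')"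
    and eq: "b \<bullet> u = u' \<bullet> a"
  obtain x where "triangle_map Q S (u, v, w) (u', v', w') a b x"
    by (rule dist_fill[OF d _ _ _ _ _ _ eq]) (use a b in \<open>simp_all add: in_Hom\<close>)
  thus "\<exists>x. triangle_map Q S (u, v, w) (u', v', w') a b x" ..
qed (fact dist_triangle dist_iso_closed dist_cone octahedral)+

end

text \<open>The arrow \<open>h\<close> depends on the chosen extension while its class does not,
  hence uniqueness concerns \<open>\<psi>\<close> and not \<open>h\<close>.\<close>

lemma (in frobenius_choice) std_unique:
  assumes "(f, g) \<in> E"
  shows "\<exists>!\<psi>. \<exists>h. induces C (Ident C (Dom C f)) (f, g) (c (Dom C f)) h \<and> \<psi> = cls h"
proof -
  have X: "Dom C f \<in> Obj C" using E_Arr[OF assms] by simp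
  obtain h where "std f g h" by (rule std_ex[OF assms])
  hence h: "induces C (Ident C (Dom C f)) (f, g) (\<iota> (Dom C f), \<pi> (Dom C f)) h" by (rule stdD)
  show ?thesis
  proof (rule ex1I[of _ "cls h"])
    show "\<exists>h'. induces C (Ident C (Dom C f)) (f, g) (c (Dom C f)) h' \<and> cls h = cls h'"
      using h by auto
  next
    fix \<psi> assume "\<exists>h'. induces C (Ident C (Dom C f)) (f, g) (c (Dom C f)) h' \<and> \<psi> = cls h'"
    then obtain h' where h': "induces C (Ident C (Dom C f)) (f, g) (\<iota> (Dom C f), \<pi> (Dom C f)) h'" "\<psi> = cls h'"
      by auto
    show "\<psi> = cls h"
      unfolding h'(2) by (rule induces_unique[OF assms row(1)[OF X] row(3)[OF X] h'(1) h refl])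
  qed
qed

section \<open>Faithful functors with both adjoints\<close>

lemma (in faithful_right_adjoint) deflation_F_split:
  "\<lbrakk>g \<in> deflations (F_split A B F); is_kernel A f g\<rbrakk> \<Longrightarrow> (f, g) \<in> F_split A B F"
  by (simp add: F_split_iff deflations_iff)

text \<open>The prefix \<open>O\<close> carries the copy of the theory for the opposite categories.
  By \<open>op_E\<close> its pairs are those of \<open>E\<close> reversed, so its deflations are the
  inflations of \<open>E\<close>.\<close>

locale faithful_two_sided_adjoint = faithful_right_adjoint A B F L \<phi> +
  O: faithful_right_adjoint "op_category A" "op_category B" F R \<psi>
  for A :: "('o, 'm, 'y) preadditive_data_scheme" and B :: "('p, 'n, 'z) preadditive_data_scheme"
    and F :: "('o, 'm, 'p, 'n) functor_data" and L R :: "('p, 'n, 'o, 'm) functor_data" and \<phi> \<psi>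
begin

abbreviation "E \<equiv> F_split A B F"

lemma op_E: "F_split (op_category A) (op_category B) F = E\<inverse>"
  by (rule op_F_split) (rule B.preadditive_category_axioms)

lemma op_deflations: "deflations (F_split (op_category A) (op_category B) F) = inflations E"
  by (simp add: op_E op_inflations)

lemma inflation_F_split: "\<lbrakk>f \<in> inflations E; is_cokernel A g f\<rbrakk> \<Longrightarrow> (f, g) \<in> E"
  using O.deflation_F_split[of f g] by (simp add: op_E op_inflations)

lemma inflations_Comp:
  "\<lbrakk>i \<in> inflations E; i' \<in> inflations E; Cod A i = Dom A i'\<rbrakk> \<Longrightarrow> i' \<cdot>\<^bsub>A\<^esub> i \<in> inflations E"
  using O.deflations_Comp[of i' i] by (simp add: op_deflations)

lemma inflations_cancel:
  "\<lbrakk>i' \<cdot>\<^bsub>A\<^esub> i \<in> inflations E; i \<in> Arr A; i' \<in> Arr A; Cod A i = Dom A i'\<rbrakk> \<Longrightarrow> i \<in> inflations E"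
  using O.deflations_cancel[of i i'] by (simp add: op_deflations)

lemma enough_injectives: "enough_injectives A E"
  unfolding enough_injectives_def
proof
  fix X assume X: "X \<in> Obj A"
  have inj: "projectives (op_category A) (E\<inverse>) = injectives A E"
    by (rule op_injectives) (rule F_split_short_exact)
  obtain g f where "(g, f) \<in> E\<inverse>" "Cod A f \<in> injectives A E" "Dom A f = X"
    using O.enough_projectives X unfolding enough_projectives_def op_E inj by fastforce
  thus "\<exists>(f, g) \<in> E. Dom A f = X \<and> Cod A f \<in> injectives A E"
    by (intro bexI[of _ "(f, g)"]) simp_all
qed

lemma exact_structure: "exact_structure A E"
proof (intro exact_structure.intro exact_structure_axioms.intro A.additive_category_axioms)
  fix f g assume "(f, g) \<in> E"
  thus "is_kernel A f g \<and> is_cokernel A g f"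
    using F_split_short_exact by (simp add: short_exact_def)
next
  fix Z assume "zero_object A Z"
  hence "Z \<in> Obj A" by (simp add: zero_object_def)
  thus "Ident A Z \<in> deflations E" "Ident A Z \<in> inflations E"
    using zero_deflation O.zero_deflation[of Z] by (simp_all add: op_deflations)
next
  fix i f assume "i \<in> inflations E" "f \<in> Arr A" "Dom A f = Dom A i"
  thus "\<exists>i' f'. is_pushout A f i i' f' \<and> i' \<in> inflations E"
    using O.deflations_pullback[of i f] by (simp add: op_deflations)
qed (fact F_split_iso_closed deflations_Comp inflations_Comp deflations_pullback)+

lemma frobenius_exact:
  assumes "projectives A E = injectives A E"
  shows "frobenius_exact A E (projectives A E)"
proof (intro frobenius_exact.intro frobenius_exact_axioms.intro A.abelian_category_axioms)
  fix f g assume "short_exact A f g"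
  thus "f \<in> inflations E \<Longrightarrow> (f, g) \<in> E" "g \<in> deflations E \<Longrightarrow> (f, g) \<in> E"
    using inflation_F_split deflation_F_split by (simp_all add: short_exact_def)
qed (fact F_split_short_exact inflations_Comp inflations_cancel deflations_cancel enough_projectives
    enough_injectives refl assms)+

lemma ex_injective_choice: "\<exists>c. injective_choice A E c"
proof -
  have "\<forall>X \<in> Obj A. \<exists>r. r \<in> E \<and> Dom A (fst r) = X \<and> Cod A (fst r) \<in> injectives A E"
    using enough_injectives unfolding enough_injectives_def by fastforce
  thus ?thesis unfolding injective_choice_def by (rule bchoice)
qed

end

theorem theorem3p4:
  fixes A :: "('o, 'm, 'y) preadditive_data_scheme"
    and B :: "('p, 'n, 'z) preadditive_data_scheme"
    and F :: "('o, 'm, 'p, 'n) functor_data"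
    and L R :: "('p, 'n, 'o, 'm) functor_data"
  assumes "abelian_category A" and "abelian_category B"
    and "additive_functor A B F" and "faithful A F"
    and "adjoint B A L F" and "adjoint A B F R"
  defines "E \<equiv> F_split A B F"
  defines "\<P> \<equiv> projectives A E"
  shows "exact_structure A E \<and> enough_projectives A E \<and> enough_injectives A E \<and>
    (\<P> = injectives A E \<longrightarrow>
       equiv (Arr A) (quot_rel A \<P>) \<and>
       additive_functor A (quot_category A \<P>) (quot_functor A \<P>) \<and>
       (\<exists>c. injective_choice A E c) \<and>
       (\<forall>c. injective_choice A E c \<longrightarrow>
          (\<forall>a \<in> Arr A. \<exists>h. induces A a (c (Dom A a)) (c (Cod A a)) h) \<and>
          (\<forall>a h. induces A a (c (Dom A a)) (c (Cod A a)) h \<longrightarrow>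
             farr (shift_functor A \<P> c) (quot_class A \<P> a) = quot_class A \<P> h) \<and>
          (\<forall>(f, g) \<in> E. \<exists>!\<psi>. \<exists>h.
             induces A (Ident A (Dom A f)) (f, g) (c (Dom A f)) h \<and> \<psi> = quot_class A \<P> h) \<and>
          triangulated_category (quot_category A \<P>) (shift_functor A \<P> c)
            (distinguished_triangles A E \<P> c)))"
proof -
  interpret A: abelian_category A by fact
  interpret B: abelian_category B by fact
  obtain \<phi> where \<phi>: "adjunction B A L F \<phi>" using assms(5) unfolding adjoint_def ..
  obtain \<psi> where \<psi>: "adjunction (op_category B) (op_category A) R F \<psi>"
    using op_adjoint[OF assms(6)] unfolding adjoint_def ..
  interpret OA: abelian_category "op_category A" by (rule op_abelian) fact
  interpret OB: abelian_category "op_category B" by (rule op_abelian) fact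
  interpret faithful_two_sided_adjoint A B F L R \<phi> \<psi>
  proof unfold_locales
    show "is_functor A B F" using \<open>additive_functor A B F\<close> by (simp add: additive_functor_def)
    show "is_functor (op_category A) (op_category B) F"
      using op_additive_functor[OF \<open>additive_functor A B F\<close>] by (simp add: additive_functor_def)
  qed (fact \<phi> \<psi> assms(3,4) op_additive_functor[OF assms(3)] op_faithful[OF assms(4)])+
  show ?thesis
  proof (intro conjI impI allI)
    assume eq: "\<P> = injectives A E"
    interpret frobenius_exact A E \<P>
      unfolding \<P>_def E_def by (rule frobenius_exact) (use eq in \<open>simp add: \<P>_def E_def\<close>)
    show "equiv (Arr A) (quot_rel A \<P>)" by (rule quot_equiv)
    show "additive_functor A (quot_category A \<P>) (quot_functor A \<P>)" by (rule quot_functor_additive)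
    show "\<exists>c. injective_choice A E c" unfolding E_def by (rule ex_injective_choice)
    fix c assume "injective_choice A E c"
    then interpret frobenius_choice A E \<P> c by unfold_locales
    show "\<forall>a \<in> Arr A. \<exists>h. induces A a (c (Dom A a)) (c (Cod A a)) h"
    proof
      fix a assume "a \<in> Arr A"
      then obtain h where "shifts a h" by (rule shifts_ex)
      thus "\<exists>h. induces A a (c (Dom A a)) (c (Cod A a)) h" by auto
    qed
    show "farr (shift_functor A \<P> c) (quot_class A \<P> a) = quot_class A \<P> h"
      if "induces A a (c (Dom A a)) (c (Cod A a)) h" for a h
      by (rule shift_cls) (use that in simp)
    show "\<forall>(f, g) \<in> E. \<exists>!\<psi>. \<exists>h.
        induces A (Ident A (Dom A f)) (f, g) (c (Dom A f)) h \<and> \<psi> = quot_class A \<P> h"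
    proof
      fix x assume x: "x \<in> E"
      obtain f g where fg: "x = (f, g)" by (cases x)
      show "case x of (f, g) \<Rightarrow> \<exists>!\<psi>. \<exists>h.
          induces A (Ident A (Dom A f)) (f, g) (c (Dom A f)) h \<and> \<psi> = quot_class A \<P> h"
        unfolding fg prod.case by (rule std_unique) (use x fg in simp)
    qed
    show "triangulated_category (quot_category A \<P>) (shift_functor A \<P> c)
        (distinguished_triangles A E \<P> c)"
      by (rule happel)
  next
    show "exact_structure A E" unfolding E_def by (rule exact_structure)
    show "enough_projectives A E" unfolding E_def by (rule enough_projectives)
    show "enough_injectives A E" unfolding E_def by (rule enough_injectives)
  qed
qed

end
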